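(* Every $n$-ary quasigroup of order $4$ (over $\Sigma=\{0,1,2,3\}$) is permutably reducible or semilinear.
   Context: Let $\Sigma$ be a nonempty set. An $n$-quasigroup ($n$-ary quasigroup) of order $|\Sigma|$ is a function $f:\Sigma^n\to\Sigma$ such that in the equality $z_0=f(z_1,\dots,z_n)$ knowledge of any $n$ of the elements $z_0,z_1,\dots,z_n$ uniquely specifies the remaining one. The associated predicate $f\langle z_0,z_1,\dots,z_n\rangle\in\{0,1\}$ equals $1$ iff $z_0=f(z_1,\dots,z_n)$. Order-$4$ quasigroups are considered over $\Sigma=\{0,1,2,3\}$. An $n$-quasigroup $f$ is permutably reducible if there exist $m\in\{2,\dots,n-1\}$, an $(n-m+1)$-quasigroup $h$, an $m$-quasigroup $g$ (both over $\Sigma$), and a permutation $\sigma$ of $\{1,\dots,n\}$ such that $f(x_1,\dots,x_n)= h(g(x_{\sigma(1)},\dots,x_{\sigma(m)}),x_{\sigma(m+1)},\dots,x_{\sigma(n)})$ for all $x_1,\dots,x_n\in\Sigma$. $n$-quasigroups $f$ and $g$ are isotopic if there are permutations $\tau_0,\dots,\tau_n$ of $\Sigma$ with $f(x_1,\dots,x_n)=\tau_0^{-1}g(\tau_1x_1,\dots,\tau_nx_n)$ for all $x_1,\dots,x_n$. Let $l(0)=l(1)=0$, $l(2)=l(3)=1$, and $L\langle x_0,\dots,x_n\rangle = l(x_0)\oplus\dots\oplus l(x_n)\oplus 1$, where $\oplus$ is addition modulo $2$. An $n$-quasigroup $f$ over $\{0,1,2,3\}$ is standardly semilinear if $f\langle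 x_0,\dots,x_n\rangle\le L\langle x_0,\dots,x_n\rangle$ for all $x_0,\dots,x_n\in\{0,1,2,3\}$. An $n$-quasigroup of order $4$ is semilinear if it is isotopic to some standardly semilinear $n$-quasigroup. *)

theory Defs
  imports Main "HOL-Library.NList" "HOL-Combinatorics.Permutations"
begin

text \<open>
  An element of \<open>\<Sigma>\<^sup>n\<close> is a list in \<^term>\<open>nlists n S\<close>, and an \<open>n\<close>-ary operation is a function on
  lists of which only the values on \<^term>\<open>nlists n S\<close> matter. List positions start at 0, so the
  argument \<open>x\<^sub>i\<close> of the operation is at position \<open>i - 1\<close> of the list \<open>[x\<^sub>1, \<dots>, x\<^sub>n]\<close>, whereas in a
  list \<open>[z\<^sub>0, z\<^sub>1, \<dots>, z\<^sub>n]\<close> of values related by the operation the element \<open>z\<^sub>i\<close> is at position \<open>i\<close>.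
\<close>

definition graph_pred :: "('a list \<Rightarrow> 'a) \<Rightarrow> 'a list \<Rightarrow> nat" where
  "graph_pred f zs = (if hd zs = f (tl zs) then 1 else 0)"

text \<open>
  In the last clause, the entry of \<open>zs\<close> at position \<open>i\<close> is irrelevant: the other \<open>n\<close> entries
  determine exactly one value for it.
\<close>

definition quasigroup :: "'a set \<Rightarrow> nat \<Rightarrow> ('a list \<Rightarrow> 'a) \<Rightarrow> bool" where
  "quasigroup S n f \<longleftrightarrow>
     (\<forall>xs\<in>nlists n S. f xs \<in> S) \<and>
     (\<forall>i\<le>n. \<forall>zs\<in>nlists (n + 1) S. \<exists>!z. z \<in> S \<and> graph_pred f (zs[i := z]) = 1)"

definition permutably_reducible :: "'a set \<Rightarrow> nat \<Rightarrow> ('a list \<Rightarrow> 'a) \<Rightarrow> bool" where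
  "permutably_reducible S n f \<longleftrightarrow>
     (\<exists>m h g \<sigma>. 2 \<le> m \<and> m < n \<and>
        quasigroup S (n - m + 1) h \<and> quasigroup S m g \<and> \<sigma> permutes {0..<n} \<and>
        (\<forall>xs\<in>nlists n S.
           f xs = h (g (map (\<lambda>i. xs ! \<sigma> i) [0..<m]) # map (\<lambda>i. xs ! \<sigma> i) [m..<n])))"

definition isotopic :: "'a set \<Rightarrow> nat \<Rightarrow> ('a list \<Rightarrow> 'a) \<Rightarrow> ('a list \<Rightarrow> 'a) \<Rightarrow> bool" where
  "isotopic S n f g \<longleftrightarrow>
     (\<exists>\<tau> :: nat \<Rightarrow> 'a \<Rightarrow> 'a. (\<forall>i\<le>n. \<tau> i permutes S) \<and>
        (\<forall>xs\<in>nlists n S.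
           f xs = inv (\<tau> 0) (g (map (\<lambda>i. \<tau> (i + 1) (xs ! i)) [0..<n]))))"

definition Sigma4 :: "nat set" where
  "Sigma4 = {0, 1, 2, 3}"

definition l_bit :: "nat \<Rightarrow> nat" where
  "l_bit x = (if x = 0 \<or> x = 1 then 0 else 1)"

definition L_pred :: "nat list \<Rightarrow> nat" where
  "L_pred zs = (sum_list (map l_bit zs) + 1) mod 2"

definition standardly_semilinear :: "nat \<Rightarrow> (nat list \<Rightarrow> nat) \<Rightarrow> bool" where
  "standardly_semilinear n f \<longleftrightarrow>
     quasigroup Sigma4 n f \<and> (\<forall>zs\<in>nlists (n + 1) Sigma4. graph_pred f zs \<le> L_pred zs)"

definition semilinear :: "nat \<Rightarrow> (nat list \<Rightarrow> nat) \<Rightarrow> bool" where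
  "semilinear n f \<longleftrightarrow>
     quasigroup Sigma4 n f \<and> (\<exists>g. standardly_semilinear n g \<and> isotopic Sigma4 n f g)"

end

theory Submission
  imports Defs
begin

text \<open>
  Identify the four values with the elements of the Klein four-group. For \<open>D \<noteq> 0\<close> the map \<open>pr D\<close> to the
  quotient modulo \<open>{0, D}\<close> splits the values into two pairs, and each of the three such splittings
  turns the quasigroup \<open>f\<close> into a Boolean function \<open>bitf D\<close>. If some \<open>bitf D\<close> is a sum of functions of
  one variable each, then \<open>f\<close> is semilinear (\<open>additive_semilinear\<close>). In general, two variables
  interact for \<open>bitf D\<close> if it is not a sum of unary functions on some retract to these variables, and
  the arguments fall into the connected components of this relation. The theorem follows from two facts.

  First, for at least two variables some \<open>bitf D\<close> is not connected (\<open>exists_splitting\<close>). Second, a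
  component \<open>K\<close> of \<open>bitf D\<close> is a module: the other variables see the variables in \<open>K\<close> only through one
  value, so that \<open>f\<close> factors through a retract to \<open>K\<close> (\<open>connected_module\<close>, \<open>module_reducible\<close>). The
  reason is that a move of a variable of \<open>K\<close> within a level set of \<open>bitf D\<close> adds \<open>D\<close> to \<open>f\<close>, whatever
  the values outside \<open>K\<close> are, and that the level sets are connected by such moves
  (\<open>level_set_connected\<close>). Hence either all components are single variables and \<open>f\<close> is semilinear, or
  a component with at least two variables reduces \<open>f\<close>.

  The first fact is local at the start: a Latin square of order 4 is isotopic to the table of the
  four-group or of the cyclic group. In the second case the subgroup of order 2 singles out one
  splitting \<open>D\<close>, the type of the binary retract, and \<open>bitf D\<close> is the only one that is additive on the
  retract (\<open>latin_square_form\<close>, \<open>type_interact\<close>). For Latin cubes the claim is checked by enumeration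
  of the types of the planes (\<open>latin_cube_splits\<close>), which also yields strong rules for the types in a
  ternary retract (\<open>decoupled_cube_cases\<close>, \<open>two_types\<close>, \<open>type_changes\<close>).

  For more variables consider a smallest counterexample \<open>N\<close>. A set on which \<open>f\<close> is connected has at
  most one splitting (\<open>split_unique\<close>), and every smaller set of at least two
  variables has one. Choose a set \<open>B\<close>, as large as
  possible, that is connected for some \<open>bitf D\<close> and interacts with a further variable with type \<open>D\<close>.
  Growing \<open>B\<close> and this variable inside \<open>N\<close> keeps the splitting \<open>D\<close>, so that \<open>B\<close> becomes a component in
  \<open>N - {n}\<close> for some \<open>n\<close> at some value of \<open>n\<close> (\<open>extend_colour\<close>, \<open>card_pair_less\<close>). If \<open>B\<close> is a singleton,
  the retracts to \<open>N - {n}\<close> and \<open>N - {l}\<close> for two variables have all their types in \<open>{0, D}\<close> and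
  \<open>{0, P}\<close>, respectively, and these are incompatible (\<open>beta_ge_2\<close>). Otherwise \<open>n\<close> breaks the module
  \<open>B\<close> in some context, because contracting a module in \<open>N\<close> would give a smaller counterexample
  (\<open>broken\<close>). A broken \<open>B\<close> must interact with a variable \<open>l\<close> in \<open>N - {n} - B\<close> (\<open>broken_interacts\<close>), which
  by maximality is the only one (\<open>broken_interacting\<close>), and the rules for ternary retracts then
  isolate one of the variables for some \<open>bitf P\<close> on \<open>N\<close> (\<open>contradiction\<close>).
\<close>

section \<open>The Klein four-group and Latin squares and cubes of order 4\<close>

datatype k4 = K0 | K1 | K2 | K3

instantiation k4 :: ab_group_add
begin

fun plus_k4 :: "k4 \<Rightarrow> k4 \<Rightarrow> k4" where
  "K0 + y = y"
| "x + K0 = x"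
| "K1 + K1 = K0"
| "K1 + K2 = K3"
| "K1 + K3 = K2"
| "K2 + K1 = K3"
| "K2 + K2 = K0"
| "K2 + K3 = K1"
| "K3 + K1 = K2"
| "K3 + K2 = K1"
| "K3 + K3 = K0"

definition zero_k4 :: k4 where "0 = K0"
definition uminus_k4 :: "k4 \<Rightarrow> k4" where "- x = (x :: k4)"
definition minus_k4 :: "k4 \<Rightarrow> k4 \<Rightarrow> k4" where "x - y = x + (y :: k4)"

instance
proof
  fix a b c :: k4
  show "a + b + c = a + (b + c)" by (cases a; cases b; cases c) simp_all
  show "a + b = b + a" by (cases a; cases b) simp_all
  show "0 + a = a" by (simp add: zero_k4_def)
  show "- a + a = 0" by (cases a) (simp_all add: zero_k4_def uminus_k4_def)
  show "a - b = a + - b" by (simp add: minus_k4_def uminus_k4_def)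
qed

end

lemma k4_add_self [simp]: "(x :: k4) + x = 0"
  by (cases x) (simp_all add: zero_k4_def)

lemma k4_minus [simp]: "(x :: k4) - y = x + y" "- x = x"
  by (simp_all add: minus_k4_def uminus_k4_def)

lemma k4_add_left_self [simp]: "(x :: k4) + (x + y) = y"
  by (simp add: add.assoc [symmetric])

lemma k4_eq_iff: "(x :: k4) = y \<longleftrightarrow> x + y = 0"
  by (metis add.right_neutral k4_add_left_self k4_add_self)

lemma k4_add_eq_iff: "(x :: k4) + y = z \<longleftrightarrow> x = y + z"
  by (metis add.commute k4_add_left_self)

text \<open>
  For \<open>D \<noteq> 0\<close> this is the quotient map of the four-group modulo \<open>{0, D}\<close>, with the quotient
  embedded again as \<open>{0, D}\<close>. The three maps \<open>pr D\<close> are thus, up to exchanging the two values,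
  the three ways to split the four values into two pairs.
\<close>

definition pr :: "k4 \<Rightarrow> k4 \<Rightarrow> k4" where
  "pr D x = (if x = 0 \<or> x = D then 0 else D)"

lemma pr_add: "pr D (x + y) = pr D x + pr D y"
  by (cases D; cases x; cases y) (simp_all add: pr_def zero_k4_def)

lemma pr_0 [simp]: "pr D 0 = 0" "pr 0 x = 0" "pr D D = 0"
  by (simp_all add: pr_def)

lemma pr_eq_0: "D \<noteq> 0 \<Longrightarrow> pr D x = 0 \<longleftrightarrow> x = 0 \<or> x = D"
  by (auto simp: pr_def)

lemma pr_range: "pr D x = 0 \<or> pr D x = D"
  by (auto simp: pr_def)

lemma k4_third:
  fixes D P x :: k4
  assumes "D \<noteq> 0" "P \<noteq> 0" "D \<noteq> P"
  shows "x = 0 \<or> x = D \<or> x = P \<or> x = D + P"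
  using assms by (cases D; cases P; cases x) (simp_all add: zero_k4_def)

text \<open>The product of the images of \<open>x\<close> and \<open>y\<close> modulo \<open>{0, D}\<close>, as an element of \<open>{0, D}\<close>.\<close>

fun mul :: "k4 \<Rightarrow> k4 \<Rightarrow> k4 \<Rightarrow> k4" where
  "mul K0 x y = K0"
| "mul D K0 y = K0"
| "mul D x K0 = K0"
| "mul K1 K1 y = K0"
| "mul K1 x K1 = K0"
| "mul K1 x y = K1"
| "mul K2 K2 y = K0"
| "mul K2 x K2 = K0"
| "mul K2 x y = K2"
| "mul K3 K3 y = K0"
| "mul K3 x K3 = K0"
| "mul K3 x y = K3"

lemma mul_values: "mul D x y = (if D \<noteq> 0 \<and> x \<noteq> 0 \<and> x \<noteq> D \<and> y \<noteq> 0 \<and> y \<noteq> D then D else 0)"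
  by (cases D; cases x; cases y) (simp_all add: zero_k4_def)

lemma mul_commute: "mul D x y = mul D y x"
  by (simp add: mul_values)

definition k4s :: "k4 list" where "k4s = [K0, K1, K2, K3]"

lemma set_k4s [simp]: "set k4s = UNIV"
  using k4.exhaust by (auto simp: k4s_def)

definition avoiding :: "k4 list \<Rightarrow> k4 list" where
  "avoiding xs = filter (\<lambda>x. \<not> List.member xs x) k4s"

lemma set_avoiding [simp]: "set (avoiding xs) = - set xs"
  by (auto simp: avoiding_def)

text \<open>
  A Latin square whose row and column of the neutral element are the identity is given by its other
  nine entries, here \<open>a\<close> to \<open>i\<close> row by row. Each is chosen among the values that do not yet occur in its
  row or column; only four squares result.
\<close>

definition normalized_squares_ok :: bool where
  "normalized_squares_ok \<longleftrightarrow>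
     list_all (\<lambda>a. list_all (\<lambda>b. list_all (\<lambda>c.
     list_all (\<lambda>d. list_all (\<lambda>e. list_all (\<lambda>f.
     list_all (\<lambda>g. list_all (\<lambda>h. list_all (\<lambda>i.
       list_ex (\<lambda>D. [a, b, c, d, e, f, g, h, i] =
         map (\<lambda>(x, y). x + y + mul D x y)
           [(K1, K1), (K1, K2), (K1, K3), (K2, K1), (K2, K2), (K2, K3), (K3, K1), (K3, K2), (K3, K3)]) k4s)
     (avoiding [K3, g, h, K3, c, f])) (avoiding [K3, g, K2, b, e])) (avoiding [K3, K1, a, d]))
     (avoiding [K2, d, e, K3, c])) (avoiding [K2, d, K2, b])) (avoiding [K2, K1, a]))
     (avoiding [K1, a, b, K3])) (avoiding [K1, a, K2])) (avoiding [K1, K1])"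

lemma normalized_squares_ok: "normalized_squares_ok"
  by code_simp

definition latin :: "(k4 \<Rightarrow> k4 \<Rightarrow> k4) \<Rightarrow> bool" where
  "latin F \<longleftrightarrow> (\<forall>a. bij (F a)) \<and> (\<forall>b. bij (\<lambda>a. F a b))"

lemma normalized_latin_square:
  assumes "latin H" and H0: "\<And>x. H x 0 = x" "\<And>y. H 0 y = y"
  obtains D where "\<And>x y. H x y = x + y + mul D x y"
proof -
  have r: "v \<noteq> v' \<Longrightarrow> H u v \<noteq> H u v'" and c: "v \<noteq> v' \<Longrightarrow> H v u \<noteq> H v' u" for u v v'
    using assms(1) by (auto simp: latin_def bij_def dest: injD)
  have H0': "H x K0 = x" "H K0 x = x" for x
    using H0 by (simp_all add: zero_k4_def)
  have rr: "H K1 v \<noteq> K1" "H K2 v \<noteq> K2" "H K3 v \<noteq> K3" if "v \<noteq> K0" for v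
    using r [OF that] H0' by metis+
  have cc: "H v K1 \<noteq> K1" "H v K2 \<noteq> K2" "H v K3 \<noteq> K3" if "v \<noteq> K0" for v
    using c [OF that] H0' by metis+
  have "\<exists>D. [H K1 K1, H K1 K2, H K1 K3, H K2 K1, H K2 K2, H K2 K3, H K3 K1, H K3 K2, H K3 K3] =
         map (\<lambda>(x, y). x + y + mul D x y)
           [(K1, K1), (K1, K2), (K1, K3), (K2, K1), (K2, K2), (K2, K3), (K3, K1), (K3, K2), (K3, K3)]"
    by (rule normalized_squares_ok [unfolded normalized_squares_ok_def list_all_iff list_ex_iff,
          simplified set_avoiding set_k4s Ball_def Bex_def UNIV_I simp_thms, rule_format])
       (simp_all add: r c rr cc)
  then obtain D where D: "[H K1 K1, H K1 K2, H K1 K3, H K2 K1, H K2 K2, H K2 K3, H K3 K1, H K3 K2, H K3 K3] =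
         map (\<lambda>(x, y). x + y + mul D x y)
           [(K1, K1), (K1, K2), (K1, K3), (K2, K1), (K2, K2), (K2, K3), (K3, K1), (K3, K2), (K3, K3)]"
    by (elim exE)
  have "H x y = x + y + mul D x y" for x y
  proof (cases "x = K0 \<or> y = K0")
    case True
    then show ?thesis
      by (auto simp: H0 mul_values simp flip: zero_k4_def)
  next
    case False
    then show ?thesis using D by (cases x; cases y) simp_all
  qed
  then show thesis by (rule that)
qed

text \<open>
  Every Latin square of order 4 is, up to isotopy, the addition table of the four-group (\<open>D = 0\<close>)
  or of the cyclic group, the latter with the pair \<open>{0, D}\<close> as subgroup of order 2.
\<close>

lemma latin_square_form:
  assumes "latin F"
  obtains D where
    "\<And>x y. F x y = F x b + F a y + F a b + mul D (F x b + F a b) (F a y + F a b)"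
proof -
  define p where "p = inv (\<lambda>x. F x b + F a b)"
  define q where "q = inv (\<lambda>y. F a y + F a b)"
  have shift: "bij (\<lambda>z :: k4. z + w)" for w
    by (rule o_bij [of "\<lambda>z. z + w"]) (auto simp: fun_eq_iff add.assoc)
  have bx: "bij (\<lambda>x. F x b + F a b)" and byy: "bij (\<lambda>y. F a y + F a b)"
    using assms bij_comp [OF _ shift, unfolded comp_def] by (auto simp: latin_def)
  have pb: "bij p" and qb: "bij q"
    using bx byy by (simp_all add: p_def q_def bij_imp_bij_inv)
  have p: "F (p x) b + F a b = x" and q: "F a (q x) + F a b = x" for x
    using bx byy by (simp_all add: p_def q_def bij_is_surj surj_f_inv_f [where f = "\<lambda>x. F x b + F a b"]
        surj_f_inv_f [where f = "\<lambda>y. F a y + F a b"])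
  have p': "p (F x b + F a b) = x" and q': "q (F a x + F a b) = x" for x
    using bx byy by (simp_all add: p_def q_def bij_is_inj inv_f_f [where f = "\<lambda>x. F x b + F a b"]
        inv_f_f [where f = "\<lambda>y. F a y + F a b"])
  define H where "H x y = F (p x) (q y) + F a b" for x y
  have rows: "bij (F x)" and cols: "bij (\<lambda>x. F x y)" for x y
    using assms by (auto simp: latin_def)
  have "latin H"
    unfolding latin_def H_def
    using bij_comp [OF bij_comp [OF qb rows] shift] bij_comp [OF bij_comp [OF pb cols] shift]
    by (simp add: comp_def)
  moreover have "q 0 = b" "p 0 = a"
    using q' [of b] p' [of a] by simp_all
  ultimately obtain D where D: "\<And>x y. H x y = x + y + mul D x y"
    using normalized_latin_square [of H] p q by (auto simp: H_def)
  have "F x y = F x b + F a y + F a b + mul D (F x b + F a b) (F a y + F a b)" for x y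
  proof -
    define X Y where "X = F x b + F a b" and "Y = F a y + F a b"
    have "F x y = F a b + (X + Y + mul D X Y)"
      using D [of X Y] by (simp add: H_def X_def Y_def p' q' k4_add_eq_iff)
    also have "\<dots> = F x b + F a y + F a b + mul D X Y"
      by (simp add: X_def Y_def ac_simps)
    finally show ?thesis
      by (simp only: X_def Y_def)
  qed
  then show thesis by (rule that)
qed

text \<open>
  The value at \<open>(X, Y, Z)\<close> of a Latin cube that is the identity on the three axes, when \<open>p\<close> and \<open>q\<close>
  are the elements \<open>D\<close> from \<open>latin_square_form\<close> for the coordinate planes \<open>XZ\<close> and \<open>YZ\<close>, and \<open>a\<close> is that
  of the plane through \<open>Z\<close> parallel to \<open>XY\<close>. Computing the same value from the two other families of parallel planes gives
  equations between the elements \<open>D\<close> of the planes, which \<open>cube_ok\<close> solves by enumeration.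
\<close>

definition cube :: "k4 \<Rightarrow> k4 \<Rightarrow> k4 \<Rightarrow> k4 \<Rightarrow> k4 \<Rightarrow> k4 \<Rightarrow> k4" where
  "cube a p q X Y Z = (let X' = X + mul p X Z; Y' = Y + mul q Y Z in X' + Y' + Z + mul a X' Y')"

definition k4s' :: "k4 list" where "k4s' = [K1, K2, K3]"

definition within :: "k4 \<Rightarrow> k4 list \<Rightarrow> bool" where
  "within P ds \<longleftrightarrow> list_all (\<lambda>d. d = K0 \<or> d = P) ds"

definition two_within :: "k4 \<Rightarrow> k4 list \<Rightarrow> k4 list \<Rightarrow> k4 list \<Rightarrow> bool" where
  "two_within P a b c \<longleftrightarrow>
     (let A = within P a; B = within P b; C = within P c in A \<and> B \<or> A \<and> C \<or> B \<and> C)"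

definition fits :: "k4 \<Rightarrow> k4 \<Rightarrow> k4 \<Rightarrow> k4 \<Rightarrow> k4 \<Rightarrow> k4 \<Rightarrow> k4 \<Rightarrow> bool" where
  "fits p q r Y Z a b \<longleftrightarrow> list_all (\<lambda>X. cube a p q X Y Z = cube b r q X Z Y) k4s'"

definition fits' :: "k4 \<Rightarrow> k4 \<Rightarrow> k4 \<Rightarrow> k4 \<Rightarrow> k4 \<Rightarrow> k4 \<Rightarrow> k4 \<Rightarrow> bool" where
  "fits' p q r X Z a c \<longleftrightarrow> list_all (\<lambda>Y. cube a p q X Y Z = cube c r p Y Z X) k4s'"

text \<open>
  Here \<open>p\<close>, \<open>q\<close> and \<open>r\<close> belong to the three coordinate planes, and \<open>a1\<close> to \<open>a3\<close>, \<open>b1\<close> to \<open>b3\<close> and \<open>c1\<close> to \<open>c3\<close>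
  to the planes parallel to \<open>XY\<close>, \<open>XZ\<close> and \<open>YZ\<close>. The filters remove inconsistent combinations as early as
  possible. In all others, two of the three families of parallel planes have all their elements in a
  common set \<open>{0, P}\<close>.
\<close>

definition cube_ok :: "k4 \<Rightarrow> k4 \<Rightarrow> k4 \<Rightarrow> bool" where
  "cube_ok p q r \<longleftrightarrow>
   list_all (\<lambda>a1.
     list_all (\<lambda>b1. list_all (\<lambda>b2. list_all (\<lambda>b3.
     list_all (\<lambda>c1. list_all (\<lambda>c2. list_all (\<lambda>c3.
     list_all (\<lambda>a2. list_all (\<lambda>a3.
       list_ex (\<lambda>P. two_within P [r, a1, a2, a3] [p, b1, b2, b3] [q, c1, c2, c3]) k4s')
     (filter (\<lambda>a3. fits p q r K1 K3 a3 b1 \<and> fits p q r K2 K3 a3 b2 \<and> fits p q r K3 K3 a3 b3) k4s))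
     (filter (\<lambda>a2. fits p q r K1 K2 a2 b1 \<and> fits p q r K2 K2 a2 b2 \<and> fits p q r K3 K2 a2 b3) k4s))
     (filter (fits' p q r K3 K1 a1) k4s)) (filter (fits' p q r K2 K1 a1) k4s)) (filter (fits' p q r K1 K1 a1) k4s))
     (filter (fits p q r K3 K1 a1) k4s)) (filter (fits p q r K2 K1 a1) k4s)) (filter (fits p q r K1 K1 a1) k4s)) k4s"

lemma all_cubes_ok: "list_all (\<lambda>p. list_all (\<lambda>q. list_all (cube_ok p q) k4s) k4s) k4s"
  by code_simp

definition splits_square :: "k4 \<Rightarrow> (k4 \<Rightarrow> k4 \<Rightarrow> k4) \<Rightarrow> bool" where
  "splits_square P F \<longleftrightarrow>
     (\<forall>x x' y y'. pr P (F x y) + pr P (F x' y') = pr P (F x y') + pr P (F x' y))"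

lemma splits_square_form:
  assumes "\<And>x y. F x y = g x + h y + mul D (g' x) (h' y)" and "D = 0 \<or> D = P"
  shows "splits_square P F"
proof -
  have "pr P (mul D u v) = 0" for u v
    using assms(2) by (auto simp: mul_values)
  then show ?thesis
    unfolding splits_square_def assms(1) by (simp add: pr_add ac_simps)
qed

text \<open>
  The ternary case of the main result on splittings: for one of the three ways to split the values
  into pairs, one of the three arguments contributes a separate summand.
\<close>

lemma latin_cube_splits:
  assumes "\<And>k. latin (\<lambda>i j. F i j k)" "\<And>j. latin (\<lambda>i k. F i j k)" "\<And>i. latin (\<lambda>j k. F i j k)"
  obtains P where "P \<noteq> 0"
    "(\<forall>k. splits_square P (\<lambda>i j. F i j k)) \<and> (\<forall>j. splits_square P (\<lambda>i k. F i j k)) \<or>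
     (\<forall>k. splits_square P (\<lambda>i j. F i j k)) \<and> (\<forall>i. splits_square P (\<lambda>j k. F i j k)) \<or>
     (\<forall>j. splits_square P (\<lambda>i k. F i j k)) \<and> (\<forall>i. splits_square P (\<lambda>j k. F i j k))"
proof -
  define c where "c = F 0 0 0"
  have "\<exists>D. \<forall>x y. F x y k = F x 0 k + F 0 y k + F 0 0 k + mul D (F x 0 k + F 0 0 k) (F 0 y k + F 0 0 k)" for k
    using latin_square_form [OF assms(1), of k 0 0] by blast
  then obtain a' where a': "\<And>k x y. F x y k = F x 0 k + F 0 y k + F 0 0 k + mul (a' k) (F x 0 k + F 0 0 k) (F 0 y k + F 0 0 k)"
    by metis
  have "\<exists>D. \<forall>x y. F x k y = F x k 0 + F 0 k y + F 0 k 0 + mul D (F x k 0 + F 0 k 0) (F 0 k y + F 0 k 0)" for k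
    using latin_square_form [OF assms(2), of k 0 0] by blast
  then obtain b' where b': "\<And>k x y. F x k y = F x k 0 + F 0 k y + F 0 k 0 + mul (b' k) (F x k 0 + F 0 k 0) (F 0 k y + F 0 k 0)"
    by metis
  have "\<exists>D. \<forall>x y. F k x y = F k x 0 + F k 0 y + F k 0 0 + mul D (F k x 0 + F k 0 0) (F k 0 y + F k 0 0)" for k
    using latin_square_form [OF assms(3), of k 0 0] by blast
  then obtain c' where c': "\<And>k x y. F k x y = F k x 0 + F k 0 y + F k 0 0 + mul (c' k) (F k x 0 + F k 0 0) (F k 0 y + F k 0 0)"
    by metis
  have shift: "bij (\<lambda>z :: k4. z + w)" for w
    by (rule o_bij [of "\<lambda>z. z + w"]) (auto simp: fun_eq_iff add.assoc)
  have "bij (\<lambda>x. F x 0 0)" "bij (\<lambda>x. F 0 x 0)" "bij (\<lambda>x. F 0 0 x)"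
    using assms(1) [of 0] assms(2) [of 0] by (simp_all add: latin_def)
  then have bij: "bij (\<lambda>x. F x 0 0 + c)" "bij (\<lambda>x. F 0 x 0 + c)" "bij (\<lambda>x. F 0 0 x + c)"
    using bij_comp [OF _ shift [of c], unfolded comp_def] by blast+
  define p q r where "p = b' 0" and "q = c' 0" and "r = a' 0"
  define u v w where "u = inv (\<lambda>x. F x 0 0 + c)" and "v = inv (\<lambda>x. F 0 x 0 + c)" and "w = inv (\<lambda>x. F 0 0 x + c)"
  have "F (u x) 0 0 + c = x" "F 0 (v x) 0 + c = x" "F 0 0 (w x) + c = x" for x
    using bij [THEN bij_is_surj, THEN surj_f_inv_f, of x]
    by (simp_all add: u_def v_def w_def)
  then have u: "F (u x) 0 0 = x + c" and v: "F 0 (v x) 0 = x + c" and w: "F 0 0 (w x) = x + c" for x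
    by (metis add.commute k4_add_eq_iff)+
  have inverse: "u (F x 0 0 + c) = x" "v (F 0 x 0 + c) = x" "w (F 0 0 x + c) = x" for x
    using bij [THEN bij_is_inj, THEN inv_f_f, of x]
    by (simp_all add: u_def v_def w_def)
  have surj: "\<exists>X. x = u X" "\<exists>X. x = v X" "\<exists>X. x = w X" for x
    using inverse [of x] by metis+
  have zero: "u 0 = 0" "v 0 = 0" "w 0 = 0"
    using inverse [of 0] by (simp_all add: c_def)
  have faces: "F (u X) 0 (w Z) = X + Z + mul p X Z + c"
    "F 0 (v Y) (w Z) = Y + Z + mul q Y Z + c"
    "F (u X) (v Y) 0 = X + Y + mul r X Y + c" for X Y Z
    using b' [of "u X" 0 "w Z"] c' [of 0 "v Y" "w Z"] a' [of "u X" "v Y" 0]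
    by (simp_all add: u v w p_def q_def r_def c_def [symmetric] ac_simps)
  have 1: "F (u X) (v Y) (w Z) = cube (a' (w Z)) p q X Y Z + c" for X Y Z
    using a' [of "u X" "v Y" "w Z"]
    by (simp add: faces u v w c_def [symmetric] ac_simps cube_def Let_def)
  have 2: "F (u X) (v Y) (w Z) = cube (b' (v Y)) r q X Z Y + c" for X Y Z
    using b' [of "u X" "v Y" "w Z"]
    by (simp add: faces u v w c_def [symmetric] ac_simps cube_def Let_def mul_commute)
  have 3: "F (u X) (v Y) (w Z) = cube (c' (u X)) r p Y Z X + c" for X Y Z
    using c' [of "u X" "v Y" "w Z"]
    by (simp add: faces u v w c_def [symmetric] ac_simps cube_def Let_def mul_commute)
  have fits: "fits p q r Y Z (a' (w Z)) (b' (v Y))" for Y Z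
    unfolding fits_def list_all_iff using 1 2 by (metis add_right_cancel)
  have fits': "fits' p q r X Z (a' (w Z)) (c' (u X))" for X Z
    unfolding fits'_def list_all_iff using 1 3 by (metis add_right_cancel)
  have ok: "cube_ok p q r"
    using all_cubes_ok by (simp add: list_all_iff)
  have "\<exists>P\<in>set k4s'. two_within P [r, a' (w K1), a' (w K2), a' (w K3)]
      [p, b' (v K1), b' (v K2), b' (v K3)] [q, c' (u K1), c' (u K2), c' (u K3)]"
    using ok [unfolded cube_ok_def list_all_iff list_ex_iff set_filter set_k4s, simplified]
    using fits fits' by blast
  then obtain P where P: "P \<noteq> 0" "two_within P [r, a' (w K1), a' (w K2), a' (w K3)]
      [p, b' (v K1), b' (v K2), b' (v K3)] [q, c' (u K1), c' (u K2), c' (u K3)]"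
    by (auto simp: k4s'_def zero_k4_def)
  have A: "splits_square P (\<lambda>i j. F i j k)" if "within P [r, a' (w K1), a' (w K2), a' (w K3)]" for k
  proof -
    obtain Z where "k = w Z" using surj by metis
    then have "a' k = 0 \<or> a' k = P"
      using that zero(3) by (cases Z) (auto simp: within_def zero_k4_def r_def)
    then show ?thesis
      by (intro splits_square_form [where D = "a' k" and g = "\<lambda>x. F x 0 k" and h = "\<lambda>y. F 0 y k + F 0 0 k"
            and g' = "\<lambda>x. F x 0 k + F 0 0 k" and h' = "\<lambda>y. F 0 y k + F 0 0 k"]) (subst a', simp_all add: ac_simps)
  qed
  have B: "splits_square P (\<lambda>i j. F i k j)" if "within P [p, b' (v K1), b' (v K2), b' (v K3)]" for k
  proof -
    obtain Z where "k = v Z" using surj by metis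
    then have "b' k = 0 \<or> b' k = P"
      using that zero(2) by (cases Z) (auto simp: within_def zero_k4_def p_def)
    then show ?thesis
      by (intro splits_square_form [where D = "b' k" and g = "\<lambda>x. F x k 0" and h = "\<lambda>y. F 0 k y + F 0 k 0"
            and g' = "\<lambda>x. F x k 0 + F 0 k 0" and h' = "\<lambda>y. F 0 k y + F 0 k 0"]) (subst b', simp_all add: ac_simps)
  qed
  have C: "splits_square P (\<lambda>i j. F k i j)" if "within P [q, c' (u K1), c' (u K2), c' (u K3)]" for k
  proof -
    obtain Z where "k = u Z" using surj by metis
    then have "c' k = 0 \<or> c' k = P"
      using that zero(1) by (cases Z) (auto simp: within_def zero_k4_def q_def)
    then show ?thesis
      by (intro splits_square_form [where D = "c' k" and g = "\<lambda>x. F k x 0" and h = "\<lambda>y. F k 0 y + F k 0 0"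
            and g' = "\<lambda>x. F k x 0 + F k 0 0" and h' = "\<lambda>y. F k 0 y + F k 0 0"]) (subst c', simp_all add: ac_simps)
  qed
  show thesis
    using that [OF P(1)] P(2) A B C unfolding two_within_def Let_def by blast
qed

section \<open>Additive splittings of functions of several variables\<close>

text \<open>
  The relation of a point \<open>x\<close> to the points of the retract in the variables \<open>U\<close> through \<open>x\<close>. The values
  of \<open>x\<close> outside \<open>U\<close> are the context in which a function is considered on \<open>U\<close>.
\<close>

definition agree :: "'i set \<Rightarrow> ('i \<Rightarrow> 'a) \<Rightarrow> ('i \<Rightarrow> 'a) \<Rightarrow> bool" where
  "agree U x y \<longleftrightarrow> (\<forall>m. m \<notin> U \<longrightarrow> y m = x m)"

lemma agree_refl [simp]: "agree U x x"
  by (simp add: agree_def)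

lemma agree_sym: "agree U x y \<Longrightarrow> agree U y x"
  by (simp add: agree_def)

lemma agree_trans: "agree U x y \<Longrightarrow> agree U y z \<Longrightarrow> agree U x z"
  by (simp add: agree_def)

lemma agree_mono: "agree U x y \<Longrightarrow> U \<subseteq> V \<Longrightarrow> agree V x y"
  by (auto simp: agree_def)

lemma agree_upd [simp]: "i \<in> U \<Longrightarrow> agree U x (y(i := a)) \<longleftrightarrow> agree U x y"
  by (auto simp: agree_def)

lemma agree_upd' [simp]: "i \<in> U \<Longrightarrow> agree U (x(i := a)) y \<longleftrightarrow> agree U x y"
  by (auto simp: agree_def)

lemma agreeD: "agree U x y \<Longrightarrow> m \<notin> U \<Longrightarrow> y m = x m"
  by (simp add: agree_def)

lemma agree_induct [consumes 2, case_names base step]: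
  assumes "finite W" "agree W y z"
    and "P y" "\<And>z i a. i \<in> W \<Longrightarrow> agree W y z \<Longrightarrow> P z \<Longrightarrow> P (z(i := a))"
  shows "P z"
  using assms
proof (induction W arbitrary: z rule: finite_induct)
  case empty
  then have "z = y" by (auto simp: agree_def)
  then show ?case using empty by simp
next
  case (insert i W)
  have "P (z(i := y i))"
  proof (rule insert.IH)
    show "agree W y (z(i := y i))"
      using insert.prems(1) by (auto simp: agree_def)
    show "P y" by fact
    show "P (z(j := a))" if "j \<in> W" "agree W y z" "P z" for z j a
      using insert.prems(3) [of j z a] that agree_mono [of W y z "insert i W"] by blast
  qed
  moreover have "agree (insert i W) y (z(i := y i))"
    using insert.prems(1) by simp
  ultimately show ?case
    using insert.prems(3) [of i "z(i := y i)" "z i"] by (metis fun_upd_triv fun_upd_upd insertI1)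
qed

definition patch :: "'i set \<Rightarrow> ('i \<Rightarrow> 'a) \<Rightarrow> ('i \<Rightarrow> 'a) \<Rightarrow> 'i \<Rightarrow> 'a" where
  "patch W u y = (\<lambda>m. if m \<in> W then u m else y m)"

lemma patch_upd: "i \<in> W \<Longrightarrow> (patch W u y)(i := a) = patch W (u(i := a)) y"
  by (auto simp: patch_def)

lemma patch_upd': "i \<notin> W \<Longrightarrow> (patch W u y)(i := a) = patch W u (y(i := a))"
  by (auto simp: patch_def)

lemma patch_agree [simp]: "agree W y (patch W u y)"
  by (simp add: agree_def patch_def)

lemma patch_eq: "agree W y z \<Longrightarrow> patch W z y = z"
  by (auto simp: agree_def patch_def)

lemma patch_patch [simp]: "patch W u (patch W v y) = patch W u y"
  by (auto simp: patch_def)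

lemma patch_self [simp]: "patch W y y = y"
  by (auto simp: patch_def)

lemma patch_cong: "agree W y y' \<Longrightarrow> patch W u y = patch W u y'"
  by (auto simp: agree_def patch_def)

text \<open>Whether \<open>h\<close>, as a function of the two variables \<open>i\<close> and \<open>j\<close>, is not a sum of unary functions.\<close>

definition interact :: "(('i \<Rightarrow> 'a) \<Rightarrow> 'g::ab_group_add) \<Rightarrow> 'i \<Rightarrow> 'i \<Rightarrow> ('i \<Rightarrow> 'a) \<Rightarrow> bool" where
  "interact h i j x \<longleftrightarrow>
     \<not> (\<forall>a a' b b'. h (x(i := a, j := b)) + h (x(i := a', j := b')) =
                    h (x(i := a, j := b')) + h (x(i := a', j := b)))"

lemma interact_commute:
  assumes "i \<noteq> j"
  shows "interact h i j x = interact h j i x"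
proof -
  have "interact h j i x" if "interact h i j x" for i j
  proof (cases "i = j")
    case False
    show ?thesis
      using that unfolding interact_def fun_upd_twist [OF False] by (metis add.commute)
  qed (use that in simp)
  then show ?thesis by blast
qed

lemma interact_upd [simp]:
  assumes "i \<noteq> j"
  shows "interact h i j (x(i := c)) = interact h i j x" "interact h i j (x(j := c)) = interact h i j x"
  using assms by (simp_all add: interact_def fun_upd_twist)

lemma interact_cong_agree:
  assumes "i \<noteq> j" "agree {i, j} x y"
  shows "interact h i j x = interact h i j y"
proof -
  have "y = x(i := y i, j := y j)"
    using assms(2) by (auto simp: agree_def)
  then have "interact h i j y = interact h i j (x(i := y i, j := y j))"
    by simp
  then show ?thesis
    using assms(1) by simp
qed

definition decoupled :: "(('i \<Rightarrow> 'a) \<Rightarrow> 'g::ab_group_add) \<Rightarrow> 'i set \<Rightarrow> 'i set \<Rightarrow> ('i \<Rightarrow> 'a) \<Rightarrow> bool" where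
  "decoupled h A B x \<longleftrightarrow> (\<forall>i\<in>A. \<forall>j\<in>B. \<forall>y. agree (A \<union> B) x y \<longrightarrow> \<not> interact h i j y)"

lemma decoupled_commute: "A \<inter> B = {} \<Longrightarrow> decoupled h A B x = decoupled h B A x"
  unfolding decoupled_def Un_commute [of B A] by (metis disjoint_iff interact_commute)

lemma decoupled_mono:
  "decoupled h A B x \<Longrightarrow> A' \<subseteq> A \<Longrightarrow> B' \<subseteq> B \<Longrightarrow> agree (A \<union> B) x x' \<Longrightarrow> decoupled h A' B' x'"
  unfolding decoupled_def by (meson Un_mono agree_mono agree_trans subsetD)

lemma decoupled_cong: "agree (A \<union> B) x y \<Longrightarrow> decoupled h A B x = decoupled h A B y"
  unfolding decoupled_def by (meson agree_sym agree_trans)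

lemma add_eq_diff_swap: "a + b = c + d \<Longrightarrow> a - d = c - (b :: 'g :: ab_group_add)"
  by (simp add: algebra_simps)

text \<open>
  That no variable in \<open>A\<close> interacts with one in \<open>B\<close> is a local form of \<open>h\<close> being the sum of a
  function of the variables in \<open>A\<close> and one of the variables in \<open>B\<close>.
\<close>

lemma decoupled_sum:
  assumes "finite A" "finite B" "A \<inter> B = {}" and dec: "decoupled h A B x"
    and y: "agree (A \<union> B) x y" and y': "agree B y y'"
  shows "h (patch A u y) + h (patch A u' y') = h (patch A u y') + h (patch A u' y)"
proof -
  have swap: "h (z(j := b)) + h (y'(j := c)) = h (y'(j := b)) + h (z(j := c))"
    if j: "j \<in> B" and y': "agree (A \<union> B) x y'" and z: "agree A y' z" for z y' j b c
    using \<open>finite A\<close> z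
  proof (induction rule: agree_induct)
    case base
    then show ?case by (simp add: add.commute)
  next
    case (step z i a)
    have "i \<noteq> j" using step.hyps j assms(3) by auto
    have "agree (A \<union> B) x z"
      using y' step.hyps(2) by (meson agree_mono agree_trans Un_upper1)
    then have "\<not> interact h i j z"
      using dec step.hyps(1) j by (auto simp: decoupled_def)
    then have "h (z(i := a, j := b)) + h (z(i := z i, j := c)) = h (z(i := a, j := c)) + h (z(i := z i, j := b))"
      unfolding interact_def by blast
    then have 1: "h (z(i := a, j := b)) - h (z(i := a, j := c)) = h (z(j := b)) - h (z(j := c))"
      by (simp add: algebra_simps)
    have 2: "h (z(j := b)) - h (z(j := c)) = h (y'(j := b)) - h (y'(j := c))"
      using step.IH by (rule add_eq_diff_swap)
    show ?case
      using 1 2 by (simp only: diff_eq_eq diff_add_eq eq_diff_eq)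
  qed
  show ?thesis
    using \<open>finite B\<close> y'
  proof (induction rule: agree_induct)
    case base
    then show ?case by (simp add: add.commute)
  next
    case (step z j b)
    have jA: "j \<notin> A" using step.hyps(1) assms(3) by auto
    have "agree (A \<union> B) x z"
      using y step.hyps(2) by (meson agree_mono agree_trans Un_upper2)
    then have xz: "agree (A \<union> B) x (patch A u z)"
      by (meson agree_mono agree_trans Un_upper1 patch_agree)
    have pz: "agree A (patch A u z) (patch A u' z)"
      by (simp add: agree_def patch_def)
    have "h (patch A u' (z(j := b))) + h (patch A u z) = h (patch A u (z(j := b))) + h (patch A u' z)"
      using swap [OF step.hyps(1) xz pz, of b "z j"] jA
      by (simp only: patch_upd' [OF jA] fun_upd_triv)
    then have E1: "h (patch A u' (z(j := b))) = h (patch A u (z(j := b))) + h (patch A u' z) - h (patch A u z)"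
      by (simp add: algebra_simps)
    have E2: "h (patch A u y) = h (patch A u z) + h (patch A u' y) - h (patch A u' z)"
      using step.IH by (simp add: algebra_simps)
    show ?case
      unfolding E1 E2 by (simp add: algebra_simps fun_upd_def)
  qed
qed

text \<open>
  The relation between two contexts of saying that \<open>h\<close>, as a function of the variables in \<open>W\<close>,
  changes only by a constant from one to the other.
\<close>

definition shifted :: "(('i \<Rightarrow> 'a) \<Rightarrow> 'g::ab_group_add) \<Rightarrow> 'i set \<Rightarrow> ('i \<Rightarrow> 'a) \<Rightarrow> ('i \<Rightarrow> 'a) \<Rightarrow> bool" where
  "shifted h W y y' \<longleftrightarrow> (\<exists>c. \<forall>u. h (patch W u y') = h (patch W u y) + c)"

lemma shifted_refl [simp]: "shifted h W y y"
  by (auto simp: shifted_def intro: exI [of _ 0])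

lemma shifted_sym: "shifted h W y y' \<Longrightarrow> shifted h W y' y"
  unfolding shifted_def by (elim exE, rule_tac x = "- c" in exI) simp

lemma shifted_trans: "shifted h W y y' \<Longrightarrow> shifted h W y' y'' \<Longrightarrow> shifted h W y y''"
  unfolding shifted_def by (elim exE, rule_tac x = "c + ca" in exI) (simp add: add.assoc)

lemma shifted_agree: "agree W y y' \<Longrightarrow> shifted h W y y'"
  by (metis patch_cong shifted_def shifted_refl)

lemma shifted_mono:
  assumes "shifted h W y y'" "V \<subseteq> W" "\<And>m. m \<in> W - V \<Longrightarrow> y' m = y m"
  shows "shifted h V y y'"
proof -
  obtain c where c: "\<And>u. h (patch W u y') = h (patch W u y) + c"
    using assms(1) by (auto simp: shifted_def)
  have "patch V u y' = patch W (patch V u y) y'" "patch V u y = patch W (patch V u y) y" for u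
    using assms(2,3) by (auto simp: patch_def fun_eq_iff)
  then show ?thesis
    unfolding shifted_def using c by metis
qed

lemma shifted_interact:
  assumes "shifted h W y y'" "i \<in> W" "j \<in> W"
  shows "interact h i j (patch W u y) = interact h i j (patch W u y')"
proof -
  obtain c where c: "\<And>u. h (patch W u y') = h (patch W u y) + c"
    using assms(1) by (auto simp: shifted_def)
  show ?thesis
    using assms(2,3) by (simp add: interact_def patch_upd c algebra_simps)
qed

lemma shifted_decoupled:
  assumes "shifted h (A \<union> B) y y'"
  shows "decoupled h A B y = decoupled h A B y'"
proof -
  have *: "decoupled h A B y'" if "decoupled h A B y" "shifted h (A \<union> B) y y'" for y y'
    unfolding decoupled_def
  proof (intro ballI allI impI)
    fix i j z assume ij: "i \<in> A" "j \<in> B" and z: "agree (A \<union> B) y' z"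
    have "\<not> interact h i j (patch (A \<union> B) z y)"
      using that(1) ij by (auto simp: decoupled_def)
    then show "\<not> interact h i j z"
      using shifted_interact [OF that(2), of i j z] ij patch_eq [OF z] by auto
  qed
  show ?thesis using * assms shifted_sym by blast
qed

lemma decoupled_shifted:
  assumes "finite A" "finite B" "A \<inter> B = {}" "decoupled h A B y" "agree B y y'"
  shows "shifted h A y y'"
proof -
  have "h (patch A u y') = h (patch A u y) + (h (patch A y y') - h y)" for u
    using decoupled_sum [OF assms(1-4) agree_refl assms(5), of y u]
    by (simp add: algebra_simps)
  then show ?thesis unfolding shifted_def by blast
qed

text \<open>
  The graph on \<open>U\<close> whose edges are the pairs of variables that interact at some point of the retract
  to \<open>U\<close> through \<open>x\<close> is connected, provided that \<open>U\<close> is nonempty.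
\<close>

definition connected :: "(('i \<Rightarrow> 'a) \<Rightarrow> 'g::ab_group_add) \<Rightarrow> 'i set \<Rightarrow> ('i \<Rightarrow> 'a) \<Rightarrow> bool" where
  "connected h U x \<longleftrightarrow> (\<forall>A. A \<subseteq> U \<and> A \<noteq> {} \<and> decoupled h A (U - A) x \<longrightarrow> A = U)"

lemma connected_singleton [simp]: "connected h {i} x"
  by (auto simp: connected_def)

lemma connectedD: "connected h U x \<Longrightarrow> A \<subseteq> U \<Longrightarrow> A \<noteq> {} \<Longrightarrow> decoupled h A (U - A) x \<Longrightarrow> A = U"
  by (auto simp: connected_def)

lemma not_connectedE:
  assumes "\<not> connected h U x"
  obtains A where "A \<subseteq> U" "A \<noteq> {}" "A \<noteq> U" "decoupled h A (U - A) x"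
  using assms by (auto simp: connected_def)

lemma connected_shifted:
  assumes "shifted h U y y'"
  shows "connected h U y = connected h U y'"
proof -
  have "decoupled h A (U - A) y = decoupled h A (U - A) y'" if "A \<subseteq> U" for A
    using shifted_decoupled [of h A "U - A" y y'] that assms by (simp add: Un_absorb1)
  then show ?thesis by (auto simp: connected_def)
qed

lemma connected_cong: "agree U x y \<Longrightarrow> connected h U x = connected h U y"
  by (rule connected_shifted [OF shifted_agree])

lemma connected_insert:
  assumes "connected h W y" "k \<notin> W" "W \<noteq> {}" "\<not> decoupled h W {k} y"
  shows "connected h (insert k W) y"
proof (rule ccontr)
  assume "\<not> connected h (insert k W) y"
  then obtain A where A: "A \<subseteq> insert k W" "A \<noteq> {}" "A \<noteq> insert k W" "decoupled h A (insert k W - A) y"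
    by (rule not_connectedE)
  have "decoupled h (A \<inter> W) (W - (A \<inter> W)) y"
    by (rule decoupled_mono [OF A(4)]) auto
  then consider "A \<inter> W = {}" | "A \<inter> W = W"
    using connectedD [OF assms(1), of "A \<inter> W"] by auto
  then show False
  proof cases
    case 1
    then have "A = {k}" "insert k W - A = W" using A(1,2) assms(2) by auto
    then show False using A(4) assms(2,4) decoupled_commute [of "{k}" W h y] by simp
  next
    case 2
    then have "A = W" "insert k W - A = {k}" using A(1,3) assms(2) by auto
    then show False using A(4) assms(4) by simp
  qed
qed

text \<open>
  A connected proper subset of a connected set can be enlarged by one variable: as long as no
  variable outside \<open>W\<close> interacts with \<open>W\<close>, changing the variables outside \<open>W\<close> does not affect
  \<open>h\<close> on \<open>W\<close>, and if this were so in all contexts then \<open>W\<close> would split off from \<open>U\<close>.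
\<close>

lemma connected_extend:
  assumes "finite U" "connected h U x" "W \<subseteq> U" "W \<noteq> U" "W \<noteq> {}" "agree U x y" "connected h W y"
  obtains k y' where "k \<in> U - W" "agree (U - W) y y'" "shifted h W y y'" "connected h (insert k W) y'"
proof (rule ccontr)
  assume "\<not> thesis"
  note extension = that
  have no: "\<not> connected h (insert k W) y'" if "k \<in> U - W" "agree (U - W) y y'" "shifted h W y y'" for k y'
    using extension [OF that] \<open>\<not> thesis\<close> by blast
  have finW: "finite W" and finU: "finite (U - W)"
    using assms(1,3) finite_subset by auto
  have dec: "decoupled h W {k} y'" if "k \<in> U - W" "agree (U - W) y y'" "shifted h W y y'" for k y'
    using no [OF that] connected_insert [of h W y' k] connected_shifted [OF that(3)] assms(5,7) that(1) by blast
  have all: "shifted h W y y'" if "agree (U - W) y y'" for y'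
    using finU that
  proof (induction rule: agree_induct)
    case base
    show ?case by simp
  next
    case (step z k a)
    have "shifted h W z (z(k := a))"
      by (rule decoupled_shifted [OF finW _ _ dec [OF step]]) (use step.hyps in auto)
    then show ?case using step.IH shifted_trans by blast
  qed
  have "decoupled h W (U - W) x"
    unfolding decoupled_def
  proof (intro ballI allI impI)
    fix i j z assume ij: "i \<in> W" "j \<in> U - W" and z: "agree (W \<union> (U - W)) x z"
    have y': "agree (U - W) y (patch W y z)"
      using z assms(3,6) by (auto simp: agree_def patch_def)
    have "agree (W \<union> {j}) (patch W y z) z"
      by (auto simp: agree_def patch_def)
    then show "\<not> interact h i j z"
      using dec [OF ij(2) y' all [OF y']] ij(1) by (auto simp: decoupled_def)
  qed
  then show False
    using connectedD [OF assms(2,3,5)] assms(4) by auto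
qed

text \<open>
  Growing \<open>{w}\<close> to a subset with one variable less than \<open>U\<close> shows that some variable other than \<open>w\<close> can
  be left out, in a context that may differ from the given one.
\<close>

lemma connected_remove:
  assumes "finite U" "connected h U x" "w \<in> U" "U \<noteq> {w}"
  obtains k y where "k \<in> U - {w}" "agree U x y" "connected h (U - {k}) y"
proof -
  have grow: "\<exists>W y. w \<in> W \<and> W \<subseteq> U \<and> card W = Suc n \<and> agree U x y \<and> connected h W y" if "Suc n < card U" for n
    using that
  proof (induction n)
    case 0
    have "w \<in> {w} \<and> {w} \<subseteq> U \<and> card {w} = Suc 0 \<and> agree U x x \<and> connected h {w} x"
      using assms(3) by simp
    then show ?case by blast
  next
    case (Suc n)
    have "Suc n < card U" using Suc.prems by simp
    from Suc.IH [OF this] obtain W y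
      where W: "w \<in> W" "W \<subseteq> U" "card W = Suc n" "agree U x y" "connected h W y"
      by blast
    have "W \<noteq> U" "W \<noteq> {}" using W Suc.prems by auto
    then obtain k y' where k: "k \<in> U - W" "agree (U - W) y y'" "connected h (insert k W) y'"
      using connected_extend [OF assms(1,2) W(2) _ _ W(4,5)] by blast
    have "agree U x y'"
      using W(4) k(2) by (meson Diff_subset agree_mono agree_trans)
    moreover have "card (insert k W) = Suc (Suc n)"
      using W(2,3) k(1) by (simp add: finite_subset [OF W(2) assms(1)])
    moreover have "w \<in> insert k W" "insert k W \<subseteq> U"
      using W(1,2) k(1) by auto
    ultimately show ?case
      using k(3) by blast
  qed
  have two: "2 \<le> card U"
  proof -
    have "{w} \<subset> U" using assms(3,4) by blast
    from psubset_card_mono [OF assms(1) this] show ?thesis by simp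
  qed
  have "Suc (card U - 2) < card U" using two by simp
  from grow [OF this] obtain W y where W: "w \<in> W" "W \<subseteq> U" "card W = Suc (card U - 2)" "agree U x y" "connected h W y"
    by blast
  have "card (U - W) = 1"
    using W(2,3) two by (simp add: card_Diff_subset finite_subset [OF W(2) assms(1)])
  then obtain k where "U - W = {k}" by (auto simp: card_1_singleton_iff)
  then have "k \<in> U - {w}" and "W = U - {k}" using W(1,2) by auto
  then show thesis using that [of k y] W(4,5) by simp
qed

text \<open>Every variable lies in a connected component, the smallest set containing it that splits off.\<close>

lemma connected_component:
  assumes "finite V" "v \<in> V"
  obtains K where "K \<subseteq> V" "v \<in> K" "decoupled h K (V - K) y" "connected h K y"
proof -
  define ok where "ok K \<longleftrightarrow> K \<subseteq> V \<and> v \<in> K \<and> decoupled h K (V - K) y" for K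
  have "ok V" unfolding ok_def decoupled_def Diff_cancel using assms(2) by blast
  from ex_has_least_nat [of ok V card, OF this]
  obtain K where "ok K \<and> (\<forall>A. ok A \<longrightarrow> card K \<le> card A)" ..
  then have "ok K" and least: "\<And>A. ok A \<Longrightarrow> card K \<le> card A" by blast+
  then have K: "K \<subseteq> V" "v \<in> K" "decoupled h K (V - K) y" by (simp_all add: ok_def)
  have finK: "finite K" by (rule finite_subset [OF K(1) assms(1)])
  have finVK: "finite (V - K)" using assms(1) by (rule finite_Diff)
  have VK: "K \<union> (V - K) = V" using K(1) by blast
  have "ok A" if A: "A \<subseteq> K" "v \<in> A" "decoupled h A (K - A) y" for A
  proof -
    have "\<not> interact h i j z" if ij: "i \<in> A" "j \<in> V - A" and z: "agree (A \<union> (V - A)) y z" for i j z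
    proof -
      have "A \<union> (V - A) = V" using A(1) K(1) by blast
      then have zV: "agree V y z" using z by simp
      show ?thesis
      proof (cases "j \<in> K")
        case True
        have "agree (V - K) y (patch K y z)"
          using zV by (simp add: agree_def patch_def)
        then have "shifted h K y (patch K y z)"
          using decoupled_shifted [OF finK finVK _ K(3)] by blast
        then have "interact h i j (patch K z y) = interact h i j z"
          using shifted_interact [of h K y "patch K y z" i j z] ij(1) A(1) True by auto
        moreover have "agree (A \<union> (K - A)) y (patch K z y)"
        proof -
          have "A \<union> (K - A) = K" using A(1) by blast
          then show ?thesis by simp
        qed
        ultimately show ?thesis
          using A(3) ij True unfolding decoupled_def by blast
      next
        case False
        then show ?thesis
          using K(3) ij A(1) zV unfolding decoupled_def VK by blast
      qed
    qed
    then have "decoupled h A (V - A) y" unfolding decoupled_def by blast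
    then show ?thesis using A(1,2) K(1) unfolding ok_def by blast
  qed
  then have small: "A = K" if "A \<subseteq> K" "v \<in> A" "decoupled h A (K - A) y" for A
    using card_seteq [OF finK that(1)] least that by blast
  have "A = K" if A: "A \<subseteq> K" "A \<noteq> {}" "decoupled h A (K - A) y" for A
  proof (cases "v \<in> A")
    case True then show ?thesis using small A by blast
  next
    case False
    have "K - (K - A) = A" using A(1) by blast
    moreover have "decoupled h (K - A) A y"
      using A(3) decoupled_commute [of A "K - A" h y] by blast
    ultimately have "K - A = K"
      using small [of "K - A"] False K(2) by simp
    then show ?thesis using A by blast
  qed
  then have "connected h K y"
    unfolding connected_def by blast
  with K show thesis by (rule that)
qed

text \<open>
  The retract to a component changes only by a constant when the context changes.
\<close>

lemma connected_split_off:
  assumes "finite V" "K \<subseteq> V" "decoupled h K (V - K) y" "connected h K y" "agree V y y'"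
  shows "connected h K y'"
proof -
  have "agree (V - K) y (patch K y y')"
    using assms(5) by (simp add: agree_def patch_def)
  then have "shifted h K y (patch K y y')"
    by (rule decoupled_shifted [OF finite_subset [OF assms(2,1)] finite_Diff [OF assms(1)] Diff_disjoint assms(3)])
  then have "connected h K (patch K y y')"
    using connected_shifted [of h K y "patch K y y'"] assms(4) by simp
  then show ?thesis
    using connected_cong [of K y' "patch K y y'" h] by simp
qed

section \<open>Quasigroups of order 4 and the types of their binary retracts\<close>

lemma k4_other: "\<exists>c. c \<noteq> 0 \<and> c \<noteq> (D :: k4)"
proof (cases "D = K1")
  case True
  then have "K2 \<noteq> 0 \<and> K2 \<noteq> D" by (simp add: zero_k4_def)
  then show ?thesis ..
next
  case False
  then have "K1 \<noteq> 0 \<and> K1 \<noteq> D" by (simp add: zero_k4_def)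
  then show ?thesis ..
qed

lemma k4_card: "card (UNIV :: k4 set) = 4"
  unfolding set_k4s [symmetric] k4s_def by simp

lemma k4_class_card:
  assumes "D \<noteq> 0" "c = 0 \<or> c = D"
  shows "card {v. pr D v = c} = 2"
proof -
  have "{v. pr D v = c} = set (filter (\<lambda>v. pr D v = c) k4s)" by simp
  also have "card \<dots> = 2"
    using assms unfolding k4s_def by (cases D) (auto simp: pr_def zero_k4_def)
  finally show ?thesis .
qed

locale quasigroup4 =
  fixes f :: "('i \<Rightarrow> k4) \<Rightarrow> k4" and I :: "'i set"
  assumes finite_I: "finite I"
    and bij: "i \<in> I \<Longrightarrow> bij (\<lambda>v. f (x(i := v)))"
begin

abbreviation bitf :: "k4 \<Rightarrow> ('i \<Rightarrow> k4) \<Rightarrow> k4" where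
  "bitf D \<equiv> (\<lambda>x. pr D (f x))"

lemma inj_upd: "i \<in> I \<Longrightarrow> f (x(i := v)) = f (x(i := w)) \<longleftrightarrow> v = w"
  using bij [of i x] by (auto simp: bij_def dest: injD)

lemma surj_upd:
  assumes "i \<in> I"
  obtains v where "f (x(i := v)) = c"
  using bij [OF assms, of x] by (metis bij_pointE)

lemma finite_subI: "U \<subseteq> I \<Longrightarrow> finite U"
  by (rule finite_subset [OF _ finite_I])

lemma latin_retract:
  assumes "i \<in> I" "j \<in> I" "i \<noteq> j"
  shows "latin (\<lambda>a b. f (x(i := a, j := b)))"
  unfolding latin_def
  proof (intro conjI allI)
  show "bij (\<lambda>b. f (x(i := a, j := b)))" for a by (rule bij [OF assms(2)])
  show "bij (\<lambda>a. f (x(i := a, j := b)))" for b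
    unfolding fun_upd_twist [OF assms(3)] by (rule bij [OF assms(1)])
qed

text \<open>
  By the normal form of Latin squares, a binary retract differs from a sum of unary functions only by
  a product with values in \<open>{0, D}\<close>. If \<open>D \<noteq> 0\<close>, then among the three splittings only \<open>pr D\<close> maps it to 0.
\<close>

lemma interact_exists_type:
  assumes "i \<in> I" "j \<in> I" "i \<noteq> j"
  shows "\<exists>D. (interact f i j x \<longleftrightarrow> D \<noteq> 0) \<and>
    (\<forall>P. P \<noteq> 0 \<longrightarrow> (interact (bitf P) i j x \<longleftrightarrow> D \<noteq> 0 \<and> D \<noteq> P))"
proof -
  define F where "F a b = f (x(i := a, j := b))" for a b
  have "latin F" unfolding F_def by (rule latin_retract [OF assms])
  then obtain D where D: "\<And>a b. F a b = F a 0 + F 0 b + F 0 0 + mul D (F a 0 + F 0 0) (F 0 b + F 0 0)"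
    using latin_square_form [of F 0 0] by blast
  have no: "\<not> interact (bitf P) i j x" if "D = 0 \<or> D = P" for P
  proof -
    have "splits_square P F"
      by (rule splits_square_form [OF _ that, where g = "\<lambda>a. F a 0" and h = "\<lambda>b. F 0 b + F 0 0"
            and g' = "\<lambda>a. F a 0 + F 0 0" and h' = "\<lambda>b. F 0 b + F 0 0"])
         (subst D, simp add: ac_simps)
    then show ?thesis by (simp add: interact_def splits_square_def F_def)
  qed
  have no': "\<not> interact f i j x" if "D = 0"
  proof -
    have eq: "F a b = F a 0 + F 0 b + F 0 0" for a b
      using D [of a b] that by (simp add: mul_values)
    have "F a b + F a' b' = F a b' + F a' b" for a b a' b'
      unfolding eq [of a b] eq [of a' b'] eq [of a b'] eq [of a' b] by (simp only: ac_simps)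
    then show ?thesis by (simp add: interact_def F_def)
  qed
  have yes: "\<exists>a b. F a b + F 0 0 + (F a 0 + F 0 b) = D" if "D \<noteq> 0"
  proof -
    obtain c where c: "c \<noteq> 0" "c \<noteq> D" using k4_other by blast
    obtain a where a: "F a 0 = c + F 0 0"
      using surj_upd [OF assms(1), of "x(j := 0)" "c + F 0 0"]
      unfolding F_def fun_upd_twist [OF assms(3)] by metis
    obtain b where b: "F 0 b = c + F 0 0"
      using surj_upd [OF assms(2), of "x(i := 0)" "c + F 0 0"] unfolding F_def by metis
    have "F a b = F a 0 + F 0 b + F 0 0 + D"
      using D [of a b] a b c that by (simp add: mul_values add.assoc)
    then have "F a b + F 0 0 + (F a 0 + F 0 b) = D"
      by (simp add: ac_simps)
    then show ?thesis by blast
  qed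
  have "interact f i j x" if "D \<noteq> 0"
  proof (rule ccontr)
    assume "\<not> interact f i j x"
    then have "F a b + F 0 0 = F a 0 + F 0 b" for a b
      unfolding interact_def F_def by blast
    then show False using yes [OF that] that by auto
  qed
  moreover have "interact (bitf P) i j x" if "D \<noteq> 0" "P \<noteq> 0" "D \<noteq> P" for P
  proof (rule ccontr)
    assume "\<not> interact (bitf P) i j x"
    then have "pr P (F a b) + pr P (F 0 0) = pr P (F a 0) + pr P (F 0 b)" for a b
      unfolding interact_def F_def by blast
    then have "pr P (F a b + F 0 0 + (F a 0 + F 0 b)) = 0" for a b
      by (simp add: pr_add)
    then show False using yes [OF that(1)] that pr_eq_0 by metis
  qed
  ultimately show ?thesis using no no' by metis
qed

text \<open>
  The type of the binary retract in the variables \<open>i\<close> and \<open>j\<close>: it is 0 if the retract is isotopic to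
  the four-group. Otherwise the retract is isotopic to the cyclic group, and its type \<open>D\<close> tells which
  of the three splittings of the values into pairs belongs to the subgroup of order 2.
\<close>

definition type :: "'i \<Rightarrow> 'i \<Rightarrow> ('i \<Rightarrow> k4) \<Rightarrow> k4" where
  "type i j x = (if interact f i j x then (THE D. D \<noteq> 0 \<and> \<not> interact (bitf D) i j x) else 0)"

lemma type_interact:
  assumes "i \<in> I" "j \<in> I" "i \<noteq> j"
  shows "interact f i j x \<longleftrightarrow> type i j x \<noteq> 0"
    and "P \<noteq> 0 \<Longrightarrow> interact (bitf P) i j x \<longleftrightarrow> type i j x \<noteq> 0 \<and> type i j x \<noteq> P"
proof -
  obtain D where D: "interact f i j x \<longleftrightarrow> D \<noteq> 0"
      "\<And>P. P \<noteq> 0 \<Longrightarrow> interact (bitf P) i j x \<longleftrightarrow> D \<noteq> 0 \<and> D \<noteq> P"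
    using interact_exists_type [OF assms, of x] by blast
  have "type i j x = D"
  proof (cases "D = 0")
    case True
    then show ?thesis using D(1) by (simp add: type_def)
  next
    case False
    then have "(THE D. D \<noteq> 0 \<and> \<not> interact (bitf D) i j x) = D"
      by (intro the_equality) (auto simp: D(2))
    then show ?thesis using D(1) False by (simp add: type_def)
  qed
  then show "interact f i j x \<longleftrightarrow> type i j x \<noteq> 0"
    and "P \<noteq> 0 \<Longrightarrow> interact (bitf P) i j x \<longleftrightarrow> type i j x \<noteq> 0 \<and> type i j x \<noteq> P"
    using D by simp_all
qed

lemma type_commute: "i \<noteq> j \<Longrightarrow> type i j x = type j i x"
  by (simp add: type_def interact_commute [of i j])

lemma type_upd [simp]:
  "i \<noteq> j \<Longrightarrow> type i j (x(i := c)) = type i j x" "i \<noteq> j \<Longrightarrow> type i j (x(j := c)) = type i j x"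
  by (simp_all add: type_def)

lemma type_cong: "i \<noteq> j \<Longrightarrow> agree {i, j} x y \<Longrightarrow> type i j x = type i j y"
  by (simp add: type_def interact_cong_agree [of i j x y])

lemma type_shifted:
  assumes "shifted f W y y'" "i \<in> W" "j \<in> W"
  shows "type i j (patch W u y) = type i j (patch W u y')"
proof -
  have "shifted (bitf D) W y y'" for D
    using assms(1) unfolding shifted_def by (metis pr_add)
  then have "interact (bitf D) i j (patch W u y) = interact (bitf D) i j (patch W u y')" for D
    using assms(2,3) by (rule shifted_interact)
  then show ?thesis
    by (simp add: type_def shifted_interact [OF assms])
qed

lemma decoupled_f_iff:
  assumes "A \<subseteq> I" "B \<subseteq> I" "A \<inter> B = {}"
  shows "decoupled f A B x \<longleftrightarrow> (\<forall>i\<in>A. \<forall>j\<in>B. \<forall>y. agree (A \<union> B) x y \<longrightarrow> type i j y = 0)"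
  unfolding decoupled_def using assms type_interact(1) by (metis disjoint_iff subsetD)

lemma decoupled_bit_iff:
  assumes "A \<subseteq> I" "B \<subseteq> I" "A \<inter> B = {}" "P \<noteq> 0"
  shows "decoupled (bitf P) A B x \<longleftrightarrow>
    (\<forall>i\<in>A. \<forall>j\<in>B. \<forall>y. agree (A \<union> B) x y \<longrightarrow> type i j y = 0 \<or> type i j y = P)"
  unfolding decoupled_def using assms type_interact(2) by (metis disjoint_iff subsetD)

lemma connected_bit_imp_f:
  assumes "connected (bitf P) U x" "U \<subseteq> I" "P \<noteq> 0"
  shows "connected f U x"
  unfolding connected_def
proof (intro allI impI, elim conjE)
  fix A assume A: "A \<subseteq> U" "A \<noteq> {}" "decoupled f A (U - A) x"
  have "decoupled (bitf P) A (U - A) x"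
    using A assms(2,3) by (subst (asm) decoupled_f_iff, (auto)[3], subst decoupled_bit_iff) auto
  then show "A = U" using connectedD [OF assms(1)] A by blast
qed

lemma bit_eq: "D \<noteq> 0 \<Longrightarrow> bitf D z = bitf D z' \<Longrightarrow> f z = f z' \<or> f z = f z' + D"
  by (metis k4_add_self pr_add pr_eq_0 k4_add_eq_iff add.commute add.right_neutral k4_add_left_self)

lemma bit_eq_move:
  assumes "D \<noteq> 0" "i \<in> I" "bitf D (z(i := a)) = bitf D z" "a \<noteq> z i"
  shows "f (z(i := a)) = f z + D"
  using bit_eq [OF assms(1,3)] inj_upd [OF assms(2), of z a "z i"] assms(4) by simp

text \<open>
  Each of the two columns is in the class \<open>c\<close> for two of the four values of \<open>n\<close>. As \<open>a\<close> is none of them,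
  they are chosen among three values, and so the two columns share one.
\<close>

lemma common_value:
  assumes "D \<noteq> 0" "c = 0 \<or> c = D" "n \<in> I"
    and "bitf D (z(n := a)) \<noteq> c" "bitf D (z'(n := a)) \<noteq> c"
  obtains t where "bitf D (z(n := t)) = c" "bitf D (z'(n := t)) = c"
proof -
  define T where "T z = (\<lambda>t. f (z(n := t))) -` {v. pr D v = c}" for z
  have fin: "finite A" for A :: "k4 set"
    using finite_subset [OF subset_UNIV finite_set [of k4s, unfolded set_k4s]] .
  have card: "card (T z) = 2" for z
    unfolding T_def k4_class_card [OF assms(1,2), symmetric]
    by (rule card_vimage_inj) (use bij [OF assms(3), of z] in \<open>simp_all add: bij_def\<close>)
  have "T z \<inter> T z' \<noteq> {}"
  proof
    assume "T z \<inter> T z' = {}"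
    then have "card (T z \<union> T z') = 4"
      using card_Un_disjoint [OF fin fin, of "T z" "T z'"] card by simp
    moreover have "T z \<union> T z' \<subseteq> UNIV - {a}"
      using assms(4,5) by (auto simp: T_def)
    then have "card (T z \<union> T z') \<le> card (UNIV - {a})"
      by (rule card_mono [OF fin])
    moreover have "card (UNIV - {a}) = 3"
      using fin [of UNIV] k4_card by simp
    ultimately show False by simp
  qed
  then show thesis using that by (auto simp: T_def)
qed

section \<open>Connected splittings give modules\<close>

text \<open>
  A level set of \<open>bitf D\<close>, as a graph with the pairs of points that differ in one variable as edges, is
  connected if \<open>bitf D\<close> is. In the induction step, one variable \<open>n\<close> is given the value \<open>a\<close>. The columns, in
  the direction of \<open>n\<close>, that are on the level at \<open>a\<close> are joined there to the points of the level with
  this value of \<open>n\<close>, which are connected by induction. The other columns are joined to each other, again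
  by induction, because two columns off the level at \<open>a\<close> meet it at a common value of \<open>n\<close>. An interaction
  of \<open>n\<close> with another variable links the two parts.
\<close>

lemma level_set_connected:
  assumes "K \<subseteq> I" "D \<noteq> 0" "connected (bitf D) K x"
    and "\<And>z i a. i \<in> K \<Longrightarrow> agree K x z \<Longrightarrow> bitf D (z(i := a)) = bitf D z \<Longrightarrow> G (z(i := a)) = G z"
    and "agree K x z" "agree K x z'" "bitf D z = bitf D z'"
  shows "G z = G z'"
  using assms
proof (induction "card K" arbitrary: K x G z z' rule: less_induct)
  case less
  note inv = less.prems(4)
  have finK: "finite K" using less.prems(1) by (rule finite_subI)
  show ?case
  proof (cases "K = {}")
    case True
    then have "z = z'" using less.prems(5,6) by (auto simp: agree_def fun_eq_iff)
    then show ?thesis by simp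
  next
    case False
    then obtain w where w: "w \<in> K" by blast
    show ?thesis
    proof (cases "K = {w}")
      case True
      then have "z' = z(w := z' w)" using less.prems(5,6) by (auto simp: agree_def fun_eq_iff)
      then show ?thesis using inv [of w z "z' w"] w less.prems(5,7) by metis
    next
      case False
      obtain n y where n: "n \<in> K - {w}" and y: "agree K x y" and conn: "connected (bitf D) (K - {n}) y"
        using connected_remove [OF finK less.prems(3) w False] by blast
      define W where "W = K - {n}"
      define a where "a = y n"
      have "card W < card K" unfolding W_def using n finK by (intro card_Diff1_less) auto
      then have W: "W \<subseteq> K" "n \<notin> W" "n \<in> K" "insert n W = K" "W \<noteq> {}" "card W < card K" "W \<subseteq> I" "n \<in> I"
        using n w less.prems(1) by (auto simp: W_def)
      have agW: "agree K x u" "u n = a" if "agree W y u" for u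
        using that y W by (auto simp: agree_def a_def)
      have toW: "agree W y (u(n := a))" if "agree K x u" for u
        using that y W by (auto simp: agree_def a_def)
      have invn: "G u = G (u(n := t))" if "agree K x u" "bitf D (u(n := t)) = bitf D u" for u t
        using inv [OF W(3) that] by simp
      have base: "G u = G u'" if "agree W y u" "agree W y u'" "bitf D u = bitf D u'" for u u'
      proof (rule less.hyps [OF W(6,7) less.prems(2) conn [folded W_def] _ that])
        show "G (z(i := b)) = G z" if "i \<in> W" "agree W y z" "bitf D (z(i := b)) = bitf D z" for z i b
          using inv [of i z b] that W(1) agW(1) by blast
      qed
      have vals: "bitf D u = 0 \<or> bitf D u = D" for u by (rule pr_range)
      \<comment> \<open>A point of the column of \<open>u\<close> on the level that \<open>u\<close> is not on.\<close>
      define opp where "opp u = u(n := (SOME t. bitf D (u(n := t)) = bitf D u + D))" for u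
      have opp: "bitf D (opp u) = bitf D u + D" for u
      proof -
        obtain t where "f (u(n := t)) = f u + (SOME c. c \<noteq> 0 \<and> c \<noteq> D)"
          using surj_upd [OF W(8)] by metis
        moreover have "pr D (SOME c. c \<noteq> 0 \<and> c \<noteq> D) = D"
          using someI_ex [OF k4_other [of D]] by (simp add: pr_def)
        ultimately have "bitf D (u(n := t)) = bitf D u + D" by (simp add: pr_add)
        then show ?thesis unfolding opp_def by (rule someI)
      qed
      have opp_eq: "G (opp u) = G (u(n := t))"
        if "agree K x u" "bitf D (u(n := t)) = bitf D u + D" for u t
      proof -
        have "opp u = (u(n := t))(n := opp u n)" by (simp add: opp_def)
        moreover have "agree K x (u(n := t))" using that(1) W(3) by simp
        ultimately show ?thesis using invn [of "u(n := t)" "opp u n"] that(2) opp [of u] by metis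
      qed
      have base': "G (opp u) = G (opp u')" if "agree W y u" "agree W y u'" "bitf D u = bitf D u'" for u u'
      proof (rule less.hyps [OF W(6,7) less.prems(2) conn [folded W_def] _ that, where G = "\<lambda>u. G (opp u)"])
        fix z i b assume i: "i \<in> W" and z: "agree W y z" and eq: "bitf D (z(i := b)) = bitf D z"
        have zi: "agree W y (z(i := b))" using z i by simp
        define c where "c = bitf D z + D"
        have c: "c = 0 \<or> c = D" "bitf D z \<noteq> c" using vals [of z] less.prems(2) by (auto simp: c_def)
        have "z(n := a) = z" "(z(i := b))(n := a) = z(i := b)"
          using agW(2) [OF z] agW(2) [OF zi] by (metis fun_upd_triv)+
        then obtain t where t: "bitf D (z(n := t)) = c" "bitf D ((z(i := b))(n := t)) = c"
          using common_value [OF less.prems(2) c(1) W(8), of z a "z(i := b)"] c(2) eq by metis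
        have "(z(i := b))(n := t) = (z(n := t))(i := b)"
          using i W(2) by (auto simp: fun_upd_twist)
        then have "G ((z(i := b))(n := t)) = G (z(n := t))"
          using inv [of i "z(n := t)" b] t agW(1) [OF z] i W by auto
        then show "G (opp (z(i := b))) = G (opp z)"
          using opp_eq [OF agW(1) [OF z]] opp_eq [OF agW(1) [OF zi]] t eq by (simp add: c_def)
      qed
      have link: "\<exists>p q. agree W y p \<and> agree W y q \<and> bitf D p = c \<and> bitf D q = c + D \<and> G p = G (opp q)"
        if c: "c = 0 \<or> c = D" for c
      proof -
        have "\<not> decoupled (bitf D) {n} W x"
          using connectedD [OF less.prems(3), of "{n}"] W n by (auto simp: W_def)
        then obtain i z where i: "i \<in> W" and z: "agree K x z" and int: "interact (bitf D) n i z"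
          unfolding decoupled_def using W(4) by auto
        have ni: "n \<noteq> i" using i W(2) by blast
        obtain b b' t where bt: "bitf D (z(i := b, n := a)) \<noteq> bitf D (z(i := b', n := a))"
            "bitf D (z(i := b, n := t)) = bitf D (z(i := b', n := t))"
        proof (rule ccontr)
          assume none: "\<not> thesis"
          note found = that
          define s where "s b t = bitf D (z(i := b, n := t))" for b t
          have dif: "s b t \<noteq> s b' t" if "s b a \<noteq> s b' a" for b b' t
            using none found [of b b' t] that unfolding s_def by blast
          have val: "s b t = 0 \<or> s b t = D" for b t unfolding s_def by (rule vals)
          obtain b0 where b0: "s b0 a \<noteq> s 0 a"
          proof -
            obtain v where "f ((z(n := a))(i := v)) = f (z(i := 0, n := a)) + (SOME c. c \<noteq> 0 \<and> c \<noteq> D)"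
              using surj_upd [of i] i W(7) by blast
            moreover have "pr D (SOME c. c \<noteq> 0 \<and> c \<noteq> D) = D"
              using someI_ex [OF k4_other [of D]] by (simp add: pr_def)
            ultimately have "s v a = s 0 a + D"
              by (simp add: s_def pr_add fun_upd_twist [OF ni])
            then show thesis using that less.prems(2) by (metis add_cancel_left_right)
          qed
          have same: "s b t = s b' t" if "s b a = s b' a" for b b' t
            using dif [of b b0] dif [of b' b0] dif [of b 0] dif [of b' 0] b0 that val by metis
          have "s b t + s b' t' = s b t' + s b' t" for b b' t t'
          proof (cases "s b a = s b' a")
            case True
            then show ?thesis using same by (metis add.commute)
          next
            case False
            then have "s b t + s b' t = D" "s b t' + s b' t' = D"
              using dif val by (metis add.right_neutral add_0)+
            then show ?thesis by (metis add.commute k4_add_left_self k4_add_eq_iff add.assoc)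
          qed
          then have "\<not> interact (bitf D) i n z"
            unfolding interact_def s_def by blast
          then show False using int interact_commute [OF ni] by blast
        qed
        define u v where "u = z(i := b, n := a)" and "v = z(i := b', n := a)"
        have uv: "agree W y u" "agree W y v"
          using toW [of "z(i := b)"] toW [of "z(i := b')"] z i W by (auto simp: u_def v_def)
        have upd: "u(n := r) = z(i := b, n := r)" "v(n := r) = z(i := b', n := r)" for r
          by (simp_all add: u_def v_def)
        have move: "G (u(n := r)) = G (v(n := r))" if "bitf D (u(n := r)) = bitf D (v(n := r))" for r
        proof -
          have "v(n := r) = (u(n := r))(i := b')"
            unfolding upd using ni by (auto simp: fun_upd_twist)
          moreover have "agree K x (u(n := r))" using agW(1) [OF uv(1)] W(3) by simp
          ultimately show ?thesis using inv [of i "u(n := r)" b'] i W(1) that by (metis subsetD)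
        qed
        have ne: "bitf D u \<noteq> bitf D v" using bt(1) by (simp add: u_def v_def)
        \<comment> \<open>The two columns have a common value at \<open>t\<close>, and hence also take the other value simultaneously.\<close>
        have "\<exists>r. bitf D (u(n := r)) = c \<and> bitf D (v(n := r)) = c"
        proof (cases "bitf D (u(n := t)) = c")
          case True then show ?thesis using bt(2) upd by metis
        next
          case False
          then show ?thesis using common_value [OF less.prems(2) c W(8), of u t v] bt(2) upd by metis
        qed
        then obtain r where r: "bitf D (u(n := r)) = c" "bitf D (v(n := r)) = c" by blast
        have G: "G (u(n := r)) = G (v(n := r))" using move r by simp
        show ?thesis
        proof (cases "bitf D u = c")
          case True
          then have v: "bitf D v = c + D" using ne vals [of v] c by auto
          have "G u = G (u(n := r))" using invn [OF agW(1) [OF uv(1)]] r True by simp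
          moreover have "G (opp v) = G (v(n := r))"
            using opp_eq [OF agW(1) [OF uv(2)]] r v by (simp add: add.assoc)
          ultimately show ?thesis using uv True v G by metis
        next
          case False
          then have u: "bitf D u = c + D" and v: "bitf D v = c" using ne vals [of u] vals [of v] c by auto
          have "G v = G (v(n := r))" using invn [OF agW(1) [OF uv(2)]] r v by simp
          moreover have "G (opp u) = G (u(n := r))"
            using opp_eq [OF agW(1) [OF uv(1)]] r u by (simp add: add.assoc)
          ultimately show ?thesis using uv u v G by metis
        qed
      qed
      obtain p q where pq: "agree W y p" "agree W y q" "bitf D p = bitf D z"
          "bitf D q = bitf D z + D" "G p = G (opp q)"
        using link [OF vals [of z]] by blast
      have "G u = G p" if u: "agree K x u" "bitf D u = bitf D z" for u
      proof -
        define u0 where "u0 = u(n := a)"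
        have u0: "agree W y u0" unfolding u0_def by (rule toW [OF u(1)])
        show ?thesis
        proof (cases "bitf D u0 = bitf D z")
          case True
          then have "G u = G u0" using invn [OF u(1), of a] u(2) by (simp add: u0_def)
          also have "\<dots> = G p" using base [OF u0 pq(1)] True pq(3) by simp
          finally show ?thesis .
        next
          case False
          then have eq: "bitf D u0 = bitf D z + D" using vals [of u0] vals [of z] by auto
          have "u = u0(n := u n)" by (simp add: u0_def)
          then have "G (opp u0) = G u"
            using opp_eq [OF agW(1) [OF u0], of "u n"] eq u(2) by (simp add: add.assoc)
          moreover have "G (opp u0) = G (opp q)" using base' [OF u0 pq(2)] eq pq(4) by simp
          ultimately show ?thesis using pq(5) by simp
        qed
      qed
      then show ?thesis using less.prems(5-7) by metis
    qed
  qed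
qed

end

text \<open>
  A permutation of the values transports the splitting \<open>Q\<close> to some splitting \<open>Q'\<close>, up to the names of
  the two classes.
\<close>

lemma perm_pr:
  fixes \<pi> :: "k4 \<Rightarrow> k4"
  assumes "bij \<pi>" "Q \<noteq> 0"
  obtains Q' where "Q' \<noteq> 0" "\<And>x. pr Q (\<pi> x) = (if pr Q' x = 0 then pr Q (\<pi> 0) else pr Q (\<pi> 0) + Q)"
proof -
  obtain e where e: "\<pi> e = \<pi> 0 + Q"
    using assms(1) by (metis bij_pointE)
  then have "e \<noteq> 0" using assms(2) by auto
  moreover have "pr Q (\<pi> x) = (if pr e x = 0 then pr Q (\<pi> 0) else pr Q (\<pi> 0) + Q)" for x
  proof (cases "x = 0 \<or> x = e")
    case True
    then show ?thesis using e by (auto simp: pr_add)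
  next
    case False
    then have "\<pi> x \<noteq> \<pi> 0" "\<pi> x \<noteq> \<pi> 0 + Q"
      using assms(1) e by (metis bij_is_inj injD)+
    then have "\<pi> x + \<pi> 0 \<noteq> 0" "\<pi> x + \<pi> 0 \<noteq> Q"
      by (simp_all add: k4_add_eq_iff)
    then have "pr Q (\<pi> x + \<pi> 0) = Q" by (simp add: pr_def)
    then have "pr Q (\<pi> x) = pr Q (\<pi> 0) + Q"
      unfolding pr_add by (rule k4_add_eq_iff [THEN iffD1])
    moreover have "pr e x \<noteq> 0" using False \<open>e \<noteq> 0\<close> by (simp add: pr_eq_0)
    ultimately show ?thesis by simp
  qed
  ultimately show thesis by (rule that)
qed

lemma two_valued_additive:
  fixes Q Q' c :: k4
  assumes "w1 = 0 \<or> w1 = Q'" "w2 = 0 \<or> w2 = Q'" "w3 = 0 \<or> w3 = Q'" "w4 = 0 \<or> w4 = Q'" and "Q \<noteq> 0"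
    and "(if w1 = 0 then c else c + Q) + (if w2 = 0 then c else c + Q) =
         (if w3 = 0 then c else c + Q) + (if w4 = 0 then c else c + Q)"
  shows "w1 + w2 = w3 + w4"
proof -
  have eq: "c + Q + c = Q" by (simp add: ac_simps)
  show ?thesis
    using assms by (cases "w1 = 0"; cases "w2 = 0"; cases "w3 = 0"; cases "w4 = 0") (auto simp: eq)
qed

context quasigroup4
begin

text \<open>
  The set of variables \<open>B\<close> acts as one variable towards \<open>k\<close>: on the retract in the variables \<open>B\<close> and
  \<open>k\<close>, two settings of the variables in \<open>B\<close> that give the same value of \<open>f\<close> for one value of \<open>k\<close> do so for
  every value of \<open>k\<close>.
\<close>

definition module_at :: "'i set \<Rightarrow> 'i \<Rightarrow> ('i \<Rightarrow> k4) \<Rightarrow> bool" where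
  "module_at B k x \<longleftrightarrow> (\<forall>z z' v w. agree B x z \<longrightarrow> agree B x z' \<longrightarrow>
     f (z(k := w)) = f (z'(k := w)) \<longrightarrow> f (z(k := v)) = f (z'(k := v)))"

lemma module_atD:
  "module_at B k x \<Longrightarrow> agree B x z \<Longrightarrow> agree B x z' \<Longrightarrow>
     f (z(k := w)) = f (z'(k := w)) \<Longrightarrow> f (z(k := v)) = f (z'(k := v))"
  unfolding module_at_def by blast

lemma module_cong:
  assumes "agree (insert k B) x x'" "module_at B k x"
  shows "module_at B k x'"
  unfolding module_at_def
proof (intro allI impI)
  fix z z' v w
  assume "agree B x' z" "agree B x' z'" and eq: "f (z(k := w)) = f (z'(k := w))"
  then have ag: "k \<notin> B \<Longrightarrow> agree B x (z(k := x k))" "k \<notin> B \<Longrightarrow> agree B x (z'(k := x k))"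
    "k \<in> B \<Longrightarrow> agree B x z" "k \<in> B \<Longrightarrow> agree B x z'"
    using assms(1) by (auto simp: agree_def)
  show "f (z(k := v)) = f (z'(k := v))"
  proof (cases "k \<in> B")
    case True
    then show ?thesis using module_atD [OF assms(2) ag(3,4) eq] by blast
  next
    case False
    then show ?thesis using module_atD [OF assms(2) ag(1,2), of w v] eq by simp
  qed
qed

text \<open>
  Moving a variable of \<open>B\<close> within a level set of \<open>bitf D\<close> adds \<open>D\<close> to \<open>f\<close>, both for the value \<open>w\<close> and for the
  value \<open>v\<close> of \<open>k\<close>, because \<open>k\<close> does not interact with \<open>B\<close> for \<open>bitf D\<close>. So the sum of \<open>f\<close> at the two values of
  \<open>k\<close> is invariant under such moves and depends only on the level set.
\<close>

lemma connected_module: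
  assumes "B \<subseteq> I" "k \<in> I" "k \<notin> B" "D \<noteq> 0"
    and conn: "connected (bitf D) B x" and dec: "decoupled (bitf D) B {k} x"
  shows "module_at B k x"
  unfolding module_at_def
proof (intro allI impI)
  fix z z' v w
  assume z: "agree B x z" and z': "agree B x z'" and eq: "f (z(k := w)) = f (z'(k := w))"
  have finB: "finite B" using assms(1) by (rule finite_subI)
  define x' where "x' = x(k := w)"
  have "shifted (bitf D) B x x'"
    by (rule decoupled_shifted [OF finB _ _ dec]) (use assms(3) in \<open>auto simp: x'_def\<close>)
  then have conn': "connected (bitf D) B x'"
    using conn connected_shifted by blast
  define G where "G z = f (z(k := v)) + f z" for z
  have kb: "z(k := w) = z" if "agree B x' z" for z
    using that assms(3) by (auto simp: agree_def x'_def)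
  have inv: "G (z(i := a)) = G z"
    if i: "i \<in> B" and z: "agree B x' z" and eq: "bitf D (z(i := a)) = bitf D z" for z i a
  proof (cases "a = z i")
    case False
    have ik: "i \<noteq> k" using i assms(3) by blast
    have iI: "i \<in> I" using i assms(1) by blast
    have "agree (B \<union> {k}) x z" using z by (auto simp: agree_def x'_def)
    then have "\<not> interact (bitf D) i k z"
      using dec i unfolding decoupled_def by blast
    then have "bitf D (z(i := a, k := v)) + bitf D (z(i := z i, k := w)) =
        bitf D (z(i := a, k := w)) + bitf D (z(i := z i, k := v))"
      unfolding interact_def by blast
    moreover have "z(i := a, k := w) = z(i := a)" "z(i := z i, k := w) = z"
      using kb [OF z] kb [of "z(i := a)"] z i by simp_all
    ultimately have "bitf D (z(i := a, k := v)) + bitf D z = bitf D z + bitf D (z(k := v))"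
      using eq by simp
    then have "bitf D (z(i := a, k := v)) = bitf D (z(k := v))"
      by (metis add.commute add_left_cancel)
    then have "bitf D ((z(k := v))(i := a)) = bitf D (z(k := v))"
      by (simp add: fun_upd_twist [OF ik])
    then have "f ((z(k := v))(i := a)) = f (z(k := v)) + D"
      by (rule bit_eq_move [OF assms(4) iI]) (use False ik in simp)
    moreover have "f (z(i := a)) = f z + D"
      by (rule bit_eq_move [OF assms(4) iI eq False])
    ultimately show ?thesis
      by (simp add: G_def fun_upd_twist [OF ik] ac_simps)
  qed (simp add: fun_upd_idem)
  have ag: "agree B x' (z(k := w))" "agree B x' (z'(k := w))"
    using z z' by (auto simp: agree_def x'_def)
  have "bitf D (z(k := w)) = bitf D (z'(k := w))"
    by (simp only: eq)
  from level_set_connected [OF assms(1,4) conn' _ ag this, of G] inv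
  have "G (z(k := w)) = G (z'(k := w))" by blast
  then show "f (z(k := v)) = f (z'(k := v))"
    using eq by (simp add: G_def)
qed

text \<open>
  For a module, the variable \<open>b'\<close> alone reaches, uniformly in \<open>k\<close>, every value that \<open>b\<close> reaches, even if
  the other variables of \<open>B\<close> have different values.
\<close>

lemma module_interact:
  fixes H :: "k4 \<Rightarrow> k4"
  assumes mod: "module_at B k x" and "b \<in> B" "b' \<in> B" "k \<notin> B" "B \<subseteq> I"
    and y: "agree (insert k B) x y" "agree (insert k B) x y'"
    and int: "interact (\<lambda>z. H (f z)) b k y"
  shows "interact (\<lambda>z. H (f z)) b' k y'"
proof (rule ccontr)
  assume no: "\<not> interact (\<lambda>z. H (f z)) b' k y'"
  have bI: "b \<in> I" "b' \<in> I" using assms(2,3,5) by auto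
  have "\<exists>c. \<forall>v. f (y(b := a, k := v)) = f (y'(b' := c, k := v))" for a
  proof -
    obtain c where "f ((y'(k := x k))(b' := c)) = f (y(b := a, k := x k))"
      using surj_upd [OF bI(2)] by blast
    moreover have bk: "b' \<noteq> k" using assms by auto
    ultimately have c: "f ((y(b := a))(k := x k)) = f ((y'(b' := c))(k := x k))"
      by (simp add: fun_upd_twist [OF bk])
    have "agree B x (y(b := a, k := x k))" "agree B x (y'(b' := c, k := x k))"
      using y assms(2-4) by (auto simp: agree_def)
    then have "f ((y(b := a, k := x k))(k := v)) = f ((y'(b' := c, k := x k))(k := v))" for v
      by (rule module_atD [OF mod, where w = "x k"]) (use c in simp)
    then show ?thesis by auto
  qed
  then have "\<forall>a. \<exists>c. \<forall>v. f (y(b := a, k := v)) = f (y'(b' := c, k := v))" by blast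
  then obtain g where g: "\<And>a v. f (y(b := a, k := v)) = f (y'(b' := g a, k := v))"
    by (metis)
  have "\<not> interact (\<lambda>z. H (f z)) b k y"
    using no unfolding interact_def g by blast
  then show False using int by blast
qed

lemma module_type:
  assumes "module_at B k x" "b \<in> B" "b' \<in> B" "k \<notin> B" "B \<subseteq> I"
    and "agree (insert k B) x y" "agree (insert k B) x y'"
  shows "type b k y = type b' k y'"
proof -
  have eq: "interact (\<lambda>z. H (f z)) b k y = interact (\<lambda>z. H (f z)) b' k y'" for H :: "k4 \<Rightarrow> k4"
    using module_interact [OF assms, of H] module_interact [OF assms(1,3,2,4,5,7,6), of H] by blast
  have "interact f b k y = interact f b' k y'" using eq [of "\<lambda>z. z"] by simp
  then show ?thesis by (simp add: type_def eq)
qed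

section \<open>Ternary retracts\<close>

lemma cube_decoupled:
  assumes "i \<in> I" "j \<in> I" "k \<in> I" and ne: "i \<noteq> j" "i \<noteq> k" "j \<noteq> k"
  obtains P where "P \<noteq> 0"
    "decoupled (bitf P) {j, k} {i} x \<or> decoupled (bitf P) {i, k} {j} x \<or> decoupled (bitf P) {i, j} {k} x"
proof -
  define F where "F a b c = f (x(i := a, j := b, k := c))" for a b c
  have F: "F a b c = f ((x(k := c))(i := a, j := b))" "F a b c = f ((x(j := b))(i := a, k := c))"
    "F a b c = f ((x(i := a))(j := b, k := c))" for a b c
    using ne by (auto simp: F_def fun_upd_twist)
  have "latin (\<lambda>a b. F a b c)" "latin (\<lambda>a c. F a b c)" "latin (\<lambda>b c. F a b c)" for a b c
    unfolding F(1)
    subgoal by (rule latin_retract) (use assms in auto)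
    subgoal unfolding F(1) [symmetric] F(2) by (rule latin_retract) (use assms in auto)
    subgoal unfolding F(1) [symmetric] F(3) by (rule latin_retract) (use assms in auto)
    done
  then obtain P where P: "P \<noteq> 0"
    "(\<forall>k. splits_square P (\<lambda>i j. F i j k)) \<and> (\<forall>j. splits_square P (\<lambda>i k. F i j k)) \<or>
     (\<forall>k. splits_square P (\<lambda>i j. F i j k)) \<and> (\<forall>i. splits_square P (\<lambda>j k. F i j k)) \<or>
     (\<forall>j. splits_square P (\<lambda>i k. F i j k)) \<and> (\<forall>i. splits_square P (\<lambda>j k. F i j k))"
    using latin_cube_splits [of F] by metis
  have ij: "\<not> interact (bitf P) i j y" if "\<forall>k. splits_square P (\<lambda>i j. F i j k)" "agree {i, j, k} x y" for y
  proof -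
    have "y(i := a, j := b) = (x(k := y k))(i := a, j := b)" for a b
      using that(2) ne by (auto simp: agree_def fun_eq_iff)
    then show ?thesis using that(1) by (simp add: interact_def splits_square_def F(1))
  qed
  have ik: "\<not> interact (bitf P) i k y" if "\<forall>j. splits_square P (\<lambda>i k. F i j k)" "agree {i, j, k} x y" for y
  proof -
    have "y(i := a, k := b) = (x(j := y j))(i := a, k := b)" for a b
      using that(2) ne by (auto simp: agree_def fun_eq_iff)
    then show ?thesis using that(1) by (simp add: interact_def splits_square_def F(2))
  qed
  have jk: "\<not> interact (bitf P) j k y" if "\<forall>i. splits_square P (\<lambda>j k. F i j k)" "agree {i, j, k} x y" for y
  proof -
    have "y(j := a, k := b) = (x(i := y i))(j := a, k := b)" for a b
      using that(2) ne by (auto simp: agree_def fun_eq_iff)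
    then show ?thesis using that(1) by (simp add: interact_def splits_square_def F(3))
  qed
  have sets: "{j, k} \<union> {i} = {i, j, k}" "{i, k} \<union> {j} = {i, j, k}" "{i, j} \<union> {k} = {i, j, k}" by auto
  have "decoupled (bitf P) {j, k} {i} x \<or> decoupled (bitf P) {i, k} {j} x \<or> decoupled (bitf P) {i, j} {k} x"
    unfolding decoupled_def sets
    using P(2) ij ik jk interact_commute [OF ne(1), of "bitf P"] interact_commute [OF ne(2), of "bitf P"]
      interact_commute [OF ne(3), of "bitf P"]
    by blast
  then show thesis using that P(1) by blast
qed

text \<open>
  The two kinds of ternary retracts. In a nested one the values of \<open>i\<close> and \<open>j\<close> are combined first, and
  some values of \<open>k\<close> exchange the two splittings other than \<open>D\<close> for the inner operation.
\<close>

definition uniform3 :: "'i \<Rightarrow> 'i \<Rightarrow> 'i \<Rightarrow> ('i \<Rightarrow> k4) \<Rightarrow> bool" where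
  "uniform3 i j k x \<longleftrightarrow> (\<exists>P. P \<noteq> 0 \<and> (\<forall>y. agree {i, j, k} x y \<longrightarrow>
     type i j y \<in> {0, P} \<and> type i k y \<in> {0, P} \<and> type j k y \<in> {0, P}))"

definition nested3 :: "'i \<Rightarrow> 'i \<Rightarrow> 'i \<Rightarrow> ('i \<Rightarrow> k4) \<Rightarrow> bool" where
  "nested3 i j k x \<longleftrightarrow> (\<exists>D. D \<noteq> 0 \<and> (\<forall>y. agree {i, j, k} x y \<longrightarrow>
     type i k y = D \<and> type j k y = D \<and> type i j y \<noteq> 0 \<and> type i j y \<noteq> D \<and>
     (\<exists>v. type i j (y(k := v)) \<noteq> type i j y)))"

lemma pair_connected:
  assumes "i \<noteq> j" "interact h i j y"
  shows "connected h {i, j} y"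
proof -
  have "\<not> decoupled h {j} {i} y"
    using assms interact_commute [of j i h y] unfolding decoupled_def by force
  from connected_insert [OF connected_singleton _ _ this] assms(1)
  have "connected h (insert i {j}) y" by blast
  then show ?thesis by simp
qed

text \<open>
  In a nested ternary retract the inner pair \<open>i, j\<close> is a module, so that moving \<open>k\<close> permutes the
  values of the inner operation; the permutations fix the splitting \<open>D\<close> and some of them exchange
  the other two splittings, since otherwise they would respect a second splitting, for which the
  retract would be uniform.
\<close>

lemma decoupled_cube_cases:
  assumes "i \<in> I" "j \<in> I" "k \<in> I" and ne: "i \<noteq> j" "i \<noteq> k" "j \<noteq> k"
    and P: "P \<noteq> 0" and dec: "decoupled (bitf P) {i, j} {k} x"
  shows "uniform3 i j k x \<or> nested3 i j k x"
proof -
  have cube: "{i, j} \<union> {k} = {i, j, k}" by auto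
  have sub: "{i, j} \<subseteq> I" "{k} \<subseteq> I" "{i, j} \<inter> {k} = {}" using assms by auto
  have side: "type i k y \<in> {0, P}" "type j k y \<in> {0, P}" if "agree {i, j, k} x y" for y
    using dec that unfolding decoupled_bit_iff [OF sub P] cube by auto
  show ?thesis
  proof (cases "\<forall>y. agree {i, j, k} x y \<longrightarrow> type i j y \<in> {0, P}")
    case True
    then show ?thesis unfolding uniform3_def using side P by blast
  next
    case False
    then obtain y0 where y0: "agree {i, j, k} x y0" "type i j y0 \<noteq> 0" "type i j y0 \<noteq> P" by auto
    have int0: "interact (bitf P) i j y0"
      using y0 type_interact(2) [OF assms(1,2) ne(1) P] by simp
    have dec0: "decoupled (bitf P) {i, j} {k} y0"
      using dec decoupled_cong [of "{i, j}" "{k}" x y0 "bitf P"] y0(1) unfolding cube by blast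
    have mod: "module_at {i, j} k y0"
      by (rule connected_module [OF sub(1) assms(3) _ P pair_connected [OF ne(1) int0] dec0]) (use ne in auto)
    define T where "T = type i k y0"
    have cube': "insert k {i, j} = {i, j, k}" by auto
    have T: "type i k y = T" "type j k y = T" if "agree {i, j, k} x y" for y
    proof -
      have "agree (insert k {i, j}) y0 y" "agree (insert k {i, j}) y0 y0"
        unfolding cube' using that y0(1) by (meson agree_sym agree_trans agree_refl)+
      then show "type i k y = T" "type j k y = T"
        unfolding T_def using module_type [OF mod] sub ne by blast+
    qed
    have ij_move: "y = patch {i, j} y (y0(k := y k))" if "agree {i, j, k} x y" for y
      using that y0(1) by (auto simp: agree_def patch_def fun_eq_iff)
    have y0_patch: "patch {i, j} y y0 = y0(i := y i, j := y j)" for y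
      by (auto simp: patch_def fun_eq_iff)
    show ?thesis
    proof (cases "T = 0")
      case True
      have "decoupled f {i, j} {k} y0"
        unfolding decoupled_f_iff [OF sub] cube
        using T True y0(1) agree_trans by blast
      then have sh: "shifted f {i, j} y0 (y0(k := v))" for v
        by (rule decoupled_shifted [rotated 3]) (use ne in auto)
      have "type i j y = type i j y0" if "agree {i, j, k} x y" for y
      proof -
        have "type i j y = type i j (patch {i, j} y (y0(k := y k)))"
          using ij_move [OF that] by simp
        also have "\<dots> = type i j (patch {i, j} y y0)"
          by (rule type_shifted [OF sh, symmetric]) auto
        also have "\<dots> = type i j y0"
          unfolding y0_patch using ne(1) by simp
        finally show ?thesis .
      qed
      then show ?thesis
        unfolding uniform3_def using y0(2) T True by (intro disjI1 exI [of _ "type i j y0"]) auto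
    next
      case False
      then have TP: "T = P" using side(1) [OF y0(1)] T_def by auto
      have sh: "shifted (bitf P) {i, j} y0 (y0(k := v))" for v
        by (rule decoupled_shifted [OF _ _ _ dec0]) (use ne in auto)
      have out: "type i j y \<noteq> 0 \<and> type i j y \<noteq> P" if "agree {i, j, k} x y" for y
      proof -
        have "interact (bitf P) i j (patch {i, j} y y0)"
          unfolding y0_patch using int0 ne(1) by simp
        then have "interact (bitf P) i j (patch {i, j} y (y0(k := y k)))"
          using shifted_interact [OF sh, of i j y] by simp
        then have "interact (bitf P) i j y" using ij_move [OF that] by simp
        then show ?thesis using type_interact(2) [OF assms(1,2) ne(1) P] by simp
      qed
      have "\<exists>v. type i j (y(k := v)) \<noteq> type i j y" if y: "agree {i, j, k} x y" for y
      proof (rule ccontr)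
        assume const: "\<not> ?thesis"
        define Q where "Q = type i j y"
        have Q: "type i j (y(k := v)) = Q" for v using const by (simp add: Q_def)
        have Q0: "Q \<noteq> 0" "Q \<noteq> P" using out [OF y] by (simp_all add: Q_def)
        define w where "w = y k"
        have ag: "agree {i, j} y0 (y(i := a, k := y0 k))" for a
          using y y0(1) ne by (auto simp: agree_def)
        have bi: "bij (\<lambda>a. f (y(i := a)))" by (rule bij [OF assms(1)])
        \<comment> \<open>The permutation of the values that replacing \<open>w\<close> by \<open>v\<close> in the variable \<open>k\<close> induces.\<close>
        have "\<exists>\<pi>. bij \<pi> \<and> (\<forall>z. agree {i, j} y z \<longrightarrow> f (z(k := v)) = \<pi> (f z))" for v
        proof -
          define \<pi> where "\<pi> c = f (y(i := inv (\<lambda>a. f (y(i := a))) c, k := v))" for c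
          have "bij (\<lambda>a. f ((y(k := v))(i := a)))" by (rule bij [OF assms(1)])
          from bij_comp [OF bij_imp_bij_inv [OF bi] this]
          have "bij \<pi>" unfolding comp_def \<pi>_def fun_upd_twist [OF ne(2)] .
          moreover have "f (z(k := v)) = \<pi> (f z)" if z: "agree {i, j} y z" for z
          proof -
            define a where "a = inv (\<lambda>a. f (y(i := a))) (f z)"
            have "f (y(i := a)) = f z"
              unfolding a_def using surj_f_inv_f [OF bij_is_surj [OF bi]] .
            moreover have "agree {i, j} y (y(i := a))" by simp
            moreover have "module_at {i, j} k y"
              by (rule module_cong [OF _ mod]) (use y y0(1) cube' agree_sym agree_trans in metis)
            moreover have "z(k := w) = z" "(y(i := a))(k := w) = y(i := a)"
              using z ne by (auto simp: agree_def w_def fun_eq_iff)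
            ultimately have "f (z(k := v)) = f ((y(i := a))(k := v))"
              using module_atD [of "{i, j}" k y z "y(i := a)" w v] z by simp
            then show ?thesis by (simp add: \<pi>_def a_def)
          qed
          ultimately show ?thesis by blast
        qed
        then have "\<forall>v. \<exists>\<pi>. bij \<pi> \<and> (\<forall>z. agree {i, j} y z \<longrightarrow> f (z(k := v)) = \<pi> (f z))" by blast
        then obtain \<pi> where \<pi>: "\<And>v. bij (\<pi> v)" "\<And>v z. agree {i, j} y z \<Longrightarrow> f (z(k := v)) = \<pi> v (f z)"
          by metis
        have keep: "pr Q (\<pi> v c') = (if pr Q c' = 0 then pr Q (\<pi> v 0) else pr Q (\<pi> v 0) + Q)" for v c'
        proof -
          define c where "c = pr Q (\<pi> v 0)"
          obtain Q' where Q': "Q' \<noteq> 0" "\<And>x. pr Q (\<pi> v x) = (if pr Q' x = 0 then c else c + Q)"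
            using perm_pr [OF \<pi>(1) Q0(1)] unfolding c_def by blast
          have "\<not> interact (bitf Q) i j (y(k := v))"
            using type_interact(2) [OF assms(1,2) ne(1) Q0(1)] Q by simp
          then have sum: "bitf Q ((y(k := v))(i := a, j := b)) + bitf Q ((y(k := v))(i := a', j := b')) =
              bitf Q ((y(k := v))(i := a, j := b')) + bitf Q ((y(k := v))(i := a', j := b))" for a b a' b'
            unfolding interact_def by blast
          have at_v: "f ((y(k := v))(i := a, j := b)) = \<pi> v (f (y(i := a, j := b)))" for a b
          proof -
            have "(y(k := v))(i := a, j := b) = (y(i := a, j := b))(k := v)"
              using ne by (auto simp: fun_eq_iff)
            then show ?thesis using \<pi>(2) [of "y(i := a, j := b)" v] by simp
          qed
          have add: "pr Q (\<pi> v (f (y(i := a, j := b)))) + pr Q (\<pi> v (f (y(i := a', j := b')))) =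
              pr Q (\<pi> v (f (y(i := a, j := b')))) + pr Q (\<pi> v (f (y(i := a', j := b))))" for a b a' b'
            using sum [of a b a' b'] unfolding at_v .
          have "pr Q' (f (y(i := a, j := b))) + pr Q' (f (y(i := a', j := b'))) =
              pr Q' (f (y(i := a, j := b'))) + pr Q' (f (y(i := a', j := b)))" for a b a' b'
            using add [of a b a' b'] unfolding Q'(2)
            by (rule two_valued_additive [OF pr_range pr_range pr_range pr_range Q0(1)])
          then have "\<not> interact (bitf Q') i j y" unfolding interact_def by blast
          then have "Q' = Q"
            using type_interact(2) [OF assms(1,2) ne(1) Q'(1)] Q0 Q_def by auto
          then show ?thesis using Q'(2) [of c'] by (simp add: c_def)
        qed
        have "\<not> interact (bitf Q) i k y"
        proof -
          have "bitf Q (y(i := a, k := v)) = bitf Q (y(i := a)) + pr Q (\<pi> v 0)" for a v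
            using \<pi>(2) [of "y(i := a)" v] keep [of v "f (y(i := a))"] pr_range [of Q "f (y(i := a))"]
            by (auto simp: add.commute)
          then show ?thesis unfolding interact_def by (simp add: ac_simps)
        qed
        then have "type i k y = 0 \<or> type i k y = Q"
          using type_interact(2) [OF assms(1,3) ne(2) Q0(1)] by blast
        then show False using T(1) [OF y] TP P Q0 by auto
      qed
      then show ?thesis
        unfolding nested3_def using T TP P out by (intro disjI2 exI [of _ P]) blast
    qed
  qed
qed

end

context quasigroup4
begin

lemma uniform3_perm:
  assumes "i \<noteq> j" "i \<noteq> k" "j \<noteq> k"
  shows "uniform3 j k i x \<Longrightarrow> uniform3 i j k x" "uniform3 i k j x \<Longrightarrow> uniform3 i j k x"
proof -
  have "{j, k, i} = {i, j, k}" "{i, k, j} = {i, j, k}" by auto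
  then show "uniform3 j k i x \<Longrightarrow> uniform3 i j k x" "uniform3 i k j x \<Longrightarrow> uniform3 i j k x"
    using assms unfolding uniform3_def by (simp_all add: type_commute [of j i] type_commute [of k i] type_commute [of k j]) blast+
qed

lemma triple_cases:
  assumes "i \<in> I" "j \<in> I" "k \<in> I" and ne: "i \<noteq> j" "i \<noteq> k" "j \<noteq> k"
  shows "uniform3 i j k x \<or> nested3 i j k x \<or> nested3 i k j x \<or> nested3 j k i x"
proof -
  obtain P where "P \<noteq> 0"
    "decoupled (bitf P) {j, k} {i} x \<or> decoupled (bitf P) {i, k} {j} x \<or> decoupled (bitf P) {i, j} {k} x"
    using cube_decoupled [OF assms] by blast
  then show ?thesis
    using decoupled_cube_cases [OF assms] decoupled_cube_cases [of i k j P x]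
      decoupled_cube_cases [of j k i P x] uniform3_perm [OF ne] assms by metis
qed

lemma uniform3E:
  assumes "uniform3 i j k x"
  obtains P where "P \<noteq> 0" "\<And>y. agree {i, j, k} x y \<Longrightarrow> type i j y = 0 \<or> type i j y = P"
    "\<And>y. agree {i, j, k} x y \<Longrightarrow> type i k y = 0 \<or> type i k y = P"
    "\<And>y. agree {i, j, k} x y \<Longrightarrow> type j k y = 0 \<or> type j k y = P"
  using assms unfolding uniform3_def by auto

text \<open>
  Two different nonzero types of \<open>i, j\<close> occur only if the retract is nested with \<open>i, j\<close> inside. The outer
  type differs from both, and so it is their sum.
\<close>

lemma type_changes:
  assumes "i \<in> I" "j \<in> I" "k \<in> I" and ne: "i \<noteq> j" "i \<noteq> k" "j \<noteq> k"
    and y: "agree {i, j, k} y y'" "type i j y \<noteq> 0" "type i j y' \<noteq> 0" "type i j y \<noteq> type i j y'"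
    and z: "agree {i, j, k} y z"
  shows "type i k z = type i j y + type i j y'" "type j k z = type i j y + type i j y'"
proof -
  have "\<not> uniform3 i j k y"
  proof
    assume "uniform3 i j k y"
    then obtain P where "\<And>z. agree {i, j, k} y z \<Longrightarrow> type i j z = 0 \<or> type i j z = P"
        "\<And>z. agree {i, j, k} y z \<Longrightarrow> type j k z = 0 \<or> type j k z = P"
      by (rule uniform3E) blast
    from this(1) [OF agree_refl] this [OF y(1)] show False using y(2-4) by auto
  qed
  moreover have "\<not> nested3 i k j y"
  proof
    assume "nested3 i k j y"
    then obtain D where "\<And>z. agree {i, k, j} y z \<Longrightarrow> type i j z = D"
      unfolding nested3_def by blast
    moreover have "{i, k, j} = {i, j, k}" by auto
    ultimately show False using y agree_refl by metis
  qed
  moreover have "\<not> nested3 j k i y"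
  proof
    assume "nested3 j k i y"
    then obtain D where "\<And>z. agree {j, k, i} y z \<Longrightarrow> type j i z = D"
      unfolding nested3_def by blast
    moreover have "{j, k, i} = {i, j, k}" by auto
    ultimately show False using y agree_refl type_commute [OF ne(1)] by metis
  qed
  ultimately have "nested3 i j k y" using triple_cases [OF assms(1-6)] by blast
  then obtain D where D: "D \<noteq> 0" "\<And>z. agree {i, j, k} y z \<Longrightarrow> type i k z = D \<and> type j k z = D \<and> type i j z \<noteq> 0 \<and> type i j z \<noteq> D"
    unfolding nested3_def by blast
  have "D = type i j y + type i j y'"
    using D(2) [of y] D(2) [OF y(1)] D(1) y(2-4) k4_third [of "type i j y" "type i j y'" D] by auto
  then show "type i k z = type i j y + type i j y'" "type j k z = type i j y + type i j y'"
    using D(2) [OF z] by auto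
qed

text \<open>
  Two pairs with different nonzero types exclude a uniform retract. In a nested one, \<open>i, k\<close> cannot be the
  inner pair, as then \<open>i, j\<close> and \<open>j, k\<close> would both have the outer type; so the outer type is one of the two
  given types.
\<close>

lemma two_types:
  assumes "i \<in> I" "j \<in> I" "k \<in> I" and ne: "i \<noteq> j" "i \<noteq> k" "j \<noteq> k"
    and y: "agree {i, j, k} y y'" "type i j y \<noteq> 0" "type j k y' \<noteq> 0" "type i j y \<noteq> type j k y'"
  shows "(\<forall>z. agree {i, j, k} y z \<longrightarrow> type j k z = type j k y' \<and> type i k z = type j k y' \<and>
             type i j z \<noteq> type j k y' \<and> (\<exists>v. type i j (z(k := v)) \<noteq> type i j z)) \<or>
         (\<forall>z. agree {i, j, k} y z \<longrightarrow> type i j z = type i j y \<and> type i k z = type i j y \<and>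
             type j k z \<noteq> type i j y \<and> (\<exists>v. type j k (z(i := v)) \<noteq> type j k z))"
proof -
  have sets: "{i, k, j} = {i, j, k}" "{j, k, i} = {i, j, k}" by auto
  have comm: "type k j z = type j k z" "type j i z = type i j z" "type k i z = type i k z" for z
    using type_commute ne by metis+
  have "\<not> uniform3 i j k y"
  proof
    assume "uniform3 i j k y"
    then obtain P where "\<And>z. agree {i, j, k} y z \<Longrightarrow> type i j z = 0 \<or> type i j z = P"
        "\<And>z. agree {i, j, k} y z \<Longrightarrow> type j k z = 0 \<or> type j k z = P"
      by (rule uniform3E) blast
    from this(1) [OF agree_refl] this [OF y(1)] show False using y(2-4) by auto
  qed
  moreover have "\<not> nested3 i k j y"
  proof
    assume "nested3 i k j y"
    then obtain D where "\<And>z. agree {i, j, k} y z \<Longrightarrow> type i j z = D \<and> type j k z = D"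
      unfolding nested3_def sets comm by blast
    then show False using y agree_refl by metis
  qed
  ultimately consider "nested3 i j k y" | "nested3 j k i y" using triple_cases [OF assms(1-6)] by blast
  then show ?thesis
  proof cases
    case 1
    then obtain D where D: "\<And>z. agree {i, j, k} y z \<Longrightarrow>
        type j k z = D \<and> type i k z = D \<and> type i j z \<noteq> D \<and> (\<exists>v. type i j (z(k := v)) \<noteq> type i j z)"
      unfolding nested3_def by blast
    have "D = type j k y'" using D [OF y(1)] by simp
    then show ?thesis using D by blast
  next
    case 2
    then obtain D where D: "\<And>z. agree {i, j, k} y z \<Longrightarrow>
        type i j z = D \<and> type i k z = D \<and> type j k z \<noteq> D \<and> (\<exists>v. type j k (z(i := v)) \<noteq> type j k z)"
      unfolding nested3_def sets comm by blast
    have "D = type i j y" using D [OF agree_refl] by simp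
    then show ?thesis using D by blast
  qed
qed

lemma zero_type_uniform:
  assumes "i \<in> I" "j \<in> I" "k \<in> I" and ne: "i \<noteq> j" "i \<noteq> k" "j \<noteq> k" and "type i j x = 0"
  shows "uniform3 i j k x"
proof -
  have sets: "{i, k, j} = {i, j, k}" "{j, k, i} = {i, j, k}" by auto
  have "\<not> nested3 i j k x" "\<not> nested3 i k j x" "\<not> nested3 j k i x"
    unfolding nested3_def sets using assms(7) agree_refl type_commute [OF ne(1)] by metis+
  then show ?thesis using triple_cases [OF assms(1-6)] by blast
qed

lemma zero_type_uniform':
  assumes "i \<in> I" "j \<in> I" "k \<in> I" and ne: "i \<noteq> j" "i \<noteq> k" "j \<noteq> k"
    and "type i j x = 0" "agree {i, j, k} x y" "T \<noteq> 0" "type i j y = T \<or> type i k y = T \<or> type j k y = T"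
    and z: "agree {i, j, k} x z"
  shows "type i j z = 0 \<or> type i j z = T" "type i k z = 0 \<or> type i k z = T" "type j k z = 0 \<or> type j k z = T"
proof -
  obtain P where P: "\<And>z. agree {i, j, k} x z \<Longrightarrow> type i j z \<in> {0, P} \<and> type i k z \<in> {0, P} \<and> type j k z \<in> {0, P}"
    using zero_type_uniform [OF assms(1-7)] unfolding uniform3_def by blast
  have "P = T" using P [OF assms(8)] assms(9,10) by auto
  then show "type i j z = 0 \<or> type i j z = T" "type i k z = 0 \<or> type i k z = T" "type j k z = 0 \<or> type j k z = T"
    using P [OF z] by auto
qed

section \<open>Components and colours\<close>

text \<open>
  Every variable outside a component sees it as a module, in every context of the ambient set.
\<close>

lemma component_module:
  assumes "V \<subseteq> I" "K \<subseteq> V" "D \<noteq> 0" "decoupled (bitf D) K (V - K) y" "connected (bitf D) K y"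
    and "k \<in> V - K" "agree V y z"
  shows "module_at K k z"
proof (rule connected_module [of K k D])
  show "connected (bitf D) K z"
    by (rule connected_split_off [OF finite_subI [OF assms(1)] assms(2,4,5,7)])
  show "decoupled (bitf D) K {k} z"
    by (rule decoupled_mono [OF assms(4)]) (use assms in \<open>auto simp: Un_absorb1\<close>)
qed (use assms in auto)

text \<open>
  If \<open>f\<close> does not split on \<open>V\<close>, at most one \<open>bitf D\<close> does: a second splitting would cut some
  component of the first one, but a variable of another component, towards which it is a module,
  interacts with both of its parts alike.
\<close>

lemma split_unique:
  assumes "V \<subseteq> I" "connected f V y" "D \<noteq> 0" "\<not> connected (bitf D) V y" "P \<noteq> 0" "P \<noteq> D"
  shows "connected (bitf P) V y"
proof (rule ccontr)
  assume "\<not> ?thesis"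
  then obtain A where A: "A \<subseteq> V" "A \<noteq> {}" "A \<noteq> V" "decoupled (bitf P) A (V - A) y"
    by (rule not_connectedE)
  have VA: "A \<union> (V - A) = V" using A(1) by auto
  have subA: "A \<subseteq> I" "V - A \<subseteq> I" "A \<inter> (V - A) = {}" using A(1) assms(1) by auto
  have crossA: "type i j z = 0 \<or> type i j z = P" if "i \<in> A" "j \<in> V - A" "agree V y z" for i j z
    using A(4) that unfolding decoupled_bit_iff [OF subA assms(5)] VA by blast
  have "\<not> decoupled f A (V - A) y" using connectedD [OF assms(2) A(1,2)] A(3) by blast
  then obtain i j z where ij: "i \<in> A" "j \<in> V - A" "agree V y z" "type i j z \<noteq> 0"
    unfolding decoupled_f_iff [OF subA] VA by blast
  then have tij: "type i j z = P" using crossA by blast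
  obtain K where K: "K \<subseteq> V" "i \<in> K" "decoupled (bitf D) K (V - K) y" "connected (bitf D) K y"
    using connected_component [OF finite_subI [OF assms(1)], of i "bitf D" y] ij(1) A(1) by blast
  have VK: "K \<union> (V - K) = V" using K(1) by auto
  have subK: "K \<subseteq> I" "V - K \<subseteq> I" "K \<inter> (V - K) = {}" using K(1) assms(1) by auto
  have crossK: "type i j z = 0 \<or> type i j z = D" if "i \<in> K" "j \<in> V - K" "agree V y z" for i j z
    using K(3) that unfolding decoupled_bit_iff [OF subK assms(3)] VK by blast
  have j: "j \<in> K" using crossK [OF K(2) _ ij(3)] ij(2) tij assms(5,6) by auto
  have "K \<noteq> V" using K(4) assms(4) by auto
  then have "\<not> decoupled f K (V - K) y" using connectedD [OF assms(2) K(1)] K(2) by blast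
  then obtain k m z' where km: "k \<in> K" "m \<in> V - K" "agree V y z'" "type k m z' \<noteq> 0"
    unfolding decoupled_f_iff [OF subK] VK by blast
  have mod: "module_at K m z'" by (rule component_module [OF assms(1) K(1) assms(3) K(3,4) km(2,3)])
  have "m \<notin> K" using km(2) by blast
  then have "type i m z' = type k m z'" "type j m z' = type k m z'"
    using module_type [OF mod _ km(1) _ subK(1) agree_refl agree_refl] K(2) j by blast+
  moreover have "type k m z' = D" using crossK km by blast
  moreover have "j \<noteq> m" using km(2) j by blast
  ultimately have "type i m z' = D" "type m j z' = D"
    using type_commute [of j m z'] by simp_all
  then show False
    using crossA [of i m z'] crossA [of m j z'] ij km(2,3) assms(3,6) by auto
qed

section \<open>Contracting a module\<close>

text \<open>
  If a change of the variables in \<open>B\<close> does not affect the value of \<open>f\<close>, then it does not affect it after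
  any change of \<open>p\<close> and \<open>q\<close> either, since \<open>B\<close> is a module towards both.
\<close>

lemma module_interact_outside:
  fixes H :: "k4 \<Rightarrow> k4"
  assumes "p \<notin> B" "q \<notin> B" "agree B y y'" "f y = f y'"
    and p: "module_at B p y" and q: "\<And>a. module_at B q (y(p := a))"
  shows "interact (\<lambda>z. H (f z)) p q y = interact (\<lambda>z. H (f z)) p q y'"
proof -
  have "f (y(p := a, q := b)) = f (y'(p := a, q := b))" for a b
  proof -
    have eq: "y' p = y p" "y' q = y q" using assms(1-3) by (auto simp: agree_def)
    have "f (y(p := y p)) = f (y'(p := y p))"
      using assms(4) eq by (metis fun_upd_triv)
    then have "f (y(p := a)) = f (y'(p := a))"
      by (rule module_atD [OF p agree_refl assms(3)])
    moreover have "(y(p := a))(q := (y(p := a)) q) = y(p := a)" "(y'(p := a))(q := (y(p := a)) q) = y'(p := a)"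
      using eq by (auto simp: fun_eq_iff)
    ultimately have "f ((y(p := a))(q := (y(p := a)) q)) = f ((y'(p := a))(q := (y(p := a)) q))"
      by simp
    then show ?thesis
      by (rule module_atD [OF q agree_refl, rotated]) (use assms(3) in \<open>auto simp: agree_def\<close>)
  qed
  then show ?thesis by (simp add: interact_def)
qed

text \<open>
  A module in \<open>N\<close> can be contracted to one of its variables \<open>i\<close>: an interaction of a variable of \<open>B\<close> with an
  outer variable also occurs for \<open>i\<close>, and how the value of the module is attained is irrelevant for
  interactions between outer variables.
\<close>

lemma split_lift:
  assumes N: "N \<subseteq> I" "B \<subseteq> N" "i \<in> B"
    and mod: "\<And>k y. k \<in> N - B \<Longrightarrow> agree N x y \<Longrightarrow> module_at B k y"
    and split: "\<not> connected (bitf P) (insert i (N - B)) x"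
  shows "\<not> connected (bitf P) N x"
proof
  assume conn: "connected (bitf P) N x"
  define V where "V = insert i (N - B)"
  obtain A where A: "A \<subseteq> V" "A \<noteq> {}" "A \<noteq> V" "decoupled (bitf P) A (V - A) x"
    using split unfolding V_def by (rule not_connectedE)
  define A' where "A' = (if i \<in> A then A \<union> B else A)"
  have VA: "A \<union> (V - A) = V" using A(1) by auto
  have cross: "\<not> interact (bitf P) p q y" if "p \<in> A" "q \<in> V - A" "agree V x y" for p q y
    using A(4) that unfolding decoupled_def VA by blast
  have BI: "B \<subseteq> I" using N by auto
  have A'sub: "A' \<subseteq> N" "A' \<noteq> {}" using A(1,2) N by (auto simp: A'_def V_def)
  have A'N: "A' \<noteq> N" using A(1,3) N by (auto simp: A'_def V_def split: if_splits)
  have toV: "agree V x (patch B x y)" if "agree N x y" for y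
    using that by (auto simp: agree_def patch_def V_def)
  have module: "interact (bitf P) i q (patch B x y)"
    if "p \<in> B" "q \<in> N - B" "agree N x y" "interact (bitf P) p q y" for p q y
    using module_interact [OF mod [OF that(2,3)] that(1) N(3) _ BI agree_refl _ that(4)] that(2)
    by (auto simp: agree_def patch_def)
  have "decoupled (bitf P) A' (N - A') x"
    unfolding decoupled_def
  proof (intro ballI allI impI)
    fix p q y assume p: "p \<in> A'" and q: "q \<in> N - A'" and "agree (A' \<union> (N - A')) x y"
    then have y: "agree N x y" using A'sub(1) by (simp add: Un_absorb1)
    show "\<not> interact (bitf P) p q y"
    proof
      assume int: "interact (bitf P) p q y"
      have pq: "p \<noteq> q" using p q by auto
      consider "p \<in> B" | "p \<notin> B" "q \<in> B" | "p \<notin> B" "q \<notin> B" by blast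
      then show False
      proof cases
        case 1
        then have i: "i \<in> A" using p A(1) by (auto simp: A'_def V_def split: if_splits)
        then have "q \<in> N - B" "q \<in> V - A" using q by (auto simp: A'_def V_def)
        then show False using module [OF 1 _ y int] cross [OF i _ toV [OF y]] by blast
      next
        case 2
        then have i: "i \<notin> A" using q by (auto simp: A'_def)
        then have "p \<in> N - B" "p \<in> A" "i \<in> V - A" using 2 p A'sub(1) by (auto simp: A'_def V_def)
        moreover have "interact (bitf P) q p y" using int interact_commute [OF pq] by blast
        ultimately show False
          using module [OF 2(2) _ y, of p] cross [OF _ _ toV [OF y], of p i] interact_commute [of p i "bitf P"] N(3) 2(1)
          by blast
      next
        case 3
        then have pA: "p \<in> A" "q \<in> V - A" "p \<in> N - B" "q \<in> N - B"
          using p q A'sub(1) by (auto simp: A'_def V_def split: if_splits)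
        obtain v where v: "f ((patch B x y)(i := v)) = f y"
          using surj_upd [of i] N by blast
        define y' where "y' = (patch B x y)(i := v)"
        have "agree B y y'" using N(3) by (auto simp: y'_def agree_def patch_def)
        then have "interact (bitf P) p q y'"
          using module_interact_outside [of p B q y y' "pr P"] v int 3 mod [OF pA(3) y] mod [OF pA(4)] y pA(3)
          by (simp add: y'_def)
        moreover have "agree V x y'" using toV [OF y] by (simp add: y'_def V_def)
        ultimately show False using cross pA by blast
      qed
    qed
  qed
  then show False using connectedD [OF conn A'sub] A'N by blast
qed

end

section \<open>A minimal counterexample\<close>

text \<open>
  A smallest set of at least two variables on which no \<open>bitf P\<close> splits. It has at least four elements,
  since the types of binary and ternary retracts settle the case of two or three variables.
\<close>

locale counterexample = quasigroup4 +
  fixes N :: "'a set" and x :: "'a \<Rightarrow> k4"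
  assumes N_I: "N \<subseteq> I"
    and card_N: "4 \<le> card N"
    and connected_N: "P \<noteq> 0 \<Longrightarrow> connected (bitf P) N x"
    and smaller: "V \<subseteq> I \<Longrightarrow> 2 \<le> card V \<Longrightarrow> card V < card N \<Longrightarrow> \<exists>P. P \<noteq> 0 \<and> \<not> connected (bitf P) V y"
begin

lemma finite_N: "finite N"
  using N_I by (rule finite_subI)

lemma finite_subN: "U \<subseteq> N \<Longrightarrow> finite U"
  using finite_N finite_subset by blast

lemma connected_N': "P \<noteq> 0 \<Longrightarrow> agree N x y \<Longrightarrow> connected (bitf P) N y"
  using connected_N connected_cong by blast

lemma connected_f_N: "agree N x y \<Longrightarrow> connected f N y"
  using connected_bit_imp_f [OF connected_N' N_I, of K1 y] by (simp add: zero_k4_def)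

text \<open>
  A variable whose types towards all others are 0 or \<open>P\<close> would split off for \<open>bitf P\<close>.
\<close>

lemma not_isolated:
  assumes "n \<in> N" "P \<noteq> 0"
    and "\<And>k y. k \<in> N \<Longrightarrow> k \<noteq> n \<Longrightarrow> agree N x y \<Longrightarrow> type n k y = 0 \<or> type n k y = P"
  shows False
proof -
  have sub: "{n} \<subseteq> I" "N - {n} \<subseteq> I" "{n} \<inter> (N - {n}) = {}" "{n} \<union> (N - {n}) = N"
    using assms(1) N_I by auto
  have "decoupled (bitf P) {n} (N - {n}) x"
    unfolding decoupled_bit_iff [OF sub(1-3) assms(2)] sub(4) using assms(3) by auto
  then have "{n} = N"
    using connectedD [OF connected_N [OF assms(2)], of "{n}"] assms(1) by auto
  moreover have "card {n} = 1" by simp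
  ultimately show False using card_N by simp
qed

text \<open>
  A set of variables \<open>B\<close>, connected for \<open>bitf D\<close>, that interacts uniformly and with type \<open>D\<close> with a
  further variable \<open>l\<close>. The proof examines pairs with \<open>B\<close> as large as possible.
\<close>

definition pair :: "'a set \<Rightarrow> 'a \<Rightarrow> ('a \<Rightarrow> k4) \<Rightarrow> k4 \<Rightarrow> bool" where
  "pair B l y D \<longleftrightarrow> B \<subseteq> N \<and> B \<noteq> {} \<and> l \<in> N \<and> l \<notin> B \<and> agree N x y \<and> D \<noteq> 0 \<and>
     connected (bitf D) B y \<and> (\<forall>b\<in>B. \<forall>z. agree (insert l B) y z \<longrightarrow> type b l z = D)"

text \<open>
  One interaction of \<open>l\<close> with \<open>B\<close> suffices, because \<open>B\<close> is a module towards \<open>l\<close>.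
\<close>

lemma pairI:
  assumes "B \<subseteq> N" "l \<in> N" "l \<notin> B" "agree N x y" "D \<noteq> 0" "connected (bitf D) B y"
    and dec: "decoupled (bitf D) B {l} y"
    and "b \<in> B" "agree (insert l B) y z" "type b l z \<noteq> 0"
  shows "pair B l y D"
proof -
  have sub: "B \<subseteq> I" "{l} \<subseteq> I" "B \<inter> {l} = {}" "B \<union> {l} = insert l B"
    using assms(1-3) N_I by auto
  have mod: "module_at B l y"
    by (rule connected_module [OF sub(1) _ assms(3,5,6) dec]) (use sub in auto)
  have D: "type b l z = D"
    using dec assms(8-10) unfolding decoupled_bit_iff [OF sub(1-3) assms(5)] sub(4) by blast
  have "type b' l z' = D" if "b' \<in> B" "agree (insert l B) y z'" for b' z'
    using module_type [OF mod that(1) assms(8,3) sub(1) that(2) assms(9)] D by simp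
  then show ?thesis using assms unfolding pair_def by blast
qed

lemma pair_decoupled:
  assumes "pair B l y D"
  shows "decoupled (bitf D) B {l} y"
proof -
  have sub: "B \<subseteq> I" "{l} \<subseteq> I" "B \<inter> {l} = {}" "B \<union> {l} = insert l B" "D \<noteq> 0"
    using assms N_I by (auto simp: pair_def)
  show ?thesis
    using assms unfolding decoupled_bit_iff [OF sub(1-3,5)] sub(4) pair_def by blast
qed

lemma pair_card:
  assumes "pair B l y D"
  shows "card B + 2 \<le> card N"
proof -
  have p: "B \<subseteq> N" "B \<noteq> {}" "l \<in> N" "l \<notin> B" "agree N x y" "D \<noteq> 0"
    using assms by (auto simp: pair_def)
  have "insert l B \<noteq> N"
  proof
    assume eq: "insert l B = N"
    then have "N - B = {l}" using p by auto
    then have "B = N"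
      using connectedD [OF connected_N' [OF p(6,5)] p(1,2)] pair_decoupled [OF assms] by simp
    then show False using p by auto
  qed
  then have "card (insert l B) < card N"
    using p finite_N by (intro psubset_card_mono) auto
  moreover have "card (insert l B) = Suc (card B)"
    using p finite_subN by (simp add: finite_subset)
  ultimately show ?thesis by simp
qed

end

locale maximal_pair = counterexample +
  fixes \<beta> :: nat
  assumes pair_max: "pair B l y D \<Longrightarrow> card B \<le> \<beta>"
begin

text \<open>
  The set \<open>V\<close> of variables can be enlarged within \<open>N\<close>, one variable at a time, without losing that
  \<open>bitf D\<close> splits and \<open>f\<close> does not: a splitting by another \<open>bitf Z\<close> would leave all of \<open>V\<close> on one side and
  give a pair with first component \<open>V\<close>.
\<close>

lemma extend_colour:
  assumes "V \<subseteq> N" "agree N x y" "connected f V y" "D \<noteq> 0" "\<not> connected (bitf D) V y"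
    and "\<beta> < card V" "card V < card N" "V \<noteq> {}"
  shows "\<exists>n y'. n \<in> N - V \<and> agree (N - V) y y' \<and> shifted f V y y' \<and>
    connected f (N - {n}) y' \<and> \<not> connected (bitf D) (N - {n}) y'"
  using assms
proof (induction "card N - card V" arbitrary: V y rule: less_induct)
  case less
  note prems = less.prems
  have finV: "finite V" using prems(1) by (rule finite_subN)
  show ?case
  proof (cases "card V + 1 = card N")
    case True
    then have "card (N - V) = 1"
      using prems(1) finV by (simp add: card_Diff_subset)
    then obtain n where "N - V = {n}" by (auto simp: card_1_singleton_iff)
    then have "n \<in> N - V" "N - {n} = V" using prems(1) by auto
    then show ?thesis using prems(3,5) by (intro exI [of _ n] exI [of _ y]) simp
  next
    case False
    have "V \<noteq> N" using prems(7) by auto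
    then obtain k y' where k: "k \<in> N - V" "agree (N - V) y y'" "shifted f V y y'"
        "connected f (insert k V) y'"
      using connected_extend [OF finite_N connected_f_N [OF prems(2)] prems(1) _ prems(8) agree_refl prems(3)]
      by blast
    define V' where "V' = insert k V"
    have y': "agree N x y'" using prems(2) k(2) by (meson Diff_subset agree_mono agree_trans)
    have V': "V' \<subseteq> N" "card V' = Suc (card V)" "V' \<noteq> {}" using k(1) prems(1) finV by (auto simp: V'_def)
    have less_N: "card V' < card N" using False V'(2) prems(7) by simp
    have "card V' \<ge> 2" using V'(2) prems(8) finV by (simp add: card_gt_0_iff Suc_le_eq)
    then obtain Z where Z: "Z \<noteq> 0" "\<not> connected (bitf Z) V' y'"
      using smaller [of V' y'] V'(1) N_I less_N by auto
    have "Z = D"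
    proof (rule ccontr)
      assume "Z \<noteq> D"
      have VI: "V \<subseteq> I" using prems(1) N_I by auto
      have "connected (bitf Z) V y"
        using split_unique [OF VI prems(3-5) Z(1) \<open>Z \<noteq> D\<close>] .
      moreover have "shifted (bitf Z) V y y'"
        using k(3) unfolding shifted_def by (metis pr_add)
      ultimately have conn: "connected (bitf Z) V y'" using connected_shifted by blast
      then have dec: "decoupled (bitf Z) V {k} y'"
        using connected_insert [of "bitf Z" V y' k] Z(2) k(1) prems(8) unfolding V'_def by blast
      have "\<not> decoupled f V {k} y'"
      proof
        assume d: "decoupled f V {k} y'"
        have "insert k V - V = {k}" using k(1) by auto
        then show False using connectedD [OF k(4), of V] d prems(8) k(1) by auto
      qed
      then obtain b z where b: "b \<in> V" "agree (V \<union> {k}) y' z" "type b k z \<noteq> 0"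
        using decoupled_f_iff [of V "{k}" y'] VI k(1) N_I by blast
      have "pair V k y' Z"
        by (rule pairI [OF prems(1) _ _ y' Z(1) conn dec b(1) _ b(3)]) (use k(1) b(2) in auto)
      then show False using pair_max prems(6) by fastforce
    qed
    then have "\<exists>n y''. n \<in> N - V' \<and> agree (N - V') y' y'' \<and> shifted f V' y' y'' \<and>
        connected f (N - {n}) y'' \<and> \<not> connected (bitf D) (N - {n}) y''"
      using k(4) Z(2) V' less_N prems(4,6) y' unfolding V'_def [symmetric]
      by (intro less.hyps) auto
    then obtain n y'' where n: "n \<in> N - V'" "agree (N - V') y' y''" "shifted f V' y' y''"
        "connected f (N - {n}) y''" "\<not> connected (bitf D) (N - {n}) y''" by blast
    have "shifted f V y' y''"
      by (rule shifted_mono [OF n(3)]) (use n(2) in \<open>auto simp: V'_def agree_def\<close>)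
    then have "shifted f V y y''" using k(3) shifted_trans by blast
    moreover have "agree (N - V) y y''"
      using k(2) n(2) by (auto simp: V'_def agree_def)
    moreover have "n \<in> N - V" using n(1) by (auto simp: V'_def)
    ultimately show ?thesis using n(4,5) by blast
  qed
qed

end

section \<open>Modules of one variable do not suffice\<close>

text \<open>
  If \<open>i\<close> and \<open>l\<close> do not interact, changing \<open>l\<close> adds to \<open>h\<close> a term that does not depend on \<open>i\<close>.
\<close>

lemma interact_third:
  assumes ne: "i \<noteq> k" "i \<noteq> l" "k \<noteq> l" and no: "\<And>b. \<not> interact h i l (y(k := b))"
  shows "interact h i k (y(l := c)) = interact h i k y"
proof -
  define \<phi> where "\<phi> b = h (y(k := b, l := c)) - h (y(k := b))" for b
  have eq: "h ((y(l := c))(i := a, k := b)) = h (y(i := a, k := b)) + \<phi> b" for a b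
  proof -
    have "h ((y(k := b))(i := a, l := c)) + h ((y(k := b))(i := y i, l := y l)) =
        h ((y(k := b))(i := a, l := y l)) + h ((y(k := b))(i := y i, l := c))"
      using no [of b] unfolding interact_def by blast
    moreover have "(y(k := b))(i := a, l := c) = (y(l := c))(i := a, k := b)"
      "(y(k := b))(i := y i, l := y l) = y(k := b)"
      "(y(k := b))(i := a, l := y l) = y(i := a, k := b)"
      "(y(k := b))(i := y i, l := c) = y(k := b, l := c)"
      using ne by (auto simp: fun_eq_iff)
    ultimately show ?thesis by (simp add: \<phi>_def algebra_simps)
  qed
  show ?thesis
    unfolding interact_def eq by (simp add: algebra_simps)
qed

context quasigroup4
begin

text \<open>
  Moving \<open>k\<close> within its class adds the same element, 0 or \<open>D\<close>, to all values of \<open>f\<close> on the retract to \<open>W\<close>.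
\<close>

lemma bit_shift:
  assumes "W \<subseteq> I" "k \<in> I" "k \<notin> W" "D \<noteq> 0"
    and dec: "decoupled (bitf D) W {k} y" and eq: "bitf D (y(k := v)) = bitf D y"
  shows "shifted f W y (y(k := v))"
proof (cases "v = y k")
  case True
  then show ?thesis by simp
next
  case False
  have "f (patch W u (y(k := v))) = f (patch W u y) + D" for u
  proof -
    have "bitf D (patch W y y) + bitf D (patch W u (y(k := v))) =
        bitf D (patch W y (y(k := v))) + bitf D (patch W u y)"
      by (rule decoupled_sum [OF finite_subI [OF assms(1)] _ _ dec]) (use assms(3) in auto)
    moreover have "patch W y (y(k := v)) = y(k := v)" "patch W y y = y"
      using assms(3) by (auto simp: patch_def fun_eq_iff)
    ultimately have "bitf D (patch W u (y(k := v))) = bitf D (patch W u y)"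
      using eq by simp
    moreover have upd: "patch W u (y(k := v)) = (patch W u y)(k := v)"
      using assms(3) by (simp add: patch_upd')
    ultimately have "bitf D ((patch W u y)(k := v)) = bitf D (patch W u y)" by simp
    then have "f ((patch W u y)(k := v)) = f (patch W u y) + D"
      by (rule bit_eq_move [OF assms(4,2)]) (use False assms(3) in \<open>simp add: patch_def\<close>)
    then show ?thesis by (simp add: upd)
  qed
  then show ?thesis unfolding shifted_def by blast
qed

lemma type_same_class:
  assumes "i \<in> I" "l \<in> I" "k \<in> I" "i \<noteq> l" "i \<noteq> k" "l \<noteq> k" "D \<noteq> 0"
    and "decoupled (bitf D) {i, l} {k} y" "bitf D (y(k := v)) = bitf D y"
  shows "type i l (y(k := v)) = type i l y"
proof -
  have sh: "shifted f {i, l} y (y(k := v))"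
    by (rule bit_shift [OF _ assms(3) _ assms(7-9)]) (use assms in auto)
  have "type i l (patch {i, l} y y) = type i l (patch {i, l} y (y(k := v)))"
    by (rule type_shifted [OF sh]) auto
  moreover have "patch {i, l} y (y(k := v)) = y(k := v)"
    using assms by (auto simp: patch_def fun_eq_iff)
  ultimately show ?thesis by simp
qed

end

context counterexample
begin

text \<open>
  Some type differs from 0 and \<open>P\<close>, as otherwise every variable would be isolated for \<open>bitf P\<close>.
\<close>

lemma other_colour:
  assumes "P \<noteq> 0"
  obtains i j y where "i \<in> N" "j \<in> N" "i \<noteq> j" "agree N x y" "type i j y \<noteq> 0" "type i j y \<noteq> P"
proof -
  have "N \<noteq> {}" using card_N by auto
  then obtain n where "n \<in> N" by blast
  then show thesis using not_isolated [OF _ assms, of n] that by metis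
qed

lemma nested_pair:
  assumes "i \<in> N" "j \<in> N" "k \<in> N" "i \<noteq> j" "i \<noteq> k" "j \<noteq> k" "agree N x y" "nested3 i j k y"
  shows "\<exists>D. pair {i, j} k y D"
proof -
  obtain D where D: "D \<noteq> 0" "\<And>z. agree {i, j, k} y z \<Longrightarrow>
      type i k z = D \<and> type j k z = D \<and> type i j z \<noteq> 0 \<and> type i j z \<noteq> D"
    using assms(8) unfolding nested3_def by blast
  have ij: "i \<in> I" "j \<in> I" using assms(1,2) N_I by auto
  have "interact (bitf D) i j y"
    using type_interact(2) [OF ij assms(4) D(1), of y] D(2) [OF agree_refl] by blast
  then have "connected (bitf D) {i, j} y" by (rule pair_connected [OF assms(4)])
  moreover have "insert k {i, j} = {i, j, k}" by auto
  ultimately have "pair {i, j} k y D"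
    unfolding pair_def using assms D by simp
  then show ?thesis by blast
qed

end

context maximal_pair
begin

text \<open>
  As \<open>f\<close> does not split on \<open>V\<close>, a component of \<open>bitf D\<close> interacts with a variable of another component,
  necessarily with type \<open>D\<close>, and so forms a pair with it.
\<close>

lemma component_small:
  assumes V: "V \<subseteq> N" "agree N x y" "connected f V y" "D \<noteq> 0" "\<not> connected (bitf D) V y"
    and K: "K \<subseteq> V" "K \<noteq> {}" "decoupled (bitf D) K (V - K) y" "connected (bitf D) K y"
  shows "card K \<le> \<beta>"
proof -
  have sub: "K \<subseteq> I" "V - K \<subseteq> I" "K \<inter> (V - K) = {}" "K \<union> (V - K) = V" "V \<subseteq> I"
    using K(1) V(1) N_I by auto
  have "K \<noteq> V" using K(4) V(5) by auto
  then have "\<not> decoupled f K (V - K) y" using connectedD [OF V(3) K(1,2)] by blast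
  then obtain k m z where km: "k \<in> K" "m \<in> V - K" "agree V y z" "type k m z \<noteq> 0"
    unfolding decoupled_f_iff [OF sub(1-3)] sub(4) by blast
  have "pair K m z D"
  proof (rule pairI [OF _ _ _ _ V(4) _ _ km(1) agree_refl km(4)])
    show "agree N x z" using V(1,2) km(3) by (meson agree_mono agree_trans)
    show "connected (bitf D) K z"
      by (rule connected_split_off [OF finite_subI [OF sub(5)] K(1,3,4) km(3)])
    show "decoupled (bitf D) K {m} z"
      by (rule decoupled_mono [OF K(3)]) (use km sub(4) in auto)
  qed (use K(1) V(1) km(2) in auto)
  then show ?thesis by (rule pair_max)
qed

lemma coloured_edge_extends:
  assumes "i \<in> N" "j \<in> N" "i \<noteq> j" "agree N x y" "type i j y \<noteq> 0" and small: "\<beta> < 2"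
  obtains n y' where "n \<in> N" "agree N x y'" "connected f (N - {n}) y'"
    "\<not> connected (bitf (type i j y)) (N - {n}) y'"
proof -
  define D where "D = type i j y"
  have ij: "i \<in> I" "j \<in> I" using assms(1,2) N_I by auto
  have conn: "connected f {i, j} y"
    by (rule pair_connected [OF assms(3)]) (use type_interact(1) [OF ij assms(3)] assms(5) in blast)
  have sets: "{i} \<subseteq> I" "{j} \<subseteq> I" "{i} \<inter> {j} = {}" "{i} \<union> {j} = {i, j}" using ij assms(3) by auto
  have D0: "D \<noteq> 0" using assms(5) by (simp add: D_def)
  have "decoupled (bitf D) {i} {j} y"
    unfolding decoupled_bit_iff [OF sets(1-3) D0] sets(4)
    using type_cong [OF assms(3), of y] by (auto simp: D_def)
  moreover have "{i, j} - {i} = {j}" using assms(3) by auto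
  ultimately have "\<not> connected (bitf D) {i, j} y"
    using connectedD [of "bitf D" "{i, j}" y "{i}"] assms(3) by auto
  moreover have "{i, j} \<subseteq> N" "\<beta> < card {i, j}" "card {i, j} < card N" "{i, j} \<noteq> {}"
    using assms(1-3) small card_N by auto
  ultimately obtain n y' where n: "n \<in> N - {i, j}" "agree (N - {i, j}) y y'"
      "connected f (N - {n}) y'" "\<not> connected (bitf D) (N - {n}) y'"
    using extend_colour [of "{i, j}" y D, OF _ assms(4) conn D0] by blast
  have "agree N x y'"
    using assms(4) n(2) by (meson Diff_subset agree_mono agree_trans)
  then show thesis using that n D_def by blast
qed

text \<open>
  For \<open>\<beta> < 2\<close> all components of \<open>bitf D\<close> are single variables.
\<close>

lemma one_coloured:
  assumes small: "\<beta> < 2" and V: "V \<subseteq> N" "agree N x y" "connected f V y" "D \<noteq> 0" "\<not> connected (bitf D) V y"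
    and pq: "p \<in> V" "q \<in> V" "p \<noteq> q" "agree V y z"
  shows "type p q z = 0 \<or> type p q z = D"
proof -
  obtain K where K: "K \<subseteq> V" "p \<in> K" "decoupled (bitf D) K (V - K) y" "connected (bitf D) K y"
    using connected_component [OF finite_subN [OF V(1)] pq(1)] by blast
  have "K \<noteq> {}" using K(2) by blast
  from component_small [OF V K(1) this K(3,4)] small have "card K \<le> Suc 0" by simp
  moreover have "finite K" using K(1) V(1) by (intro finite_subN) blast
  ultimately have "K = {p}"
    using K(2) by (auto simp: card_le_Suc0_iff_eq)
  moreover have "{p} \<subseteq> I" "V - {p} \<subseteq> I" "{p} \<inter> (V - {p}) = {}" "{p} \<union> (V - {p}) = V"
    using V(1) N_I pq(1) by auto
  ultimately show ?thesis
    using K(3) decoupled_bit_iff [of "{p}" "V - {p}" D y] V(4) pq by auto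
qed

text \<open>
  There are types \<open>D \<noteq> P\<close>, and each extends to a splitting of some \<open>N - {n}\<close>. If both extensions leave out
  the same variable, the first one is replaced by one that leaves out another variable \<open>k\<close> for which
  the rest of \<open>N - {n}\<close> is still connected and contains a pair of type \<open>D\<close>.
\<close>

lemma two_colours:
  assumes small: "\<beta> < 2"
  obtains n l y1 y2 D P where "n \<in> N" "l \<in> N" "n \<noteq> l" "D \<noteq> 0" "P \<noteq> 0" "D \<noteq> P"
    "agree N x y1" "connected f (N - {n}) y1" "\<not> connected (bitf D) (N - {n}) y1"
    "agree N x y2" "connected f (N - {l}) y2" "\<not> connected (bitf P) (N - {l}) y2"
proof -
  obtain i j y where ij: "i \<in> N" "j \<in> N" "i \<noteq> j" "agree N x y" "type i j y \<noteq> 0"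
    by (rule other_colour [of K1]) (auto simp: zero_k4_def)
  define D where "D = type i j y"
  obtain n y1 where n: "n \<in> N" "agree N x y1" "connected f (N - {n}) y1" "\<not> connected (bitf D) (N - {n}) y1"
    using coloured_edge_extends [OF ij small] D_def by blast
  have D: "D \<noteq> 0" using ij(5) D_def by simp
  obtain i' j' y' where ij': "i' \<in> N" "j' \<in> N" "i' \<noteq> j'" "agree N x y'" "type i' j' y' \<noteq> 0" "type i' j' y' \<noteq> D"
    by (rule other_colour [OF D])
  define P where "P = type i' j' y'"
  obtain l y2 where l: "l \<in> N" "agree N x y2" "connected f (N - {l}) y2" "\<not> connected (bitf P) (N - {l}) y2"
    using coloured_edge_extends [OF ij'(1-5) small] P_def by blast
  have P: "P \<noteq> 0" "D \<noteq> P" using ij' P_def by auto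
  show thesis
  proof (cases "n = l")
    case False
    then show thesis using that n l D P by blast
  next
    case True
    have card3: "card (N - {n}) \<ge> 3" using card_N n(1) finite_N by simp
    then have "N - {n} \<noteq> {}" by (intro notI) simp
    then obtain w where w: "w \<in> N - {n}" by blast
    have "N - {n} \<noteq> {w}" using card3 by (intro notI) simp
    then obtain k y3 where k: "k \<in> N - {n} - {w}" "agree (N - {n}) y1 y3" "connected f (N - {n} - {k}) y3"
      using connected_remove [OF _ n(3) w] finite_N by blast
    define W where "W = N - {n} - {k}"
    have W: "W \<subseteq> N" "n \<notin> W" "insert n W = N - {k}" "w \<in> W" using n(1) k(1) w by (auto simp: W_def)
    have y3: "agree N x y3" using n(2) k(2) by (meson Diff_subset agree_mono agree_trans)
    have "card W \<ge> 2" using card3 k(1) finite_N by (simp add: W_def)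
    then have "W \<noteq> {w}" by (intro notI) simp
    then have "\<not> decoupled f {w} (W - {w}) y3"
      using connectedD [OF k(3) [folded W_def], of "{w}"] W(4) by blast
    moreover have subs: "{w} \<subseteq> I" "W - {w} \<subseteq> I" "{w} \<inter> (W - {w}) = {}" "{w} \<union> (W - {w}) = W"
      using W N_I by auto
    ultimately obtain q z where q: "q \<in> W - {w}" "agree W y3 z" "type w q z \<noteq> 0"
      unfolding decoupled_f_iff [OF subs(1-3)] subs(4) by blast
    have "agree (N - {n}) y1 z"
      using k(2) q(2) by (auto simp: W_def agree_def)
    then have qD: "type w q z = D"
      using one_coloured [OF small _ n(2,3) D n(4), of w q z] q W k(1) w by (auto simp: W_def)
    have conn: "connected f (N - {k}) y3"
    proof (rule ccontr)
      assume "\<not> ?thesis"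
      then have dec: "decoupled f W {n} y3"
        using connected_insert [OF k(3) [folded W_def] W(2)] W(3,4) by auto
      have "shifted f W y3 (y3(n := y2 n))"
        by (rule decoupled_shifted [OF finite_subN [OF W(1)] _ _ dec]) (use W in auto)
      then have "type w q (patch W z y3) = type w q (patch W z (y3(n := y2 n)))"
        by (rule type_shifted) (use W q in auto)
      moreover have "patch W z y3 = z" by (rule patch_eq [OF q(2)])
      moreover have "agree (N - {l}) y2 (patch W z (y3(n := y2 n)))"
        using l(2) y3 True by (auto simp: agree_def patch_def W_def)
      then have "type w q (patch W z (y3(n := y2 n))) = 0 \<or> type w q (patch W z (y3(n := y2 n))) = P"
        using one_coloured [OF small _ l(2,3) P(1) l(4), of w q] q W True by (auto simp: W_def)
      ultimately show False using qD D P by simp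
    qed
    have kN: "k \<in> N" using k(1) by auto
    have "card (N - {k}) < card N" "2 \<le> card (N - {k})" using kN card_N finite_N by simp_all
    moreover have "N - {k} \<subseteq> I" using N_I by blast
    ultimately obtain Z where Z: "Z \<noteq> 0" "\<not> connected (bitf Z) (N - {k}) y3"
      using smaller [of "N - {k}" y3] by blast
    have "type w q z = 0 \<or> type w q z = Z"
      by (rule one_coloured [OF small _ y3 conn Z]) (use q W in \<open>auto simp: W_def agree_def\<close>)
    then have "Z = D" using qD D by auto
    then show thesis using that [of k l D P y3 y2] kN l D P y3 conn Z True k(1) by auto
  qed
qed

text \<open>
  Otherwise the types among the variables other than \<open>n\<close> are in \<open>{0, D}\<close> when \<open>n\<close> has the value \<open>a\<close>, and
  those among the variables other than \<open>l\<close> are in \<open>{0, P}\<close> when \<open>l\<close> has the value \<open>c\<close>. With both values, the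
  remaining variables do not interact at all. A further variable \<open>i\<close> then interacts
  with \<open>l\<close> at some point \<open>y\<close> where \<open>n\<close> has the value \<open>a\<close>, and with \<open>n\<close> at some point \<open>z\<close> where \<open>l\<close> has the value \<open>c\<close>.
  The two points are brought together, one variable \<open>k\<close> at a time: by additivity \<open>k\<close> can be set to one
  value at both points that preserves the class of \<open>f\<close> for \<open>D\<close> at \<open>y\<close> and the class for \<open>P\<close> at \<open>z\<close>, so that
  both types survive. When only \<open>i\<close>, \<open>l\<close> and \<open>n\<close> are left, the types \<open>D\<close> and \<open>P\<close> in the same ternary
  retract make it nested, which gives a pair with two variables in the first component.
\<close>

lemma beta_ge_2: "2 \<le> \<beta>"
proof (rule ccontr)
  assume "\<not> ?thesis"
  then have small: "\<beta> < 2" by simp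
  obtain n l y1 y2 D P where nl: "n \<in> N" "l \<in> N" "n \<noteq> l" and DP: "D \<noteq> 0" "P \<noteq> 0" "D \<noteq> P"
    and 1: "agree N x y1" "connected f (N - {n}) y1" "\<not> connected (bitf D) (N - {n}) y1"
    and 2: "agree N x y2" "connected f (N - {l}) y2" "\<not> connected (bitf P) (N - {l}) y2"
    by (rule two_colours [OF small])
  define a c where "a = y1 n" and "c = y2 l"
  have tD: "type p q z = 0 \<or> type p q z = D" if "p \<in> N - {n}" "q \<in> N - {n}" "p \<noteq> q" "agree N x z" "z n = a" for p q z
    by (rule one_coloured [OF small _ 1(1,2) DP(1) 1(3) that(1-3)]) (use that(4,5) 1(1) in \<open>auto simp: agree_def a_def\<close>)
  have tP: "type p q z = 0 \<or> type p q z = P" if "p \<in> N - {l}" "q \<in> N - {l}" "p \<noteq> q" "agree N x z" "z l = c" for p q z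
    by (rule one_coloured [OF small _ 2(1,2) DP(2) 2(3) that(1-3)]) (use that(4,5) 2(1) in \<open>auto simp: agree_def c_def\<close>)
  define R where "R = N - {n, l}"
  have t0: "type p q z = 0" if "p \<in> R" "q \<in> R" "p \<noteq> q" "agree N x z" "z n = a" "z l = c" for p q z
    using tD [of p q z] tP [of p q z] that DP by (auto simp: R_def)
  have "card R \<ge> 2" unfolding R_def using card_N nl finite_N by (simp add: card_Diff_subset)
  then have "R \<noteq> {}" by (intro notI) simp
  then obtain i where i: "i \<in> R" by blast
  have inI: "p \<in> I" if "p \<in> N" for p using that N_I by auto
  have i': "i \<in> N" "i \<noteq> n" "i \<noteq> l" using i by (auto simp: R_def)
  \<comment> \<open>The variable \<open>i\<close> interacts with \<open>l\<close> when \<open>n\<close> has the value \<open>a\<close>, and with \<open>n\<close> when \<open>l\<close> has the value \<open>c\<close>.\<close>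
  have edge: "\<exists>y. agree N x y \<and> y p = d \<and> type i q y \<noteq> 0"
    if p: "p \<in> N" "q \<in> N" "p \<noteq> q" "i \<noteq> p" "i \<noteq> q" and y0: "agree N x y0" "connected f (N - {p}) y0" "y0 p = d"
      and zero: "\<And>k z. k \<in> N \<Longrightarrow> k \<noteq> i \<Longrightarrow> k \<noteq> p \<Longrightarrow> k \<noteq> q \<Longrightarrow> agree N x z \<Longrightarrow> z p = d \<Longrightarrow> z q = e \<Longrightarrow> type i k z = 0"
    for p q y0 d e
  proof (rule ccontr)
    assume no: "\<not> ?thesis"
    have sub: "{i} \<subseteq> I" "N - {p} - {i} \<subseteq> I" "{i} \<inter> (N - {p} - {i}) = {}" "{i} \<union> (N - {p} - {i}) = N - {p}"
      using i'(1) p N_I by auto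
    have q: "q \<in> N - {p}" and ip: "{i} \<subseteq> N - {p}" using p i'(1) by auto
    have "\<not> decoupled f {i} (N - {p} - {i}) y0"
    proof
      assume "decoupled f {i} (N - {p} - {i}) y0"
      from connectedD [OF y0(2) ip _ this] have "{i} = N - {p}" by simp
      with q have "q \<in> {i}" by simp
      then show False using p(5) by simp
    qed
    then obtain k y where k: "k \<in> N - {p} - {i}" "agree (N - {p}) y0 y" "type i k y \<noteq> 0"
      unfolding decoupled_f_iff [OF sub(1-3)] sub(4) by blast
    have y: "agree N x y" using agree_trans [OF y0(1) agree_mono [OF k(2) Diff_subset]] .
    have yp: "y p = d" using agreeD [OF k(2), of p] y0(3) by simp
    have kq: "k \<noteq> q" using no y yp k(3) by blast
    have kN: "k \<in> N" "k \<noteq> p" "k \<noteq> i" using k(1) by blast+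
    have "interact f i k (y(q := e)) = interact f i k y"
    proof (rule interact_third)
      fix b
      have "agree N x (y(k := b))" "(y(k := b)) p = d" using y yp kN by simp_all
      then have "type i q (y(k := b)) = 0" using no by blast
      then show "\<not> interact f i q (y(k := b))"
        using type_interact(1) [OF inI [OF i'(1)] inI [OF p(2)] p(5)] by simp
    qed (use kN kq p in simp_all)
    moreover have "type i k (y(q := e)) = 0"
    proof (rule zero [OF kN(1,3,2) kq])
      show "agree N x (y(q := e))" "(y(q := e)) p = d" "(y(q := e)) q = e"
        using y yp p by simp_all
    qed
    ultimately show False
      using k(3) type_interact(1) [OF inI [OF i'(1)] inI [OF kN(1)] kN(3) [symmetric]] by simp
  qed
  have "\<exists>y. agree N x y \<and> y n = a \<and> type i l y \<noteq> 0"
    by (rule edge [where e = c, OF nl(1,2,3) i'(2,3) 1(1,2)]) (simp add: a_def, rule t0, use i in \<open>simp_all add: R_def\<close>)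
  then obtain y where y: "agree N x y" "y n = a" "type i l y \<noteq> 0" by blast
  have "\<exists>z. agree N x z \<and> z l = c \<and> type i n z \<noteq> 0"
    by (rule edge [where e = a, OF nl(2,1) nl(3) [symmetric] i'(3,2) 2(1,2)]) (simp add: c_def, rule t0, use i in \<open>simp_all add: R_def\<close>)
  then obtain z where z: "agree N x z" "z l = c" "type i n z \<noteq> 0" by blast
  have "False" if "agree N x y" "y n = a" "y l = c" "type i l y \<noteq> 0"
    "agree N x z" "z n = a" "z l = c" "type i n z \<noteq> 0" for y z
    using that
  proof (induction "card {k \<in> R - {i}. y k \<noteq> z k}" arbitrary: y z rule: less_induct)
    case less
    note pr = less.prems
    have finR: "finite R" using finite_N by (simp add: R_def)
    have tyD: "type i l y = D" using tD [of i l y] pr i' nl by auto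
    have tzP: "type i n z = P" using tP [of i n z] pr i' nl by auto
    show False
    proof (cases "\<exists>k\<in>R - {i}. y k \<noteq> z k")
      case False
      then have ag: "agree {i, l, n} y z"
        using pr(1,5) unfolding agree_def R_def by (metis DiffI insert_iff empty_iff)
      have "uniform3 i l n y"
      proof (rule ccontr)
        assume "\<not> ?thesis"
        then have "nested3 i l n y \<or> nested3 i n l y \<or> nested3 l n i y"
          using triple_cases [of i l n y] inI i' nl by auto
        then have "\<exists>p q r D'. pair {p, q} r y D' \<and> p \<noteq> q"
          using nested_pair [of i l n y] nested_pair [of i n l y] nested_pair [of l n i y] i' nl pr(1) by metis
        then show False using pair_max small by fastforce
      qed
      then obtain O' where "\<And>z. agree {i, l, n} y z \<Longrightarrow> type i l z = 0 \<or> type i l z = O'"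
          "\<And>z. agree {i, l, n} y z \<Longrightarrow> type i n z = 0 \<or> type i n z = O'"
        by (rule uniform3E) blast
      from this(1) [OF agree_refl] this(2) [OF ag] show False using tyD tzP DP by auto
    next
      case True
      then obtain k where k: "k \<in> R" "k \<noteq> i" "y k \<noteq> z k" by auto
      have k': "k \<in> N" "k \<noteq> n" "k \<noteq> l" using k(1) by (auto simp: R_def)
      have subs: "{k} \<subseteq> I" "R - {k} \<subseteq> I" "{k} \<inter> (R - {k}) = {}" "{k} \<union> (R - {k}) = R"
        using k N_I by (auto simp: R_def)
      have "decoupled f {k} (R - {k}) y"
        unfolding decoupled_f_iff [OF subs(1-3)] subs(4)
      proof (intro ballI allI impI)
        fix p q u assume "p \<in> {k}" "q \<in> R - {k}" "agree R y u"
        then show "type p q u = 0"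
          using k(1) pr(1-3) by (intro t0) (auto simp: agree_def R_def)
      qed
      moreover have "agree (R - {k}) y (z(k := y k))"
        using pr by (auto simp: agree_def R_def)
      ultimately have sum: "f (patch {k} u y) + f (patch {k} u' (z(k := y k))) =
          f (patch {k} u (z(k := y k))) + f (patch {k} u' y)" for u u'
        using decoupled_sum [of "{k}" "R - {k}" f y y] finR by auto
      have pk: "patch {k} (w(k := v)) u = u(k := v)" for w u :: "'a \<Rightarrow> k4" and v
        by (auto simp: patch_def fun_eq_iff)
      have sum': "f (y(k := v)) + f (z(k := y k)) = f (z(k := v)) + f y" for v
        using sum [of "y(k := v)" "y(k := y k)"] unfolding pk by simp
      \<comment> \<open>A value of \<open>k\<close> that preserves the class of \<open>f\<close> for \<open>D\<close> at \<open>y\<close> and the class of \<open>f\<close> for \<open>P\<close> at \<open>z\<close>.\<close>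
      define t where "t = pr P (f (z(k := y k)) + f z)"
      define \<delta> where "\<delta> = (if t = 0 then 0 else D)"
      obtain v where v: "f (y(k := v)) = f y + \<delta>"
        using surj_upd [of k y] inI k'(1) by blast
      have prP: "pr P \<delta> = t"
        using DP pr_range [of P "f (z(k := y k)) + f z"] by (auto simp: \<delta>_def t_def pr_def)
      have eqD: "bitf D (y(k := v)) = bitf D y"
        unfolding v pr_add by (simp add: \<delta>_def)
      have "f (z(k := v)) = \<delta> + f (z(k := y k))"
        using sum' [of v] unfolding v by (metis add.assoc add.commute add_left_cancel)
      then have "pr P (f (z(k := v))) = pr P (f (z(k := y k))) + t"
        by (simp add: pr_add prP add.commute)
      then have eqP: "bitf P (z(k := v)) = bitf P z"
        by (simp add: t_def pr_add)
      have trip: "{i, l} \<subseteq> I" "{k} \<subseteq> I" "{i, l} \<inter> {k} = {}" "{i, n} \<subseteq> I" "{i, n} \<inter> {k} = {}"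
        using inI i' nl k k' by auto
      have "decoupled (bitf D) {i, l} {k} y"
        unfolding decoupled_bit_iff [OF trip(1-3) DP(1)]
      proof (intro ballI allI impI)
        fix p q u assume "p \<in> {i, l}" "q \<in> {k}" "agree ({i, l} \<union> {k}) y u"
        then show "type p q u = 0 \<or> type p q u = D"
          using k k' i' nl pr(1,2) by (intro tD) (auto simp: agree_def)
      qed
      then have ty: "type i l (y(k := v)) = type i l y"
        by (rule type_same_class [rotated 7]) (use inI i' nl k k' DP eqD in auto)
      have "decoupled (bitf P) {i, n} {k} z"
        unfolding decoupled_bit_iff [OF trip(4,2,5) DP(2)]
      proof (intro ballI allI impI)
        fix p q u assume "p \<in> {i, n}" "q \<in> {k}" "agree ({i, n} \<union> {k}) z u"
        then show "type p q u = 0 \<or> type p q u = P"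
          using k k' i' nl pr(5,7) by (intro tP) (auto simp: agree_def)
      qed
      then have tz: "type i n (z(k := v)) = type i n z"
        by (rule type_same_class [rotated 7]) (use inI i' nl k k' DP eqP in auto)
      have "{m \<in> R - {i}. (y(k := v)) m \<noteq> (z(k := v)) m} \<subset> {m \<in> R - {i}. y m \<noteq> z m}"
        using k by auto
      then have "card {m \<in> R - {i}. (y(k := v)) m \<noteq> (z(k := v)) m} < card {m \<in> R - {i}. y m \<noteq> z m}"
        using finR by (intro psubset_card_mono) auto
      then show False
        by (rule less.hyps [of "y(k := v)" "z(k := v)"]) (use pr k' ty tz in simp_all)
    qed
  qed
  from this [of "y(l := c)" "z(n := a)"] show False
    using y z i' nl by auto
qed

end

section \<open>A largest module and the variable that breaks it\<close>

context quasigroup4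
begin

lemma module_mono:
  assumes "module_at W k y" "B \<subseteq> W"
  shows "module_at B k y"
  unfolding module_at_def using module_atD [OF assms(1)] agree_mono [OF _ assms(2)] by blast

lemma module_shifted:
  assumes sh: "shifted f (insert k B) y y'" and mod: "module_at B k y'"
  shows "module_at B k y"
proof -
  obtain c where c: "\<And>u. f (patch (insert k B) u y') = f (patch (insert k B) u y) + c"
    using sh unfolding shifted_def by blast
  show ?thesis
    unfolding module_at_def
  proof (intro allI impI)
    fix z z' v w
    assume z: "agree B y z" "agree B y z'" and eq: "f (z(k := w)) = f (z'(k := w))"
    define s where "s z = patch B z y'" for z
    have "f ((s z)(k := v)) = f (z(k := v)) + c" if "agree B y z" for z v
    proof -
      have "(s z)(k := v) = patch (insert k B) (z(k := v)) y'" "z(k := v) = patch (insert k B) (z(k := v)) y"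
        using that by (auto simp: s_def patch_def agree_def fun_eq_iff)
      then show ?thesis using c [of "z(k := v)"] by simp
    qed
    note s = this
    have "f ((s z)(k := w)) = f ((s z')(k := w))" using s z eq by simp
    then have "f ((s z)(k := v)) = f ((s z')(k := v))"
      by (rule module_atD [OF mod, rotated 2]) (simp_all add: s_def)
    then show "f (z(k := v)) = f (z'(k := v))" using s z by simp
  qed
qed

text \<open>
  The variables in \<open>B\<close> can be moved one after the other, since \<open>K\<close> is a module towards each of them.
\<close>

lemma module_moves:
  assumes "finite B" "K \<inter> B = {}" and mod: "\<And>b z. b \<in> B \<Longrightarrow> agree B q z \<Longrightarrow> module_at K b z"
    and "agree K q q'" "f q = f q'"
  shows "f (patch B u q) = f (patch B u q')"
proof -
  have "f z = f (patch K q' z)" if "agree B q z" for z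
    using \<open>finite B\<close> that
  proof (induction rule: agree_induct)
    case base
    have "patch K q' q = q'" using assms(4) by (rule patch_eq)
    then show ?case using assms(5) by simp
  next
    case (step z i a)
    have iK: "i \<notin> K" using step.hyps(1) assms(2) by blast
    have "(patch K q' z)(i := z i) = patch K q' z"
      using iK by (auto simp: patch_def fun_eq_iff)
    then have "f (z(i := z i)) = f ((patch K q' z)(i := z i))"
      using step.IH by simp
    then have "f (z(i := a)) = f ((patch K q' z)(i := a))"
      by (rule module_atD [OF mod [OF step.hyps(1,2)] agree_refl patch_agree])
    then show ?case by (simp only: patch_upd' [OF iK])
  qed
  from this [of "patch B u q"] have "f (patch B u q) = f (patch K q' (patch B u q))" by simp
  moreover have "patch K q' (patch B u q) = patch B u q'"
    using assms(2,4) by (auto simp: patch_def agree_def fun_eq_iff)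
  ultimately show ?thesis by simp
qed

lemma not_interact_if_shifted:
  assumes "i \<noteq> j" "i \<in> B" "j \<notin> B" and sh: "\<And>b. shifted f B z (z(j := b))"
  shows "\<not> interact f i j z"
proof -
  have "\<exists>c. \<forall>a. f (z(i := a, j := b)) = f (z(i := a)) + c" for b
  proof -
    obtain c where c: "\<And>u. f (patch B u (z(j := b))) = f (patch B u z) + c"
      using sh [of b] unfolding shifted_def by blast
    have "patch B (z(i := a)) (z(j := b)) = z(i := a, j := b)" "patch B (z(i := a)) z = z(i := a)" for a
      using assms(1-3) by (auto simp: patch_def fun_eq_iff)
    then have "f (z(i := a, j := b)) = f (z(i := a)) + c" for a using c [of "z(i := a)"] by simp
    then show ?thesis by blast
  qed
  then have "\<forall>b. \<exists>c. \<forall>a. f (z(i := a, j := b)) = f (z(i := a)) + c" by blast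
  then obtain c where c: "\<And>a b. f (z(i := a, j := b)) = f (z(i := a)) + c b" by metis
  show ?thesis unfolding interact_def c by (simp add: ac_simps)
qed

text \<open>
  If two columns of a square of type \<open>D\<close> differ by a constant, they are in the same class of \<open>D\<close>: the
  product in the normal form of the square would otherwise distinguish them.
\<close>

lemma constant_difference_class:
  assumes ij: "i \<in> I" "j \<in> I" "i \<noteq> j" and D: "type i j y = D" "D \<noteq> 0"
    and const: "\<And>a. f (y(i := a, j := m)) + f (y(i := a, j := w)) = t"
  shows "t = 0 \<or> t = D"
proof -
  define F where "F a b = f (y(i := a, j := b))" for a b
  have "latin F" unfolding F_def by (rule latin_retract [OF ij])
  then obtain E where E: "\<And>a b. F a b = F a w + F 0 b + F 0 w + mul E (F a w + F 0 w) (F 0 b + F 0 w)"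
    using latin_square_form [of F w 0] by blast
  have "splits_square E F"
    by (rule splits_square_form [where D = E and g = "\<lambda>a. F a w" and h = "\<lambda>b. F 0 b + F 0 w"
          and g' = "\<lambda>a. F a w + F 0 w" and h' = "\<lambda>b. F 0 b + F 0 w"])
       (subst E, simp_all add: ac_simps)
  then have noE: "\<not> interact (bitf E) i j y"
    by (simp add: interact_def splits_square_def F_def)
  have ED: "E = D"
  proof (cases "E = 0")
    case True
    have form: "F a b = F a w + (F 0 b + F 0 w)" for a b
      using E [of a b] True by (simp add: mul_values ac_simps)
    have "F a b + F a' b' = F a b' + F a' b" for a b a' b'
      unfolding form [of a b] form [of a' b'] form [of a b'] form [of a' b] by (simp only: ac_simps)
    then have "\<not> interact f i j y"
      unfolding interact_def F_def by blast
    then show ?thesis using type_interact(1) [OF ij] D by blast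
  next
    case False
    then show ?thesis using noE type_interact(2) [OF ij False, of y] D by blast
  qed
  obtain c where c: "c \<noteq> 0" "c \<noteq> D" using k4_other by blast
  obtain a where "f ((y(j := w))(i := a)) = c + F 0 w" using surj_upd [OF ij(1)] by blast
  then have a: "F a w + F 0 w = c"
    by (simp add: F_def fun_upd_twist [OF ij(3)] add.assoc)
  have t: "F a m + F a w = t" "F 0 m + F 0 w = t" using const by (simp_all add: F_def)
  have form: "F a m = F a w + t + mul D c t"
    using E [of a m] unfolding ED a t(2) [symmetric] by (simp only: ac_simps)
  have "F a w + t + mul D c t + F a w = t"
    using t(1) unfolding form .
  then have "mul D c t = 0" by (simp add: ac_simps)
  then show ?thesis using c D(2) by (simp add: mul_values split: if_splits)
qed

end

text \<open>
  For the value \<open>y0 n\<close> of \<open>n\<close>, the set \<open>B\<close> of the largest possible size is a component of \<open>bitf D\<close> in \<open>N - {n}\<close>,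
  where \<open>f\<close> itself does not split.
\<close>

locale largest_module = maximal_pair +
  fixes B :: "'a set" and n :: 'a and y0 :: "'a \<Rightarrow> k4" and D :: k4
  assumes B_N: "B \<subseteq> N" and card_B: "card B = \<beta>" and n_N: "n \<in> N" and n_B: "n \<notin> B"
    and y0_N: "agree N x y0" and D_0: "D \<noteq> 0"
    and connected_f: "connected f (N - {n}) y0"
    and B_split: "decoupled (bitf D) B (N - {n} - B) y0"
    and B_connected: "connected (bitf D) B y0"
    and B_proper: "B \<noteq> N - {n}"
begin

abbreviation C where "C \<equiv> N - {n} - B"

lemma B_I: "B \<subseteq> I" and finite_B: "finite B" and C_I: "C \<subseteq> I" and finite_C: "finite C"
  and N_n: "B \<union> C = N - {n}" and B_C: "B \<inter> C = {}" and in_I: "m \<in> N \<Longrightarrow> m \<in> I"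
  using B_N N_I finite_subN [of B] finite_N n_B by auto

lemma two_le_card_B: "2 \<le> card B"
  using card_B beta_ge_2 by simp

lemma B_nonempty: "B \<noteq> {}"
  using two_le_card_B by (intro notI) simp

lemma agree_n: "agree (N - {n}) y0 y \<longleftrightarrow> agree N y0 y \<and> y n = y0 n"
  using n_N by (auto simp: agree_def)

lemma agree_N: "agree N y0 y \<longleftrightarrow> agree N x y"
  using y0_N by (auto simp: agree_def)

lemma B_connected': "agree (N - {n}) y0 y \<Longrightarrow> connected (bitf D) B y"
  by (rule connected_split_off [OF _ _ B_split B_connected]) (use finite_N N_n in auto)

lemma B_split': "agree (N - {n}) y0 y \<Longrightarrow> decoupled (bitf D) B C y"
  using B_split decoupled_cong [of B C y0 y "bitf D"] N_n by simp

lemma module_C: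
  assumes "k \<in> C" "agree (N - {n}) y0 y"
  shows "module_at B k y"
  by (rule component_module [OF _ _ D_0 B_split B_connected assms]) (use N_n N_I in auto)

lemma type_C:
  assumes "b \<in> B" "k \<in> C" "agree (N - {n}) y0 y"
  shows "type b k y = 0 \<or> type b k y = D"
  using B_split assms unfolding decoupled_bit_iff [OF B_I C_I B_C D_0] N_n by blast

text \<open>
  If \<open>B\<close> were a module towards all other variables, contracting it would give a smaller counterexample.
  It is one towards the variables in \<open>C\<close> while \<open>n\<close> has the value \<open>y0 n\<close>, so \<open>n\<close> must break it somewhere.
\<close>

lemma broken: "\<exists>e. agree (N - {n}) y0 e \<and> \<not> module_at B n e"
proof (rule ccontr)
  assume no: "\<not> ?thesis"
  have mod_n: "module_at B n y" if "agree N y0 y" for y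
  proof -
    have "agree (N - {n}) y0 (y(n := y0 n))" using that by (auto simp: agree_def)
    then have "module_at B n (y(n := y0 n))" using no by blast
    then show ?thesis by (rule module_cong [rotated]) simp
  qed
  have mod: "module_at B k y" if k: "k \<in> N - B" and y: "agree N y0 y" for k y
  proof (cases "k = n")
    case True then show ?thesis using mod_n [OF y] by simp
  next
    case False
    then have kC: "k \<in> C" using k by auto
    show ?thesis
      unfolding module_at_def
    proof (intro allI impI)
      fix z z' v w
      assume z: "agree B y z" "agree B y z'" and eq: "f (z(k := w)) = f (z'(k := w))"
      have nk: "n \<noteq> k" using False by simp
      have zn: "z n = y n" "z' n = y n" using z n_B by (auto simp: agree_def)
      have ag: "agree B (y(m := u)) (z(m := u))" "agree B (y(m := u)) (z'(m := u))" for m u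
        using z by (auto simp: agree_def)
      have yk: "agree N y0 (y(k := u))" for u using y k by simp
      have "f ((z(k := w))(n := y n)) = f ((z'(k := w))(n := y n))"
        using eq zn nk by (metis fun_upd_other fun_upd_triv)
      then have "f ((z(k := w))(n := y0 n)) = f ((z'(k := w))(n := y0 n))"
        by (rule module_atD [OF mod_n [OF yk] ag])
      then have "f ((z(n := y0 n))(k := w)) = f ((z'(n := y0 n))(k := w))"
        by (simp only: fun_upd_twist [OF nk])
      moreover have "agree (N - {n}) y0 (y(n := y0 n))" using y by (auto simp: agree_def)
      ultimately have "f ((z(n := y0 n))(k := v)) = f ((z'(n := y0 n))(k := v))"
        using module_atD [OF module_C [OF kC] ag] by blast
      then have "f ((z(k := v))(n := y0 n)) = f ((z'(k := v))(n := y0 n))"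
        by (simp only: fun_upd_twist [OF nk])
      then have "f ((z(k := v))(n := y n)) = f ((z'(k := v))(n := y n))"
        by (rule module_atD [OF mod_n [OF yk] ag])
      then show "f (z(k := v)) = f (z'(k := v))"
        using zn nk by (metis fun_upd_other fun_upd_triv)
    qed
  qed
  obtain i where i: "i \<in> B" using B_nonempty by blast
  define V where "V = insert i (N - B)"
  have "card V = Suc (card (N - B))" unfolding V_def using i finite_N by (intro card_insert_disjoint) auto
  also have "card (N - B) = card N - card B" by (rule card_Diff_subset [OF finite_B B_N])
  finally have cV: "card V = Suc (card N - card B)" .
  have "B \<subset> N" using B_N n_N n_B by blast
  then have "card B < card N" by (rule psubset_card_mono [OF finite_N])
  then have "2 \<le> card V" "card V < card N" using cV two_le_card_B by simp_all
  moreover have "V \<subseteq> I" using i B_I N_I by (auto simp: V_def)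
  ultimately obtain P where "P \<noteq> 0" "\<not> connected (bitf P) V y0" using smaller by blast
  then show False
    using split_lift [OF N_I B_N i mod] connected_N' [OF _ y0_N] unfolding V_def by blast
qed

lemma broken_connected:
  assumes "agree (N - {n}) y0 e" "\<not> module_at B n e"
  shows "\<not> decoupled (bitf D) B {n} e" "connected (bitf D) (insert n B) e"
proof -
  show 1: "\<not> decoupled (bitf D) B {n} e"
    using connected_module [OF B_I in_I [OF n_N] n_B D_0 B_connected' [OF assms(1)]] assms(2) by blast
  show "connected (bitf D) (insert n B) e"
    by (rule connected_insert [OF B_connected' [OF assms(1)] n_B B_nonempty 1])
qed

text \<open>
  If \<open>B\<close> is broken in a context where it interacts with some \<open>l\<close>, then \<open>n\<close> can be added to \<open>B\<close> to obtain a
  larger pair, unless \<open>n\<close> and \<open>l\<close> are the only variables outside \<open>B\<close>.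
\<close>

lemma broken_interacting:
  assumes e: "agree (N - {n}) y0 e" "\<not> module_at B n e"
    and l: "l \<in> C" "b \<in> B" "agree (insert l B) e z" "type b l z \<noteq> 0"
  shows "C = {l}"
proof (rule ccontr)
  assume "C \<noteq> {l}"
  define W where "W = insert l B"
  define U where "U = insert l (insert n B)"
  have l': "l \<in> N" "l \<noteq> n" "l \<notin> B" "l \<notin> insert n B" using l(1) by auto
  have U: "U \<subseteq> N" "U \<noteq> N" using l' B_N n_N \<open>C \<noteq> {l}\<close> l(1) by (auto simp: U_def)
  then have "card U < card N" using finite_N by (intro psubset_card_mono) auto
  moreover have "card U = card B + 2" using l' n_B finite_B by (simp add: U_def)
  moreover have "U \<subseteq> I" using U N_I by auto
  ultimately obtain Z where Z: "Z \<noteq> 0" "\<not> connected (bitf Z) U e"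
    using smaller [of U e] by auto
  have eN: "agree N x e" using e(1) agree_n agree_N by blast
  show False
  proof (cases "Z = D")
    case True
    have "connected (bitf D) (insert n B) e" by (rule broken_connected(2) [OF e])
    then have "decoupled (bitf D) (insert n B) {l} e"
      using connected_insert [of "bitf D" "insert n B" e l] Z(2) True l' unfolding U_def by blast
    then have "pair (insert n B) l e D"
      using broken_connected(2) [OF e] l l' B_N n_N eN D_0
      by (intro pairI [where b = b and z = z]) (auto simp: agree_def)
    then have "card (insert n B) \<le> \<beta>" by (rule pair_max)
    then show False using card_B n_B finite_B by simp
  next
    case False
    have WI: "W \<subseteq> I" using l' B_I in_I by (auto simp: W_def)
    have fB: "connected f B e" by (rule connected_bit_imp_f [OF B_connected' [OF e(1)] B_I D_0])
    have sub: "{l} \<subseteq> I" "B \<inter> {l} = {}" "B \<union> {l} = insert l B" "W - B = {l}" using l' in_I by (auto simp: W_def)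
    have "\<not> decoupled f B {l} e"
      unfolding decoupled_f_iff [OF B_I sub(1,2)] sub(3) using l by blast
    then have fW: "connected f W e"
      unfolding W_def by (rule connected_insert [OF fB l'(3) B_nonempty])
    have dB: "decoupled (bitf D) B {l} e"
      by (rule decoupled_mono [OF B_split' [OF e(1)]]) (use l in auto)
    have "\<not> connected (bitf D) W e"
    proof
      assume "connected (bitf D) W e"
      from connectedD [OF this, of B] dB sub(4) B_nonempty have "B = W" by (simp add: W_def subset_insertI)
      then show False using l' by (auto simp: W_def)
    qed
    from split_unique [OF WI fW D_0 this Z(1) False] have ZW: "connected (bitf Z) W e" .
    have nW: "n \<notin> W" "W \<noteq> {}" "insert n W = U" using l' n_B by (auto simp: W_def U_def)
    have "decoupled (bitf Z) W {n} e"
      using connected_insert [OF ZW nW(1,2)] Z(2) nW(3) by auto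
    then have "module_at W n e"
      by (rule connected_module [OF WI in_I [OF n_N] nW(1) Z(1) ZW])
    then have "module_at B n e" by (rule module_mono) (simp add: W_def subset_insertI)
    then show False using e(2) by blast
  qed
qed

end

context largest_module
begin

text \<open>
  A value of \<open>k\<close> that changes the retract to \<open>B\<close> by more than a constant witnesses an interaction, whose
  type can only be \<open>D\<close>.
\<close>

lemma not_shifted_type:
  assumes "agree (N - {n}) y0 y" "k \<in> C" "\<not> shifted f B y (y(k := v))" "b \<in> B"
  shows "type b k y = D"
proof -
  have sub: "{k} \<subseteq> I" "B \<inter> {k} = {}" "B \<union> {k} = insert k B" "k \<notin> B" using assms(2) in_I by auto
  have "\<not> decoupled f B {k} y"
    using decoupled_shifted [OF finite_B _ sub(2), of f y "y(k := v)"] assms(3) by auto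
  then obtain b' z where z: "b' \<in> B" "agree (insert k B) y z" "type b' k z \<noteq> 0"
    unfolding decoupled_f_iff [OF B_I sub(1,2)] sub(3) by blast
  have "insert k B \<subseteq> N - {n}" using assms(2) N_n by blast
  then have "agree (N - {n}) y0 z" using assms(1) z(2) by (meson agree_mono agree_trans)
  then have "type b' k z = D" using type_C [OF z(1) assms(2)] z(3) by blast
  then show ?thesis
    using module_type [OF module_C [OF assms(2,1)] assms(4) z(1) sub(4) B_I agree_refl z(2)] by simp
qed

text \<open>
  If \<open>B\<close> does not interact with the variable \<open>k\<close> in a context \<open>e\<close> in which \<open>n\<close> breaks it, then \<open>B\<close> is also
  broken after replacing the value of \<open>k\<close> by a suitable value in the other class of the splitting
  \<open>D\<close>: otherwise \<open>n\<close> would interact with all of \<open>B\<close> uniformly, and the change of \<open>k\<close> would not matter.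
\<close>

lemma still_broken:
  assumes e: "agree (N - {n}) y0 e" "\<not> module_at B n e" and k: "k \<in> C"
    and dead: "\<And>b z. b \<in> B \<Longrightarrow> agree (insert k B) e z \<Longrightarrow> type b k z = 0"
  obtains T m where "T \<noteq> 0" "T \<noteq> D" "f (e(k := m)) = f e + T" "\<not> module_at B n (e(k := m))"
proof -
  have k': "k \<in> N" "k \<noteq> n" "k \<notin> B" "k \<in> I" using k in_I by auto
  have en: "e n = y0 n" using e(1) agree_n by blast
  have sub: "{n} \<subseteq> I" "B \<inter> {n} = {}" "{k} \<subseteq> I" "B \<inter> {k} = {}" "B \<union> {k} = insert k B" "insert n B \<subseteq> I" "insert n B \<inter> {k} = {}"
    using k' n_B n_N in_I B_I by auto
  obtain b z where b: "b \<in> B" and z: "agree (B \<union> {n}) e z" and ty: "type b n z \<noteq> 0" "type b n z \<noteq> D"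
    using broken_connected(1) [OF e] unfolding decoupled_bit_iff [OF B_I sub(1,2) D_0] by blast
  define T where "T = type b n z"
  have T: "T \<noteq> 0" "T \<noteq> D" using ty by (simp_all add: T_def)
  obtain m where m: "f (e(k := m)) = f e + T" using surj_upd [OF k'(4)] by blast
  have uniform: "type b' k y = 0 \<or> type b' k y = T" "type k n y = 0 \<or> type k n y = T" "type b' n y = 0 \<or> type b' n y = T"
    if b': "b' \<in> B" and u: "agree (insert n (insert k B)) e u" "type b' n u = T"
      and y: "agree {b', k, n} u y" for b' u y
  proof -
    have ne: "b' \<noteq> k" "b' \<noteq> n" "k \<noteq> n" using b' k' n_B by auto
    have "agree (insert k B) e (u(n := y0 n))"
      using u(1) en by (auto simp: agree_def)
    then have zero: "type b' k (u(n := y0 n)) = 0" by (rule dead [OF b'])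
    have bI: "b' \<in> I" using b' B_I by blast
    have ag: "agree {b', k, n} (u(n := y0 n)) u" "agree {b', k, n} (u(n := y0 n)) y"
      using y by (auto simp: agree_def)
    note types = zero_type_uniform' [OF bI k'(4) in_I [OF n_N] ne zero ag(1) T(1) _ ag(2)]
    show "type b' k y = 0 \<or> type b' k y = T" "type k n y = 0 \<or> type k n y = T" "type b' n y = 0 \<or> type b' n y = T"
      using types u(2) by blast+
  qed
  have "\<not> module_at B n (e(k := m))"
  proof
    assume mod: "module_at B n (e(k := m))"
    have ne: "b \<noteq> k" "b \<noteq> n" "k \<noteq> n" using b k' n_B by auto
    have bI: "b \<in> I" using b B_I by blast
    have zu: "agree (insert n (insert k B)) e z" using z by (auto simp: agree_def)
    \<comment> \<open>The element \<open>b\<close> has the same type towards \<open>n\<close> after the change of \<open>k\<close>.\<close>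
    define z0 where "z0 = z(n := y0 n)"
    have z0B: "agree B e z0" using z en by (auto simp: z0_def agree_def)
    have dec: "decoupled f B {k} e"
      unfolding decoupled_f_iff [OF B_I sub(3,4)] sub(5) using dead by blast
    have "shifted f B e (e(k := m))"
      by (rule decoupled_shifted [OF finite_B _ sub(4) dec]) auto
    then obtain c where c: "\<And>u. f (patch B u (e(k := m))) = f (patch B u e) + c"
      unfolding shifted_def by blast
    have pk: "patch B u (e(k := m)) = (patch B u e)(k := m)" for u
      using k'(3) by (simp add: patch_upd')
    have "f (e(k := m)) = f e + c" using c [of e] unfolding pk by simp
    then have "c = T" using m by simp
    then have "f (z0(k := m)) = f z0 + T"
      using c [of z0] unfolding pk patch_eq [OF z0B] by simp
    then have bitT: "bitf T (z0(k := m)) = bitf T z0" by (simp add: pr_add)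
    have trip: "{b, n} \<subseteq> I" "{k} \<subseteq> I" "{b, n} \<inter> {k} = {}" using bI in_I [OF n_N] k' ne by auto
    have "decoupled (bitf T) {b, n} {k} z0"
      unfolding decoupled_bit_iff [OF trip T(1)]
    proof (intro ballI allI impI)
      fix p q y assume pq: "p \<in> {b, n}" "q \<in> {k}" "agree ({b, n} \<union> {k}) z0 y"
      have "agree {b, k, n} z y" using pq(3) by (auto simp: agree_def z0_def)
      then show "type p q y = 0 \<or> type p q y = T"
        using uniform(1,2) [OF b zu T_def [symmetric], of y] pq(1,2) type_commute [of n k y] ne by auto
    qed
    then have "type b n (z0(k := m)) = type b n z0"
      using type_same_class [OF bI in_I [OF n_N] k'(4) ne(2,1) _ T(1)] bitT ne(3) by blast
    then have tb: "type b n (z0(k := m)) = T" using ne by (simp add: z0_def T_def)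
    have zk: "agree (insert n B) (e(k := m)) (z0(k := m))"
      using z0B by (auto simp: agree_def)
    have all: "type b' n y = T" if "b' \<in> B" "agree (insert n B) (e(k := m)) y" for b' y
      using module_type [OF mod that(1) b n_B B_I that(2) zk] tb by simp
    have "decoupled (bitf T) (insert n B) {k} e"
      unfolding decoupled_bit_iff [OF sub(6,3,7) T(1)]
    proof (intro ballI allI impI)
      fix p q y assume pq: "p \<in> insert n B" "q \<in> {k}" "agree (insert n B \<union> {k}) e y"
      define b' where "b' = (if p = n then b else p)"
      have b': "b' \<in> B" using pq(1) b by (auto simp: b'_def)
      have "agree (insert n B) (e(k := m)) (y(k := m))" "agree (insert n (insert k B)) e (y(k := m))"
        using pq(3) by (auto simp: agree_def)
      moreover have "agree {b', k, n} (y(k := m)) y" by (auto simp: agree_def)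
      ultimately have "type b' k y = 0 \<or> type b' k y = T" "type k n y = 0 \<or> type k n y = T"
        using uniform(1,2) [OF b', of "y(k := m)" y] all [OF b'] by blast+
      then show "type p q y = 0 \<or> type p q y = T"
        using pq(1,2) type_commute [of n k y] ne(3) by (auto simp: b'_def split: if_splits)
    qed
    then have "shifted f (insert n B) e (e(k := m))"
      using bit_shift [OF sub(6) k'(4) _ T(1), of e m] m k' by (simp add: pr_add)
    then have "module_at B n e" using mod by (rule module_shifted)
    then show False using e(2) by blast
  qed
  then show thesis using that T m by blast
qed

text \<open>
  Otherwise \<open>B\<close> does not interact with \<open>C\<close> in any context \<open>e\<close> in which \<open>n\<close> breaks it, and it suffices to show
  that the retract to \<open>B\<close> in every other context \<open>q\<close> is a shift of the one in \<open>e\<close>; then \<open>B\<close> splits off. Take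
  \<open>e\<close> and \<open>q\<close> violating this with as few differences as possible, and let \<open>k\<close> be one of them. With the
  value of \<open>e\<close> at \<open>k\<close> instead, \<open>q\<close> becomes a shift \<open>q0\<close> of \<open>e\<close>. The variable \<open>k\<close> is the only difference in its
  component for \<open>D\<close>, since a second one could be removed at the same time by moves within the module.
  By the preceding lemma \<open>B\<close> is still broken after changing the class of \<open>e\<close> by another value \<open>m\<close> of \<open>k\<close>; by
  minimality, \<open>m\<close> also gives a shift of \<open>q0\<close>. As \<open>B\<close> and \<open>k\<close> interact with type \<open>D\<close> at \<open>q0\<close>, this means that \<open>m\<close>
  preserves the class of \<open>q0\<close> for \<open>D\<close>. But by additivity it changes the classes of \<open>e\<close> and \<open>q0\<close> alike.
\<close>

lemma broken_interacts:
  "\<exists>e k b z. agree (N - {n}) y0 e \<and> \<not> module_at B n e \<and> k \<in> C \<and> b \<in> B \<and>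
     agree (insert k B) e z \<and> type b k z \<noteq> 0"
proof (rule ccontr)
  assume none: "\<not> ?thesis"
  have dead: "type b k z = 0"
    if "agree (N - {n}) y0 e" "\<not> module_at B n e" "k \<in> C" "b \<in> B" "agree (insert k B) e z" for e k b z
    using none that by blast
  have dead_shift: "shifted f B e (e(k := v))"
    if "agree (N - {n}) y0 e" "\<not> module_at B n e" "k \<in> C" for e k v
  proof -
    have sub: "{k} \<subseteq> I" "B \<inter> {k} = {}" "B \<union> {k} = insert k B" using that(3) in_I by auto
    have dec: "decoupled f B {k} e"
      unfolding decoupled_f_iff [OF B_I sub(1,2)] sub(3) using dead [OF that] by blast
    show ?thesis by (rule decoupled_shifted [OF finite_B _ sub(2) dec]) auto
  qed
  have close: "shifted f B e q"
    if "agree (N - {n}) y0 e" "\<not> module_at B n e" "agree C e q" for e q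
    using that
  proof (induction "card {k \<in> C. e k \<noteq> q k}" arbitrary: e q rule: less_induct)
    case less
    note e = less.prems(1,2) and q = less.prems(3)
    have q': "agree (N - {n}) y0 q"
      using e(1) q by (meson Diff_subset agree_mono agree_trans)
    show ?case
    proof (rule ccontr)
      assume no: "\<not> ?case"
      define \<Delta> where "\<Delta> = {k \<in> C. e k \<noteq> q k}"
      have fin\<Delta>: "finite \<Delta>" by (rule finite_subset [OF _ finite_C]) (auto simp: \<Delta>_def)
      have IH: "shifted f B e' q'"
        if "agree (N - {n}) y0 e'" "\<not> module_at B n e'" "agree C e' q'" "{k \<in> C. e' k \<noteq> q' k} \<subset> \<Delta>" for e' q'
        by (rule less.hyps [OF psubset_card_mono [OF fin\<Delta> that(4), unfolded \<Delta>_def] that(1-3)])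
      have "\<Delta> \<noteq> {}"
      proof
        assume "\<Delta> = {}"
        then have "q = e" using q by (auto simp: \<Delta>_def agree_def fun_eq_iff)
        then show False using no by simp
      qed
      then obtain k where k\<Delta>: "k \<in> \<Delta>" by blast
      then have k: "k \<in> C" "e k \<noteq> q k" by (auto simp: \<Delta>_def)
      have k': "k \<in> N - {n}" "k \<notin> B" "k \<in> I" using k(1) in_I by auto
      define q0 where "q0 = q(k := e k)"
      have q0: "agree C e q0" "agree (N - {n}) y0 q0"
        using q q' k k' by (simp_all add: q0_def)
      have "{m \<in> C. e m \<noteq> q0 m} \<subset> \<Delta>" using k by (auto simp: \<Delta>_def q0_def)
      then have sh0: "shifted f B e q0" by (rule IH [OF e q0(1)])
      have q_q0: "q = q0(k := q k)" by (simp add: q0_def)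
      have nosh: "\<not> shifted f B q0 (q0(k := q k))"
        using no sh0 shifted_trans q_q0 by metis
      \<comment> \<open>The contexts differ in at most one variable of each component for \<open>D\<close>.\<close>
      obtain K where K: "K \<subseteq> N - {n}" "k \<in> K" "decoupled (bitf D) K (N - {n} - K) y0" "connected (bitf D) K y0"
        using connected_component [of "N - {n}" k "bitf D" y0] k'(1) finite_N by blast
      have KB: "K \<inter> B = {}"
      proof (rule ccontr)
        assume ne: "K \<inter> B \<noteq> {}"
        have "decoupled (bitf D) (K \<inter> B) (K - (K \<inter> B)) y0"
          by (rule decoupled_mono [OF B_split]) (use K in auto)
        then have "K \<inter> B = K" using connectedD [OF K(4) _ ne] by blast
        then show False using K(2) k'(2) by blast
      qed
      have modK: "module_at K b z" if "b \<in> B" "agree (N - {n}) y0 z" for b z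
        by (rule component_module [OF _ K(1) D_0 K(3,4) _ that(2)]) (use that(1) N_n KB N_I in auto)
      have single: "k2 \<notin> K" if k2: "k2 \<in> \<Delta>" "k2 \<noteq> k" for k2
      proof
        assume k2K: "k2 \<in> K"
        have k2C: "k2 \<in> C" using k2 by (simp add: \<Delta>_def)
        obtain v where v: "f ((q(k2 := e k2))(k := v)) = f q"
          using surj_upd [OF k'(3)] by blast
        define q2 where "q2 = (q(k2 := e k2))(k := v)"
        have "f (patch B u q) = f (patch B u q2)" for u
        proof (rule module_moves [OF finite_B KB])
          show "agree K q q2" using K(2) k2K by (simp add: q2_def)
          show "f q = f q2" using v by (simp add: q2_def)
          show "module_at K b z" if "b \<in> B" "agree B q z" for b z
          proof (rule modK [OF that(1)])
            have "B \<subseteq> N - {n}" using N_n by blast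
            then show "agree (N - {n}) y0 z" using agree_trans [OF q' agree_mono [OF that(2)]] by blast
          qed
        qed
        then have "shifted f B q2 q" unfolding shifted_def by (intro exI [of _ 0]) simp
        moreover have "shifted f B e q2"
        proof (rule IH [OF e])
          show "agree C e q2" using q k(1) k2C by (simp add: q2_def)
          show "{m \<in> C. e m \<noteq> q2 m} \<subset> \<Delta>" using k2 k\<Delta> by (auto simp: q2_def \<Delta>_def)
        qed
        ultimately show False using no shifted_trans by blast
      qed
      have "decoupled (bitf D) {k} (\<Delta> - {k}) e"
        by (rule decoupled_mono [OF K(3)]) (use K(2) single \<Delta>_def k' e(1) N_n K(1) in \<open>auto simp: Un_absorb1\<close>)
      moreover have "agree (\<Delta> - {k}) e q0"
        using q by (auto simp: agree_def q0_def \<Delta>_def)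
      ultimately have sum: "bitf D (patch {k} u e) + bitf D (patch {k} u' q0) =
          bitf D (patch {k} u q0) + bitf D (patch {k} u' e)" for u u'
        using decoupled_sum [of "{k}" "\<Delta> - {k}" "bitf D" e e q0 u u'] fin\<Delta> by auto
      have pk: "patch {k} (w(k := v)) u = u(k := v)" for w u :: "'a \<Rightarrow> k4" and v
        by (auto simp: patch_def fun_eq_iff)
      have bits: "bitf D (e(k := v)) + bitf D q0 = bitf D (q0(k := v)) + bitf D e" for v
        using sum [of "e(k := v)" "e(k := e k)"] unfolding pk by (simp add: q0_def)
      obtain T m where T: "T \<noteq> 0" "T \<noteq> D" "f (e(k := m)) = f e + T" "\<not> module_at B n (e(k := m))"
        using still_broken [OF e k(1) dead [OF e k(1)]] by blast
      have em: "agree (N - {n}) y0 (e(k := m))" using e(1) k'(1) by simp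
      have "shifted f B (e(k := m)) (q0(k := m))"
      proof (rule IH [OF em T(4)])
        show "agree C (e(k := m)) (q0(k := m))" using q0(1) k(1) by simp
        show "{j \<in> C. (e(k := m)) j \<noteq> (q0(k := m)) j} \<subset> \<Delta>"
          using k by (auto simp: \<Delta>_def q0_def)
      qed
      then have "shifted f B e (q0(k := m))"
        using dead_shift [OF e k(1)] shifted_trans by blast
      then have "shifted f B q0 (q0(k := m))"
        using sh0 shifted_sym shifted_trans by blast
      then obtain t where t: "\<And>u. f (patch B u (q0(k := m))) = f (patch B u q0) + t"
        unfolding shifted_def by blast
      obtain b where b: "b \<in> B" using B_nonempty by blast
      have bk: "b \<noteq> k" "b \<in> I" using b k'(2) B_I by auto
      have tyb: "type b k q0 = D" by (rule not_shifted_type [OF q0(2) k(1) nosh b])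
      have "f (q0(b := a, k := m)) + f (q0(b := a, k := e k)) = t" for a
      proof -
        have "patch B (q0(b := a)) (q0(k := m)) = q0(b := a, k := m)" "patch B (q0(b := a)) q0 = q0(b := a, k := e k)"
          using b k'(2) bk by (auto simp: patch_def fun_eq_iff q0_def)
        then show ?thesis using t [of "q0(b := a)"] by (simp add: add.assoc add.commute)
      qed
      then have "t = 0 \<or> t = D"
        by (rule constant_difference_class [OF bk(2) k'(3) bk(1) tyb D_0])
      then have "pr D t = 0" by auto
      moreover have "f (q0(k := m)) = f q0 + t"
      proof -
        have "patch B q0 (q0(k := m)) = q0(k := m)"
          using k'(2) by (auto simp: patch_def fun_eq_iff)
        then show ?thesis using t [of q0] by simp
      qed
      ultimately have "bitf D (q0(k := m)) = bitf D q0" by (simp add: pr_add)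
      then have "bitf D (e(k := m)) = bitf D e"
        using bits [of m] by (metis add.commute add_left_cancel)
      then have "pr D T = 0" unfolding T(3) pr_add by simp
      then show False using T(1,2) pr_eq_0 [OF D_0] by blast
    qed
  qed
  obtain e where e: "agree (N - {n}) y0 e" "\<not> module_at B n e" using broken by blast
  have "decoupled f B C y0"
    unfolding decoupled_def N_n
  proof (intro ballI allI impI)
    fix i j z assume ij: "i \<in> B" "j \<in> C" and z: "agree (N - {n}) y0 z"
    have "shifted f B e (z(j := b))" for b
    proof -
      define z' where "z' = patch B e (z(j := b))"
      have "agree C e z'"
        using e(1) z ij(2) N_n by (auto simp: z'_def agree_def patch_def)
      then have "shifted f B e z'" by (rule close [OF e])
      moreover have "shifted f B z' (z(j := b))"
        by (rule shifted_agree) (simp add: z'_def agree_def patch_def)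
      ultimately show ?thesis by (rule shifted_trans)
    qed
    from this [of "z j"] this have "shifted f B z (z(j := b))" for b
      using shifted_sym shifted_trans by (metis fun_upd_triv)
    then show "\<not> interact f i j z"
      using not_interact_if_shifted [of i j B z] ij by blast
  qed
  moreover have "N - {n} - B = C" ..
  moreover have "B \<subseteq> N - {n}" using N_n by blast
  ultimately have "B = N - {n}"
    using connectedD [OF connected_f _ B_nonempty] by blast
  then show False using B_proper by blast
qed

text \<open>
  In the remaining situation there is one variable \<open>l\<close> besides \<open>B\<close> and \<open>n\<close>. Fix a variable \<open>i\<close> of \<open>B\<close>, at a
  value \<open>b\<close>, such that the rest of \<open>B\<close> and \<open>n\<close> stay connected for \<open>bitf D\<close>. The retract to the variables other
  than \<open>i\<close> has a splitting \<open>Z\<close>. If \<open>Z = D\<close>, then \<open>l\<close> acts uniformly with type \<open>D\<close>, otherwise \<open>n\<close> acts uniformly with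
  type \<open>Z\<close>. The rules for ternary retracts carry these types over to all values of \<open>i\<close>, and in the end
  one of \<open>l\<close>, \<open>n\<close> and \<open>i\<close> is isolated in \<open>N\<close> for \<open>bitf D\<close> or \<open>bitf Z\<close>.
\<close>

lemma contradiction: False
proof -
  obtain e l b0 z0 where e: "agree (N - {n}) y0 e" "\<not> module_at B n e" and l: "l \<in> C"
    and b0: "b0 \<in> B" "agree (insert l B) e z0" "type b0 l z0 \<noteq> 0"
    using broken_interacts by blast
  have Cl: "C = {l}" by (rule broken_interacting [OF e l b0])
  have l': "l \<in> N" "l \<noteq> n" "l \<notin> B" "l \<in> I" using l in_I by auto
  have N: "N = insert n (insert l B)" using Cl N_n n_N B_N l' by auto
  have Nn: "N - {n} = insert l B" using N n_B l' by auto
  have nI: "n \<in> I" by (rule in_I [OF n_N])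
  have ag0: "agree (N - {n}) y0 z0" using e(1) b0(2) Nn agree_trans by metis
  have tyl: "type b l y = D" if "b \<in> B" "agree N y0 y" "y n = y0 n" for b y
  proof -
    have y: "agree (N - {n}) y0 y" using that agree_n by blast
    have "type b0 l z0 = D" using type_C [OF b0(1) l ag0] b0(3) by blast
    moreover have ag: "agree (insert l B) y0 y" "agree (insert l B) y0 z0" using y ag0 Nn by simp_all
    ultimately show ?thesis
      using module_type [OF module_C [OF l agree_refl] that(1) b0(1) l'(3) B_I ag] by simp
  qed
  have conn: "connected (bitf D) (insert n B) e" by (rule broken_connected(2) [OF e])
  have fin: "finite (insert n B)" using finite_B by simp
  obtain b1 where b1: "b1 \<in> B" using B_nonempty by blast
  then have "insert n B \<noteq> {n}" using n_B by auto
  then obtain i y where i: "i \<in> insert n B - {n}" and y: "agree (insert n B) e y"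
      and V: "connected (bitf D) (insert n B - {i}) y"
    using connected_remove [OF fin conn, of n] by blast
  have i': "i \<in> B" "i \<noteq> n" "i \<noteq> l" "i \<in> I" "i \<in> N" using i l' B_I B_N by auto
  define b where "b = y i"
  have eN: "agree N y0 e" using e(1) agree_n by blast
  have yN: "agree N y0 y" using eN y N by (auto simp: agree_def)
  define U where "U = N - {i}"
  define V where "V = insert n B - {i}"
  define W where "W = insert l (B - {i})"
  have sets: "n \<in> V" "l \<notin> V" "insert l V = U" "n \<notin> W" "insert n W = U" "W \<noteq> {}" "V \<subseteq> I" "W \<subseteq> I" "U \<subseteq> I" "i \<notin> V" "i \<notin> W"
    using N i' l' n_B B_I nI N_I by (auto simp: U_def V_def W_def)
  have "card U = card N - 1" using i'(5) finite_N by (simp add: U_def)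
  then have "2 \<le> card U" "card U < card N" using card_N by simp_all
  then obtain Z where Z: "Z \<noteq> 0" "\<not> connected (bitf Z) U y"
    using smaller [OF sets(9), of y] by blast
  have toU: "agree U y u" if "agree N y0 u" "u i = b" for u
    using that yN by (auto simp: agree_def U_def b_def)
  have "B - {i} \<noteq> {}"
  proof
    assume "B - {i} = {}"
    then have "B = {i}" using i' by auto
    then show False using two_le_card_B by simp
  qed
  then obtain j0 where j0: "j0 \<in> B" "j0 \<noteq> i" by blast
  have fixn: "agree N y0 (u(n := y0 n))" "agree N y0 (u(i := b))" if "agree N y0 u" for u
    using that n_N i' by simp_all
  have B_n: "j \<noteq> n" "j \<noteq> l" "j \<in> I" "j \<in> N" if "j \<in> B" for j
    using that n_B l' B_I B_N by auto
  show False
  proof (cases "Z = D")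
    case True
    \<comment> \<open>Here \<open>l\<close> acts uniformly with type \<open>D\<close>, and splits off from \<open>N\<close>.\<close>
    have "decoupled (bitf D) V {l} y"
      using connected_insert [OF V [folded V_def] sets(2)] Z(2) True sets(1,3) by auto
    then have mod: "module_at V l y"
      by (rule connected_module [OF sets(7) l'(4) sets(2) D_0 V [folded V_def]])
    have ln: "type l n u = D" if u: "agree N y0 u" "u i = b" for u
    proof -
      define u' where "u' = u(n := y0 n)"
      have "agree N y0 u'" "u' i = b" using u fixn i' by (simp_all add: u'_def)
      then have "agree (insert l V) y u" "agree (insert l V) y u'" using toU u sets(3) by simp_all
      then have "type n l u = type j0 l u'"
        using module_type [OF mod sets(1) _ sets(2,7)] j0 by (simp add: V_def)
      also have "\<dots> = D" using tyl [OF j0(1) \<open>agree N y0 u'\<close>] by (simp add: u'_def)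
      finally show ?thesis using type_commute [OF l'(2)] by simp
    qed
    have tri: "agree {p, q, r} u u'" if "u' = u(r := v)" for p q r u u' and v :: k4
      using that by (auto simp: agree_def)
    have ln': "type l n u = 0 \<or> type l n u = D" if u: "agree N y0 u" for u
    proof (rule ccontr)
      assume no: "\<not> ?thesis"
      have "type l n (u(i := b)) = D" by (rule ln [OF fixn(2) [OF u]]) simp
      moreover have "agree {l, n, i} u (u(i := b))" "agree {l, n, i} u (u(n := y0 n))" by simp_all
      ultimately have "type l i (u(n := y0 n)) = type l n u + D"
        using type_changes(1) [of l n i u "u(i := b)" "u(n := y0 n)"] no D_0 l' nI i' by auto
      moreover have "type l i (u(n := y0 n)) = D"
        using tyl [OF i'(1) fixn(1) [OF u]] type_commute [of l i] i'(3) by simp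
      ultimately have "type l n u = 0" by simp
      then show False using no by simp
    qed
    show False
    proof (rule not_isolated [OF l'(1) D_0])
      fix k u assume k: "k \<in> N" "k \<noteq> l" and "agree N x u"
      then have u: "agree N y0 u" using agree_N by blast
      show "type l k u = 0 \<or> type l k u = D"
      proof (cases "k = n")
        case True
        then show ?thesis using ln' [OF u] by simp
      next
        case False
        then have kB: "k \<in> B" using k N by auto
        show ?thesis
        proof (rule ccontr)
          assume no: "\<not> ?thesis"
          have "type l k (u(n := y0 n)) = D"
            using tyl [OF kB fixn(1) [OF u]] type_commute [of l k] k(2) by simp
          then have "type l n u = type l k u + D"
            using type_changes(1) [of l k n u "u(n := y0 n)" u] no D_0 l' nI B_n [OF kB] by auto
          then have "type l k u = D + type l n u" by (simp add: add.commute)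
          then show False using ln' [OF u] no by (elim disjE) simp_all
        qed
      qed
    qed
  next
    case False
    \<comment> \<open>Here \<open>n\<close> acts uniformly with type \<open>Z\<close> as long as \<open>i\<close> has the value \<open>b\<close>. If \<open>i, n\<close> has the type \<open>D\<close> anywhere,
      then it has it everywhere and \<open>i\<close> is isolated for \<open>D\<close>; otherwise \<open>n\<close> is isolated for \<open>Z\<close>.\<close>
    define y1 where "y1 = y(n := y0 n)"
    have y1: "agree N y0 y1" "y1 n = y0 n" "y1 i = b"
      using fixn(1) [OF yN] i' by (simp_all add: y1_def b_def)
    have agU: "agree U y y1" using n_N i' by (simp add: y1_def U_def)
    have Z1: "\<not> connected (bitf Z) U y1" using Z(2) connected_cong [OF agU] by blast
    have WN: "agree N y0 u \<and> u n = y0 n" if "agree W y1 u" for u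
      using that y1 sets(4) N by (auto simp: agree_def W_def)
    have lW: "type l j u = D" if "j \<in> B - {i}" "agree W y1 u" for j u
      using tyl [of j u] WN [OF that(2)] that(1) type_commute [of l j u] B_n by auto
    have Wl: "{l} \<subseteq> I" "B - {i} \<subseteq> I" "{l} \<inter> (B - {i}) = {}" "{l} \<union> (B - {i}) = W" "W - {l} = B - {i}"
      using l' B_I by (auto simp: W_def)
    have fW: "connected f W y1"
      unfolding connected_def
    proof (intro allI impI, elim conjE)
      fix A assume A: "A \<subseteq> W" "A \<noteq> {}" "decoupled f A (W - A) y1"
      have AI: "A \<subseteq> I" "W - A \<subseteq> I" "A \<inter> (W - A) = {}" "A \<union> (W - A) = W" using A(1) sets(8) by auto
      have cross: "type p q u = 0" if "p \<in> A" "q \<in> W - A" "agree W y1 u" for p q u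
        using A(3) that unfolding decoupled_f_iff [OF AI(1-3)] AI(4) by blast
      show "A = W"
      proof (rule ccontr)
        assume "A \<noteq> W"
        then obtain q where q: "q \<in> W - A" using A(1) by blast
        obtain p where p: "p \<in> A" using A(2) by blast
        show False
        proof (cases "l \<in> A")
          case True
          then have "q \<in> B - {i}" using q Wl(4) by auto
          then show False using cross [OF True q agree_refl] lW [OF _ agree_refl] D_0 by simp
        next
          case False
          then have pB: "p \<in> B - {i}" using p A(1) Wl(4) by auto
          have "l \<in> W - A" using False by (simp add: W_def)
          then have "type p l y1 = 0" by (rule cross [OF p _ agree_refl])
          moreover have "type l p y1 = D" by (rule lW [OF pB agree_refl])
          moreover have "l \<noteq> p" using p False by blast
          ultimately show False using type_commute [of l p y1] D_0 by simp
        qed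
      qed
    qed
    have "decoupled (bitf D) {l} (W - {l}) y1"
      unfolding Wl(5) decoupled_bit_iff [OF Wl(1-3) D_0] Wl(4) using lW by auto
    moreover have "W \<noteq> {l}" using j0 B_n(2) [OF j0(1)] by (auto simp: W_def)
    ultimately have "\<not> connected (bitf D) W y1"
      using connectedD [of "bitf D" W y1 "{l}"] by (auto simp: W_def)
    then have ZW: "connected (bitf Z) W y1"
      by (rule split_unique [OF sets(8) fW D_0 _ Z(1) False])
    have "decoupled (bitf Z) W {n} y1"
      using connected_insert [OF ZW sets(4,6)] Z1 sets(5) by auto
    then have "decoupled (bitf Z) W {n} y1" and mod: "module_at W n y1"
      using connected_module [OF sets(8) nI sets(4) Z(1) ZW] by blast+
    have subW: "{n} \<subseteq> I" "W \<inter> {n} = {}" "W \<union> {n} = U" using nI sets(4,5) by auto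
    have nW: "type k n u = type k' n u'" if "k \<in> W" "k' \<in> W" "agree U y1 u" "agree U y1 u'" for k k' u u'
    proof -
      have "agree (insert n W) y1 u" "agree (insert n W) y1 u'" using that(3,4) sets(5) by simp_all
      then show ?thesis by (rule module_type [OF mod that(1,2) sets(4,8)])
    qed
    have "connected f V y" by (rule connected_bit_imp_f [OF V [folded V_def] sets(7) D_0])
    have Vn: "{n} \<subseteq> I" "V - {n} \<subseteq> I" "{n} \<inter> (V - {n}) = {}" "{n} \<union> (V - {n}) = V"
      using sets(1,7) nI by auto
    have "j0 \<in> V" "j0 \<noteq> n" using j0 n_B by (auto simp: V_def)
    then have "V \<noteq> {n}" by blast
    then have "\<not> decoupled f {n} (V - {n}) y"
      using connectedD [OF \<open>connected f V y\<close>, of "{n}"] sets(1) by blast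
    then obtain j u0 where j: "j \<in> V - {n}" "agree V y u0" "type n j u0 \<noteq> 0"
      unfolding decoupled_f_iff [OF Vn(1-3)] Vn(4) by blast
    have jW: "j \<in> W" "j \<noteq> n" using j(1) by (auto simp: V_def W_def)
    have "V \<subseteq> U" using sets(3) by blast
    then have u0: "agree U y1 u0" using j(2) agU by (meson agree_mono agree_sym agree_trans)
    have "type j n u0 = 0 \<or> type j n u0 = Z"
      using \<open>decoupled (bitf Z) W {n} y1\<close> jW(1) u0
      unfolding decoupled_bit_iff [OF sets(8) subW(1,2) Z(1)] subW(3) by blast
    then have "type j n u0 = Z"
      using j(3) type_commute [OF jW(2), of u0] by simp
    then have nZ: "type k n u = Z" if "k \<in> W" "agree N y0 u" "u i = b" for k u
    proof -
      have "agree U y1 u" using toU [OF that(2,3)] agU by (meson agree_sym agree_trans)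
      then show ?thesis using nW [OF that(1) jW(1) _ u0] \<open>type j n u0 = Z\<close> by simp
    qed
    have lWm: "l \<in> W" by (simp add: W_def)
    have opts: "(type i n u = Z \<and> type l n u = Z) \<or>
        (\<forall>v. agree {i, l, n} u v \<longrightarrow> type i n v = D \<and> type i l v = D)" if u: "agree N y0 u" for u
    proof -
      define u1 where "u1 = u(n := y0 n)"
      have t1: "type i l u1 = D" using tyl [OF i'(1) fixn(1) [OF u]] by (simp add: u1_def)
      have t2: "type l n (u(i := b)) = Z" by (rule nZ [OF lWm fixn(2) [OF u]]) simp
      have ag: "agree {i, l, n} u1 (u(i := b))" "agree {i, l, n} u1 u"
        by (auto simp: agree_def u1_def)
      have toU1: "agree {i, l, n} u1 v" if "agree {i, l, n} u v" for v
        by (rule agree_trans [OF ag(2) that])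
      have ne: "type i l u1 \<noteq> 0" "type l n (u(i := b)) \<noteq> 0" "type i l u1 \<noteq> type l n (u(i := b))"
        unfolding t1 t2 using D_0 Z(1) False by simp_all
      from two_types [OF i'(4) l'(4) nI i'(3,2) l'(2) ag(1) ne, unfolded t1 t2]
      show ?thesis
      proof
        assume "\<forall>z. agree {i, l, n} u1 z \<longrightarrow> type l n z = Z \<and> type i n z = Z \<and>
          type i l z \<noteq> Z \<and> (\<exists>v. type i l (z(n := v)) \<noteq> type i l z)"
        then show ?thesis using ag(2) by blast
      next
        assume "\<forall>z. agree {i, l, n} u1 z \<longrightarrow> type i l z = D \<and> type i n z = D \<and>
          type l n z \<noteq> D \<and> (\<exists>v. type l n (z(i := v)) \<noteq> type l n z)"
        then show ?thesis using toU1 by blast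
      qed
    qed
    show False
    proof (cases "\<exists>u. agree N y0 u \<and> type i n u = D")
      case True
      then obtain u1 where u1: "agree N y0 u1" "type i n u1 = D" by blast
      have inD: "type i n u = Z \<or> type i n u = D" if "agree N y0 u" for u
        using opts [OF that] agree_refl by blast
      have stepB: "type i n v = D \<and> type i j v = D"
        if j: "j \<in> B" "j \<noteq> i" and u: "agree N y0 u" "type i n u = D" and v: "agree {i, n, j} u v" for j u v
      proof -
        have jj: "j \<in> W" "j \<noteq> n" "j \<in> I" using j B_n by (auto simp: W_def)
        have "type j n (u(i := b)) = Z" by (rule nZ [OF jj(1) fixn(2) [OF u(1)]]) simp
        then have t: "type n j (u(i := b)) = Z" using type_commute [OF jj(2)] by simp
        have ag: "agree {i, n, j} u (u(i := b))" by simp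
        have ne: "i \<noteq> j" "n \<noteq> j" "type i n u \<noteq> 0" "type n j (u(i := b)) \<noteq> 0"
            "type i n u \<noteq> type n j (u(i := b))"
          unfolding t u(2) using j(2) jj(2) D_0 Z(1) False by simp_all
        from two_types [OF i'(4) nI jj(3) i'(2) ne(1,2) ag ne(3-5), unfolded t u(2)]
        show ?thesis
        proof
          assume nested: "\<forall>z. agree {i, n, j} u z \<longrightarrow> type n j z = Z \<and> type i j z = Z \<and>
            type i n z \<noteq> Z \<and> (\<exists>v. type i n (z(j := v)) \<noteq> type i n z)"
          then obtain w where w: "type i n (u(j := w)) \<noteq> type i n u" using agree_refl by blast
          have "agree {i, n, j} u (u(j := w))" by simp
          then have "type i n (u(j := w)) \<noteq> Z" using nested by blast
          moreover have "agree N y0 (u(j := w))" using u(1) B_n(4) [OF j(1)] by simp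
          ultimately have "type i n (u(j := w)) = D" using inD by blast
          then show ?thesis using w u(2) by simp
        next
          assume "\<forall>z. agree {i, n, j} u z \<longrightarrow> type i n z = D \<and> type i j z = D \<and>
            type n j z \<noteq> D \<and> (\<exists>v. type n j (z(i := v)) \<noteq> type n j z)"
          then show ?thesis using v by blast
        qed
      qed
      have all: "type i n u = D" if "agree N u1 u" for u
        using finite_N that
      proof (induction rule: agree_induct)
        case base
        then show ?case by (rule u1)
      next
        case (step u m a)
        have u: "agree N y0 u" using u1(1) step.hyps(2) agree_trans by blast
        have "type i n (u(m := a)) = D"
        proof -
          consider "m = n" | "m = i" | "m = l" | "m \<in> B" "m \<noteq> i" using step.hyps(1) N by auto
          then show ?thesis
          proof cases
            case 1
            then show ?thesis using step.IH i'(2) by simp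
          next
            case 2
            then show ?thesis using step.IH i'(2) by simp
          next
            case 3
            then have "agree {i, l, n} u (u(m := a))" by simp
            then show ?thesis using opts [OF u] step.IH False by auto
          next
            case 4
            then have "agree {i, n, m} u (u(m := a))" by simp
            then show ?thesis using stepB [OF 4 u step.IH] by blast
          qed
        qed
        then show ?case by (simp add: fun_upd_def)
      qed
      have allD: "type i n u = D" if "agree N y0 u" for u
        using all that u1(1) agree_sym agree_trans by blast
      show False
      proof (rule not_isolated [OF i'(5) D_0])
        fix k u assume k: "k \<in> N" "k \<noteq> i" and "agree N x u"
        then have u: "agree N y0 u" using agree_N by blast
        consider "k = n" | "k = l" | "k \<in> B" using k N by auto
        then have "type i k u = D"
        proof cases
          case 1
          then show ?thesis using allD [OF u] by simp
        next
          case 2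
          then show ?thesis using opts [OF u] allD [OF u] False agree_refl by auto
        next
          case 3
          then show ?thesis using stepB [OF _ k(2) u allD [OF u] agree_refl] by blast
        qed
        then show "type i k u = 0 \<or> type i k u = D" by simp
      qed
    next
      case no: False
      then have both: "type i n u = Z" "type l n u = Z" if "agree N y0 u" for u
        using opts [OF that] that agree_refl by blast+
      show False
      proof (rule not_isolated [OF n_N Z(1)])
        fix k u assume k: "k \<in> N" "k \<noteq> n" and "agree N x u"
        then have u: "agree N y0 u" using agree_N by blast
        consider "k = i" | "k = l" | "k \<in> B" "k \<noteq> i" using k N by auto
        then show "type n k u = 0 \<or> type n k u = Z"
        proof cases
          case 1
          then show ?thesis using both [OF u] type_commute [of n k] k by simp
        next
          case 2
          then show ?thesis using both [OF u] type_commute [of n k] k by simp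
        next
          case 3
          show ?thesis
          proof (rule ccontr)
            assume neq: "\<not> ?thesis"
            have kW: "k \<in> W" using 3 by (simp add: W_def)
            have "type k n (u(i := b)) = Z" by (rule nZ [OF kW fixn(2) [OF u]]) simp
            then have "type n k (u(i := b)) = Z" using type_commute [of n k] k by simp
            then have "type n i u = type n k u + Z"
              using type_changes(1) [of n k i u "u(i := b)" u] neq Z(1) nI i' B_n [OF 3(1)] 3 by auto
            moreover have "type n i u = Z" using both(1) [OF u] type_commute [of n i] i' by simp
            ultimately have "type n k u = 0" by simp
            then show False using neq by simp
          qed
        qed
      qed
    qed
  qed
qed

end

section \<open>Existence of a splitting\<close>

context maximal_pair
begin

text \<open>
  A pair with first component of the largest size gives the situation studied above: enlarge
  \<open>insert l B\<close> to all variables but one; then \<open>B\<close> cannot grow, and so it becomes a component.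
\<close>

lemma card_pair_less:
  assumes "pair B l y D"
  shows "card B \<noteq> \<beta>"
proof
  assume card_B: "card B = \<beta>"
  have p: "B \<subseteq> N" "B \<noteq> {}" "l \<in> N" "l \<notin> B" "agree N x y" "D \<noteq> 0" "connected (bitf D) B y"
    and ty: "\<And>b z. b \<in> B \<Longrightarrow> agree (insert l B) y z \<Longrightarrow> type b l z = D"
    using assms by (auto simp: pair_def)
  have BI: "B \<subseteq> I" "{l} \<subseteq> I" "B \<inter> {l} = {}" using p N_I by auto
  have finB: "finite B" using p(1) by (rule finite_subN)
  define V where "V = insert l B"
  have VN: "V \<subseteq> N" using p(1,3) by (simp add: V_def)
  have card_V: "card V = Suc \<beta>" using finB p(4) card_B by (simp add: V_def)
  have "card B + 2 \<le> card N" using assms by (rule pair_card)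
  then have V_less: "\<beta> < card V" "card V < card N" using card_V card_B by simp_all
  obtain b where b: "b \<in> B" using p(2) by blast
  have "type b l y = D" by (rule ty [OF b agree_refl])
  then have "\<not> decoupled f B {l} y"
    unfolding decoupled_f_iff [OF BI] using b p(6) agree_refl by blast
  from connected_insert [OF connected_bit_imp_f [OF p(7) BI(1) p(6)] p(4,2) this]
  have fV: "connected f V y" by (simp add: V_def)
  have "V - B = {l}" using p(4) by (auto simp: V_def)
  then have "decoupled (bitf D) B (V - B) y" using pair_decoupled [OF assms] by simp
  moreover have "B \<noteq> V" "B \<subseteq> V" using p(4) by (auto simp: V_def)
  ultimately have DV: "\<not> connected (bitf D) V y"
    using connectedD [of "bitf D" V y B] p(2) by blast
  have "V \<noteq> {}" by (simp add: V_def)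
  from extend_colour [OF VN p(5) fV p(6) DV V_less this]
  obtain n y' where n: "n \<in> N - V" and y': "agree (N - V) y y'" "shifted f V y y'"
    and conn: "connected f (N - {n}) y'" "\<not> connected (bitf D) (N - {n}) y'"
    by blast
  have xy': "agree N x y'" by (rule agree_trans [OF p(5) agree_mono [OF y'(1)]]) blast
  have "shifted f B y y'"
    by (rule shifted_mono [OF y'(2)]) (use y'(1) in \<open>auto simp: V_def agree_def\<close>)
  then obtain c where "\<And>u. f (patch B u y') = f (patch B u y) + c" by (auto simp: shifted_def)
  then have "shifted (bitf D) B y y'" unfolding shifted_def by (intro exI [of _ "pr D c"]) (simp add: pr_add)
  then have BD: "connected (bitf D) B y'" using connected_shifted p(7) by blast
  have sub: "N - {n} \<subseteq> N" "B \<subseteq> N - {n}" "b \<in> N - {n}" using n p(1) b by (auto simp: V_def)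
  obtain K where K: "K \<subseteq> N - {n}" "b \<in> K" "decoupled (bitf D) K (N - {n} - K) y'" "connected (bitf D) K y'"
    by (rule connected_component [OF finite_subN [OF sub(1)] sub(3)])
  have "decoupled (bitf D) (B \<inter> K) (B - (B \<inter> K)) y'"
    by (rule decoupled_mono [OF K(3)]) (use sub(2) in auto)
  then have "B \<inter> K = B"
    using connectedD [OF BD, of "B \<inter> K"] b K(2) by blast
  then have BK: "B \<subseteq> K" by blast
  have "K \<noteq> {}" using K(2) by blast
  from component_small [OF sub(1) xy' conn(1) p(6) conn(2) K(1) this K(3,4)]
  have "card K \<le> card B" using card_B by simp
  with BK have "B = K" by (rule card_seteq [OF finite_subN [OF order_trans [OF K(1) sub(1)]]])
  have "l \<in> N - {n}" using n p(3) by (auto simp: V_def)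
  then have "B \<noteq> N - {n}" using p(4) by blast
  then interpret largest_module f I N x \<beta> B n y' D
    using p(1,6) card_B n xy' conn(1) K(3,4) \<open>B = K\<close> by unfold_locales (auto simp: V_def)
  show False by (rule contradiction)
qed

end

context counterexample
begin

lemma impossible: False
proof -
  obtain i j y where ij: "i \<in> N" "j \<in> N" "i \<noteq> j" "agree N x y" "type i j y \<noteq> 0"
    by (rule other_colour [of K1]) (simp_all add: zero_k4_def)
  define D where "D = type i j y"
  have ty: "type b j z = D" if b: "b \<in> {i}" and z: "agree (insert j {i}) y z" for b z
  proof -
    have "insert j {i} = {i, j}" by blast
    with z have "agree {i, j} y z" by simp
    then have "type i j y = type i j z" by (rule type_cong [OF ij(3)])
    moreover have "b = i" using b by blast
    ultimately show ?thesis unfolding D_def by simp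
  qed
  have "D \<noteq> 0" using ij(5) by (simp add: D_def)
  then have "pair {i} j y D"
    unfolding pair_def using ij(1-4) ty by auto
  moreover have "card {i} = 1" by simp
  ultimately have ex: "\<exists>B l y D. pair B l y D \<and> card B = 1" by blast
  have bound: "\<forall>k. (\<exists>B l y D. pair B l y D \<and> card B = k) \<longrightarrow> k \<le> card N"
    using pair_card add_leD1 by blast
  from ex_has_greatest_nat [of "\<lambda>k. \<exists>B l y D. pair B l y D \<and> card B = k" 1 "\<lambda>k. k" "Suc (card N)"]
  obtain \<beta> where \<beta>: "\<exists>B l y D. pair B l y D \<and> card B = \<beta>"
      "\<And>k. \<exists>B l y D. pair B l y D \<and> card B = k \<Longrightarrow> k \<le> \<beta>"
    using ex bound le_imp_less_Suc by blast
  interpret maximal_pair f I N x \<beta>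
    by unfold_locales (use \<beta>(2) in blast)
  show False using \<beta>(1) card_pair_less by blast
qed

end

context quasigroup4
begin

theorem exists_splitting:
  assumes "V \<subseteq> I" "2 \<le> card V"
  shows "\<exists>P. P \<noteq> 0 \<and> \<not> connected (bitf P) V x"
  using assms
proof (induction "card V" arbitrary: V x rule: less_induct)
  case less
  note V = less.prems
  have finV: "finite V" using V(1) by (rule finite_subI)
  consider "card V = 2" | "card V = 3" | "4 \<le> card V" using V(2) by linarith
  then show ?case
  proof cases
    case 1
    then obtain i j where ij: "V = {i, j}" "i \<noteq> j" by (auto simp: card_2_iff)
    have I: "{i} \<subseteq> I" "{j} \<subseteq> I" "{i} \<inter> {j} = {}" "{i} \<union> {j} = V" using V(1) ij by auto
    define P where "P = (if type i j x = 0 then K1 else type i j x)"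
    have P: "P \<noteq> 0" by (simp add: P_def zero_k4_def)
    have "decoupled (bitf P) {i} {j} x"
      unfolding decoupled_bit_iff [OF I(1-3) P] I(4) unfolding ij(1)
      using type_cong [OF ij(2), of x] by (auto simp: P_def)
    moreover have "V - {i} = {j}" "{i} \<subseteq> V" "{i} \<noteq> V" using ij by auto
    ultimately have "\<not> connected (bitf P) V x" using connectedD [of "bitf P" V x "{i}"] by auto
    then show ?thesis using P by blast
  next
    case 2
    then obtain i j k where ijk: "V = {i, j, k}" "i \<noteq> j" "i \<noteq> k" "j \<noteq> k"
      by (auto simp: card_3_iff)
    have I: "i \<in> I" "j \<in> I" "k \<in> I" using V(1) ijk(1) by auto
    obtain P where P: "P \<noteq> 0"
      "decoupled (bitf P) {j, k} {i} x \<or> decoupled (bitf P) {i, k} {j} x \<or> decoupled (bitf P) {i, j} {k} x"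
      by (rule cube_decoupled [OF I ijk(2-4)])
    have split: "\<not> connected (bitf P) V x" if "decoupled (bitf P) A (V - A) x" "A \<subseteq> V" "A \<noteq> {}" "A \<noteq> V" for A
      using connectedD [of "bitf P" V x A] that by blast
    have "V - {j, k} = {i}" "V - {i, k} = {j}" "V - {i, j} = {k}" "{j, k} \<subseteq> V" "{i, k} \<subseteq> V" "{i, j} \<subseteq> V"
      "{j, k} \<noteq> V" "{i, k} \<noteq> V" "{i, j} \<noteq> V" using ijk by auto
    then have "\<not> connected (bitf P) V x"
      using P(2) split [of "{j, k}"] split [of "{i, k}"] split [of "{i, j}"] by auto
    then show ?thesis using P(1) by blast
  next
    case 3
    show ?thesis
    proof (rule ccontr)
      assume "\<not> ?thesis"
      then interpret counterexample f I V x
        using V(1) 3 less.hyps by unfold_locales blast+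
      show False by (rule impossible)
    qed
  qed
qed

end

section \<open>Quasigroups on lists of numbers\<close>

lemma map_upt_in_nlists: "(\<And>i. i < n \<Longrightarrow> g i \<in> S) \<Longrightarrow> map g [0..<n] \<in> nlists n S"
  by (rule nlistsI) auto

text \<open>
  The condition for the position 0 of \<open>zs\<close> only asks for the value of \<open>f\<close>, which exists by closure.
\<close>

lemma quasigroup_iff:
  "quasigroup S n f \<longleftrightarrow> (\<forall>xs\<in>nlists n S. f xs \<in> S) \<and>
     (\<forall>i<n. \<forall>xs\<in>nlists n S. \<forall>c\<in>S. \<exists>!z. z \<in> S \<and> f (xs[i := z]) = c)"
proof -
  have pred: "graph_pred f (c # xs) = 1 \<longleftrightarrow> f xs = c" for c xs
    by (auto simp: graph_pred_def)
  have zs: "(\<forall>zs\<in>nlists (n + 1) S. P zs) \<longleftrightarrow> (\<forall>c\<in>S. \<forall>xs\<in>nlists n S. P (c # xs))" for P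
    by (auto simp: in_nlists_Suc_iff)
  have idx: "(\<forall>i\<le>n. P i) \<longleftrightarrow> P 0 \<and> (\<forall>i<n. P (Suc i))" for P :: "nat \<Rightarrow> bool"
    by (metis Suc_le_eq le0 not0_implies_Suc)
  have swap: "(\<forall>c\<in>S. \<forall>xs\<in>nlists n S. P c xs) \<longleftrightarrow> (\<forall>xs\<in>nlists n S. \<forall>c\<in>S. P c xs)" for P
    by blast
  have "\<exists>!z. z \<in> S \<and> f xs = z" if "\<forall>xs\<in>nlists n S. f xs \<in> S" "xs \<in> nlists n S" for xs
    using that by blast
  then have "(\<forall>xs\<in>nlists n S. f xs \<in> S) \<Longrightarrow> \<forall>xs\<in>nlists n S. \<forall>c\<in>S. \<exists>!z. z \<in> S \<and> f xs = z"
    by simp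
  then show ?thesis
    unfolding quasigroup_def idx zs list_update.simps nat.case pred swap by argo
qed

lemma quasigroup_in: "quasigroup S n f \<Longrightarrow> xs \<in> nlists n S \<Longrightarrow> f xs \<in> S"
  unfolding quasigroup_iff by blast

definition to_k4 :: "nat \<Rightarrow> k4" where
  "to_k4 z = (if z = 0 then K0 else if z = 1 then K1 else if z = 2 then K2 else K3)"

fun of_k4 :: "k4 \<Rightarrow> nat" where
  "of_k4 K0 = 0"
| "of_k4 K1 = 1"
| "of_k4 K2 = 2"
| "of_k4 K3 = 3"

lemma to_of_k4 [simp]: "to_k4 (of_k4 v) = v"
  by (cases v) (simp_all add: to_k4_def)

lemma of_to_k4 [simp]: "z \<in> Sigma4 \<Longrightarrow> of_k4 (to_k4 z) = z"
  by (auto simp: to_k4_def Sigma4_def)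

lemma of_k4_in [simp]: "of_k4 v \<in> Sigma4"
  by (cases v) (simp_all add: Sigma4_def)

lemma finite_Sigma4 [simp]: "finite Sigma4"
  by (simp add: Sigma4_def)

text \<open>
  An \<open>n\<close>-ary operation on lists corresponds to a function of variables indexed by all natural numbers,
  of which those from \<open>n\<close> on are set to \<open>0\<close>.
\<close>

definition context_of :: "nat \<Rightarrow> nat list \<Rightarrow> nat \<Rightarrow> k4" where
  "context_of n xs i = (if i < n then to_k4 (xs ! i) else 0)"

definition table :: "nat \<Rightarrow> ((nat \<Rightarrow> k4) \<Rightarrow> k4) \<Rightarrow> nat list \<Rightarrow> nat" where
  "table n F xs = of_k4 (F (context_of n xs))"

lemma context_of_upd:
  "xs \<in> nlists n S \<Longrightarrow> i < n \<Longrightarrow> context_of n (xs[i := z]) = (context_of n xs)(i := to_k4 z)"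
  by (auto simp: context_of_def fun_eq_iff)

lemma quasigroup_table:
  assumes "quasigroup4 F {0..<n}"
  shows "quasigroup Sigma4 n (table n F)"
  unfolding quasigroup_iff
proof (intro conjI ballI allI impI)
  interpret quasigroup4 F "{0..<n}" by (rule assms)
  fix i xs c assume i: "i < n" and xs: "xs \<in> nlists n Sigma4" and c: "c \<in> Sigma4"
  have I: "i \<in> {0..<n}" using i by simp
  obtain v where v: "F ((context_of n xs)(i := v)) = to_k4 c" by (rule surj_upd [OF I])
  show "\<exists>!z. z \<in> Sigma4 \<and> table n F (xs[i := z]) = c"
  proof (rule ex1I [of _ "of_k4 v"])
    show "of_k4 v \<in> Sigma4 \<and> table n F (xs[i := of_k4 v]) = c"
      using v c by (simp add: table_def context_of_upd [OF xs i])
    fix z assume z: "z \<in> Sigma4 \<and> table n F (xs[i := z]) = c"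
    then have "F ((context_of n xs)(i := to_k4 z)) = to_k4 c"
      by (auto simp: table_def context_of_upd [OF xs i])
    then have "F ((context_of n xs)(i := to_k4 z)) = F ((context_of n xs)(i := v))" using v by simp
    then have "to_k4 z = v" by (simp only: inj_upd [OF I])
    then show "z = of_k4 v" using z of_to_k4 by metis
  qed
qed (simp add: table_def)

lemma table_of_quasigroup:
  assumes "quasigroup Sigma4 n f"
  obtains F where "quasigroup4 F {0..<n}" "\<And>xs. xs \<in> nlists n Sigma4 \<Longrightarrow> f xs = table n F xs"
proof -
  define F where "F x = to_k4 (f (map (\<lambda>i. of_k4 (x i)) [0..<n]))" for x
  have in_nl: "map (\<lambda>i. of_k4 (x i)) [0..<n] \<in> nlists n Sigma4" for x
    by (rule map_upt_in_nlists) simp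
  have bijF: "bij (\<lambda>v. F (x(i := v)))" if i: "i \<in> {0..<n}" for x i
  proof (rule bijI)
    define ys where "ys = map (\<lambda>i. of_k4 (x i)) [0..<n]"
    have ys: "ys \<in> nlists n Sigma4" unfolding ys_def by (rule in_nl)
    have upd: "map (\<lambda>j. of_k4 ((x(i := v)) j)) [0..<n] = ys[i := of_k4 v]" for v
      by (rule nth_equalityI) (simp_all add: ys_def nth_list_update)
    have F: "F (x(i := v)) = to_k4 (f (ys[i := of_k4 v]))" for v
      unfolding F_def upd ..
    have ex1: "\<exists>!z. z \<in> Sigma4 \<and> f (ys[i := z]) = c" if "c \<in> Sigma4" for c
      using assms i ys that unfolding quasigroup_iff by simp
    have S: "f (ys[i := of_k4 v]) \<in> Sigma4" for v
      by (rule quasigroup_in [OF assms]) (metis in_nl upd)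
    show "inj (\<lambda>v. F (x(i := v)))"
    proof (rule injI)
      fix v w assume "F (x(i := v)) = F (x(i := w))"
      then have "f (ys[i := of_k4 v]) = f (ys[i := of_k4 w])"
        unfolding F using S of_to_k4 by metis
      then have "of_k4 v = of_k4 w" using ex1 [OF S [of w]] of_k4_in by blast
      then show "v = w" using to_of_k4 by metis
    qed
    show "surj (\<lambda>v. F (x(i := v)))"
      unfolding surj_def
    proof
      fix c
      obtain z where z: "z \<in> Sigma4" "f (ys[i := z]) = of_k4 c" using ex1 [OF of_k4_in [of c]] by blast
      then have "c = F (x(i := to_k4 z))" unfolding F by simp
      then show "\<exists>v. c = F (x(i := v))" by blast
    qed
  qed
  have "quasigroup4 F {0..<n}"
  proof (rule quasigroup4.intro)
    show "finite {0..<n}" by simp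
    show "bij (\<lambda>v. F (x(i := v)))" if "i \<in> {0..<n}" for x i using that by (rule bijF)
  qed
  moreover have "f xs = table n F xs" if xs: "xs \<in> nlists n Sigma4" for xs
  proof -
    note len = nlistsE_length [OF xs] and S = nlistsE_nth_in [OF xs]
    have "map (\<lambda>i. of_k4 (context_of n xs i)) [0..<n] = xs"
    proof (rule nth_equalityI)
      fix i assume "i < length (map (\<lambda>i. of_k4 (context_of n xs i)) [0..<n])"
      then have "i < n" by simp
      then show "map (\<lambda>i. of_k4 (context_of n xs i)) [0..<n] ! i = xs ! i"
        using S by (simp add: context_of_def)
    qed (simp add: len)
    then show ?thesis using of_to_k4 [OF quasigroup_in [OF assms xs]] by (simp add: table_def F_def)
  qed
  ultimately show thesis by (rule that)
qed

section \<open>A module gives a reduction\<close>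

lemma permutation_onto_prefix:
  assumes "K \<subseteq> {0..<n}"
  obtains \<sigma> where "\<sigma> permutes {0..<n}" "\<sigma> ` {0..<card K} = K"
proof -
  have fin: "finite K" using assms finite_subset by blast
  obtain \<alpha> where \<alpha>: "bij_betw \<alpha> {0..<card K} K" using ex_bij_betw_nat_finite [OF fin] by blast
  have le: "card K \<le> n" using card_mono [OF _ assms] by simp
  have "card {card K..<n} = card ({0..<n} - K)" using fin assms by (simp add: card_Diff_subset)
  then obtain \<gamma> where \<gamma>: "bij_betw \<gamma> {card K..<n} ({0..<n} - K)"
    using finite_same_card_bij [of "{card K..<n}" "{0..<n} - K"] by auto
  define \<sigma> where "\<sigma> i = (if i < card K then \<alpha> i else if i < n then \<gamma> i else i)" for i
  have 1: "bij_betw \<sigma> {0..<card K} K"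
    using \<alpha> by (subst bij_betw_cong [of _ _ \<alpha>]) (simp_all add: \<sigma>_def)
  have 2: "bij_betw \<sigma> {card K..<n} ({0..<n} - K)"
    using \<gamma> by (subst bij_betw_cong [of _ _ \<gamma>]) (simp_all add: \<sigma>_def)
  have "{0..<card K} \<union> {card K..<n} = {0..<n}" "K \<union> ({0..<n} - K) = {0..<n}" using le assms by auto
  then have "bij_betw \<sigma> {0..<n} {0..<n}" using bij_betw_combine [OF 1 2] by simp
  then have "\<sigma> permutes {0..<n}"
    by (rule bij_imp_permutes) (use le in \<open>simp add: \<sigma>_def\<close>)
  then show thesis using bij_betw_imp_surj_on [OF 1] by (rule that)
qed

text \<open>
  If every other variable sees the variables in \<open>K\<close> as one, then \<open>F\<close> factors through the retract \<open>G\<close>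
  to \<open>K\<close>: the outer operation feeds its first argument back into \<open>F\<close> through a single variable \<open>p\<close>
  in \<open>K\<close>, after a permutation \<open>s\<close> that makes the retract to \<open>p\<close> the identity.
\<close>

lemma module_reducible:
  assumes Q: "quasigroup4 F {0..<n}" and K: "K \<subseteq> {0..<n}" "2 \<le> card K" "card K < n"
    and mod: "\<And>k z. k \<in> {0..<n} - K \<Longrightarrow> agree {0..<n} (\<lambda>_. 0) z \<Longrightarrow> quasigroup4.module_at F K k z"
  shows "permutably_reducible Sigma4 n (table n F)"
proof -
  interpret quasigroup4 F "{0..<n}" by (rule Q)
  define m where "m = card K"
  obtain \<sigma> where \<sigma>: "\<sigma> permutes {0..<n}" "\<sigma> ` {0..<m} = K"
    unfolding m_def by (rule permutation_onto_prefix [OF K(1)])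
  have m: "2 \<le> m" "m < n" using K(2,3) by (simp_all add: m_def)
  have \<sigma>_n: "\<sigma> i < n \<longleftrightarrow> i < n" for i using permutes_in_image [OF \<sigma>(1), of i] by simp
  have \<sigma>_K: "\<sigma> i \<in> K \<longleftrightarrow> i < m" for i
    using inj_image_mem_iff [OF permutes_inj [OF \<sigma>(1)], of i "{0..<m}"] \<sigma>(2) by simp
  have \<sigma>_eq: "\<sigma> i = \<sigma> j \<longleftrightarrow> i = j" for i j
    using permutes_inj [OF \<sigma>(1)] by (simp add: inj_eq)
  define \<rho> where "\<rho> = inv \<sigma>"
  have \<rho>: "\<rho> (\<sigma> i) = i" "\<sigma> (\<rho> i) = i" for i
    unfolding \<rho>_def using permutes_inverses [OF \<sigma>(1)] by simp_all
  define p where "p = \<sigma> 0"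
  have p: "p \<in> K" "p \<in> {0..<n}" using \<sigma>_K [of 0] \<sigma>_n [of 0] m by (simp_all add: p_def)
  define z0 where "z0 = (\<lambda>_ :: nat. 0 :: k4)"
  define r where "r = (\<lambda>t. F (z0(p := t)))"
  have r: "bij r" unfolding r_def by (rule bij [OF p(2)])
  define s where "s = inv r"
  have s: "bij s" "r (s c) = c" for c
    using bij_imp_bij_inv [OF r] surj_f_inv_f [OF bij_is_surj [OF r]] by (simp_all add: s_def)
  define cG where "cG u = (\<lambda>j. if j \<in> K then u (\<rho> j) else 0)" for u :: "nat \<Rightarrow> k4"
  define cH where "cH w = (\<lambda>j. if j \<in> K then (z0(p := s (w 0))) j
    else if j < n then w (\<rho> j - m + 1) else 0)" for w :: "nat \<Rightarrow> k4"
  define G where "G u = F (cG u)" for u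
  define H where "H w = F (cH w)" for w
  have "quasigroup4 G {0..<m}"
  proof
    fix i u assume "i \<in> {0..<m}"
    then have "\<sigma> i \<in> K" "\<sigma> i \<in> {0..<n}" using \<sigma>_K \<sigma>_n m(2) by auto
    moreover have "cG (u(i := v)) = (cG u)(\<sigma> i := v)" if "\<sigma> i \<in> K" for v
      using that \<rho> by (auto simp: cG_def fun_eq_iff)
    ultimately show "bij (\<lambda>v. G (u(i := v)))" unfolding G_def using bij by simp
  qed simp
  then have G: "quasigroup Sigma4 m (table m G)" by (rule quasigroup_table)
  have "quasigroup4 H {0..<n - m + 1}"
  proof
    fix i w assume i: "i \<in> {0..<n - m + 1}"
    show "bij (\<lambda>v. H (w(i := v)))"
    proof (cases "i = 0")
      case True
      have "cH (w(0 := v)) = (cH w)(p := s v)" for v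
        using p(1) by (auto simp: cH_def fun_eq_iff)
      then have "(\<lambda>v. H (w(i := v))) = (\<lambda>t. F ((cH w)(p := t))) \<circ> s"
        unfolding True by (auto simp: H_def)
      then show ?thesis using bij_comp [OF s(1) bij [OF p(2)]] by simp
    next
      case False
      define j where "j = \<sigma> (i + m - 1)"
      have j: "j \<notin> K" "j < n" using False i by (auto simp: j_def \<sigma>_K \<sigma>_n)
      have "cH (w(i := v)) = (cH w)(j := v)" for v
      proof
        fix k
        have \<open>k = j\<close> if "\<rho> k - m + 1 = i" "k \<notin> K"
        proof -
          have "\<not> \<rho> k < m" using that(2) \<sigma>_K [of "\<rho> k"] \<rho>(2) by simp
          then have "\<rho> k = i + m - 1" using that(1) by simp
          then show ?thesis unfolding j_def using \<rho>(2) by metis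
        qed
        then have k: "\<rho> k - m + 1 \<noteq> i" if "k \<noteq> j" "k \<notin> K" using that by blast
        have "\<rho> j - m + 1 = i" using False by (simp add: j_def \<rho>)
        moreover have "i \<noteq> 0" "0 \<noteq> i" using False by simp_all
        ultimately show "cH (w(i := v)) k = ((cH w)(j := v)) k"
          using j k by (cases "k = j"; cases "k \<in> K") (simp_all add: cH_def)
      qed
      then show ?thesis unfolding H_def using bij [of j "cH w"] j(2) by simp
    qed
  qed simp
  then have H: "quasigroup Sigma4 (n - m + 1) (table (n - m + 1) H)" by (rule quasigroup_table)
  have "table n F xs = table (n - m + 1) H
      (table m G (map (\<lambda>i. xs ! \<sigma> i) [0..<m]) # map (\<lambda>i. xs ! \<sigma> i) [m..<n])" for xs
  proof -
    define x where "x = context_of n xs"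
    define q where "q = patch K x z0"
    define q' where "q' = z0(p := s (F q))"
    let ?gs = "map (\<lambda>i. xs ! \<sigma> i) [0..<m]"
    let ?hs = "table m G ?gs # map (\<lambda>i. xs ! \<sigma> i) [m..<n]"
    have "cG (context_of m ?gs) j = q j" for j
    proof (cases "j \<in> K")
      case True
      then have "\<rho> j < m" using \<sigma>_K [of "\<rho> j"] \<rho>(2) by simp
      then show ?thesis using True K(1) \<rho>(2) by (auto simp: cG_def q_def patch_def x_def context_of_def)
    qed (simp add: cG_def q_def patch_def z0_def)
    then have "cG (context_of m ?gs) = q" by blast
    then have Gq: "to_k4 (table m G ?gs) = F q" by (simp add: table_def G_def)
    have "cH (context_of (n - m + 1) ?hs) j = patch ({0..<n} - K) x q' j" for j
    proof -
      consider "j \<in> K" | "j \<notin> K" "j < n" | "j \<notin> K" "\<not> j < n" by blast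
      then show ?thesis
      proof cases
        case 1
        then show ?thesis using Gq by (simp add: cH_def q'_def patch_def context_of_def)
      next
        case 2
        have "\<rho> j < n" "\<not> \<rho> j < m" using 2 \<sigma>_K [of "\<rho> j"] \<sigma>_n [of "\<rho> j"] \<rho>(2) by simp_all
        then have "\<rho> j - m < n - m" "m + (\<rho> j - m) = \<rho> j" by simp_all
        then show ?thesis
          using 2 \<rho>(2) by (simp add: cH_def q'_def patch_def context_of_def x_def)
      next
        case 3
        then have "j \<noteq> p" using p(1) by blast
        then show ?thesis using 3 by (simp add: cH_def q'_def patch_def z0_def)
      qed
    qed
    then have cH: "cH (context_of (n - m + 1) ?hs) = patch ({0..<n} - K) x q'" by blast
    have xq: "patch ({0..<n} - K) x q = x"
      using K(1) by (auto simp: patch_def q_def x_def context_of_def z0_def fun_eq_iff)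
    have qq': "agree K q q'" using p(1) by (auto simp: agree_def q_def q'_def patch_def)
    have "F q = F q'" using s(2) by (simp add: q'_def r_def)
    have "F (patch ({0..<n} - K) x q) = F (patch ({0..<n} - K) x q')"
    proof (rule module_moves [OF _ _ _ qq' \<open>F q = F q'\<close>])
      fix b z assume b: "b \<in> {0..<n} - K" and z: "agree ({0..<n} - K) q z"
      have "agree {0..<n} (\<lambda>_. 0) z"
        using z K(1) by (auto simp: agree_def q_def patch_def z0_def)
      then show "module_at K b z" by (rule mod [OF b])
    qed auto
    then show ?thesis unfolding table_def [of _ F] table_def [of _ H] H_def cH xq by (simp add: x_def)
  qed
  then show ?thesis
    unfolding permutably_reducible_def using m G H \<sigma>(1) by blast
qed

section \<open>An additive bit gives semilinearity\<close>

lemma isotope_quasigroup: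
  assumes "quasigroup S n f" and \<tau>: "\<And>i. i \<le> n \<Longrightarrow> \<tau> i permutes S"
  shows "quasigroup S n (\<lambda>ys. \<tau> 0 (f (map (\<lambda>i. \<tau> (i + 1) (ys ! i)) [0..<n])))"
  unfolding quasigroup_iff
proof (intro conjI ballI allI impI)
  have in_S: "map (\<lambda>i. \<tau> (i + 1) (ys ! i)) [0..<n] \<in> nlists n S" if "ys \<in> nlists n S" for ys
    by (rule map_upt_in_nlists) (use that permutes_in_image [OF \<tau>] nlistsE_nth_in in simp)
  show "\<tau> 0 (f (map (\<lambda>i. \<tau> (i + 1) (ys ! i)) [0..<n])) \<in> S" if "ys \<in> nlists n S" for ys
    using quasigroup_in [OF assms(1) in_S [OF that]] permutes_in_image [OF \<tau> [of 0]] by simp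
  fix i ys c assume i: "i < n" and ys: "ys \<in> nlists n S" and c: "c \<in> S"
  have len: "length ys = n" using ys by simp
  define xs where "xs = map (\<lambda>i. \<tau> (i + 1) (ys ! i)) [0..<n]"
  have upd: "map (\<lambda>j. \<tau> (j + 1) (ys[i := z] ! j)) [0..<n] = xs[i := \<tau> (i + 1) z]" for z
    by (rule nth_equalityI) (use i in \<open>simp_all add: xs_def nth_list_update len\<close>)
  have \<tau>i: "\<tau> (i + 1) permutes S" and \<tau>0: "\<tau> 0 permutes S" using \<tau> i by simp_all
  obtain c' where c': "c' \<in> S" "c = \<tau> 0 c'"
    using c permutes_image [OF \<tau>0] by blast
  have xs: "xs \<in> nlists n S" unfolding xs_def by (rule in_S [OF ys])
  have "\<exists>!z. z \<in> S \<and> f (xs[i := z]) = c'"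
    using assms(1) i xs c'(1) unfolding quasigroup_iff by blast
  then obtain w where w: "w \<in> S" "f (xs[i := w]) = c'"
    and unique: "\<And>z. z \<in> S \<Longrightarrow> f (xs[i := z]) = c' \<Longrightarrow> z = w" by blast
  obtain z where z: "z \<in> S" "w = \<tau> (i + 1) z"
    using w(1) permutes_image [OF \<tau>i] by blast
  show "\<exists>!z. z \<in> S \<and> \<tau> 0 (f (map (\<lambda>j. \<tau> (j + 1) (ys[i := z] ! j)) [0..<n])) = c"
    unfolding upd
  proof (rule ex1I)
    show "z \<in> S \<and> \<tau> 0 (f (xs[i := \<tau> (i + 1) z])) = c" using z w c' by simp
    fix z' assume z': "z' \<in> S \<and> \<tau> 0 (f (xs[i := \<tau> (i + 1) z'])) = c"
    then have "f (xs[i := \<tau> (i + 1) z']) = c'"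
      unfolding c'(2) using injD [OF permutes_inj [OF \<tau>0]] by blast
    then have "\<tau> (i + 1) z' = \<tau> (i + 1) z"
      using unique z' permutes_in_image [OF \<tau>i] z(2) by blast
    then show "z' = z" using injD [OF permutes_inj [OF \<tau>i]] by blast
  qed
qed

text \<open>
  The labels 0 and 1 are given to the elements of \<open>A\<close>, and the labels 2 and 3 to the others.
\<close>

lemma class_permutation:
  assumes "A \<subseteq> Sigma4" "card A = 2"
  obtains \<tau> where "\<tau> permutes Sigma4" "\<And>z. z \<in> Sigma4 \<Longrightarrow> l_bit (\<tau> z) = (if z \<in> A then 0 else 1)"
proof -
  have fin: "finite A" using assms(1) finite_Sigma4 finite_subset by blast
  have "card (Sigma4 - A) = 2" using fin assms by (simp add: card_Diff_subset Sigma4_def)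
  then obtain \<beta> where \<beta>: "bij_betw \<beta> (Sigma4 - A) {2, 3 :: nat}"
    using finite_same_card_bij [of "Sigma4 - A" "{2, 3 :: nat}"] by auto
  obtain \<alpha> where \<alpha>: "bij_betw \<alpha> A {0, 1 :: nat}"
    using finite_same_card_bij [of A "{0, 1 :: nat}"] fin assms(2) by auto
  define \<tau> where "\<tau> z = (if z \<in> A then \<alpha> z else if z \<in> Sigma4 then \<beta> z else z)" for z
  have 1: "bij_betw \<tau> A {0, 1}"
    using \<alpha> by (subst bij_betw_cong [of _ _ \<alpha>]) (simp_all add: \<tau>_def)
  have 2: "bij_betw \<tau> (Sigma4 - A) {2, 3}"
    using \<beta> by (subst bij_betw_cong [of _ _ \<beta>]) (simp_all add: \<tau>_def)
  have "A \<union> (Sigma4 - A) = Sigma4" "{0, 1} \<union> {2, 3} = Sigma4" using assms(1) by (auto simp: Sigma4_def)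
  then have "bij_betw \<tau> Sigma4 Sigma4" using bij_betw_combine [OF 1 2] by simp
  then have "\<tau> permutes Sigma4"
    by (rule bij_imp_permutes) (use assms(1) in \<open>auto simp: \<tau>_def\<close>)
  moreover have "l_bit (\<tau> z) = (if z \<in> A then 0 else 1)" if "z \<in> Sigma4" for z
  proof (cases "z \<in> A")
    case True
    then have "\<tau> z \<in> {0, 1}" using bij_betwE [OF 1] by blast
    then show ?thesis using True by (auto simp: l_bit_def)
  next
    case False
    then have "\<tau> z \<in> {2, 3}" using bij_betwE [OF 2] that by blast
    then show ?thesis using False by (auto simp: l_bit_def)
  qed
  ultimately show thesis by (rule that)
qed

lemma card_level_set:
  assumes "bij g" "P \<noteq> 0"
  shows "card {z \<in> Sigma4. pr P (g (to_k4 z)) = pr P c} = 2"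
proof -
  have "{z \<in> Sigma4. pr P (g (to_k4 z)) = pr P c} = of_k4 ` g -` {v. pr P v = pr P c}"
  proof
    show "{z \<in> Sigma4. pr P (g (to_k4 z)) = pr P c} \<subseteq> of_k4 ` g -` {v. pr P v = pr P c}"
    proof
      fix z assume z: "z \<in> {z \<in> Sigma4. pr P (g (to_k4 z)) = pr P c}"
      then have "z = of_k4 (to_k4 z)" by simp
      then show "z \<in> of_k4 ` g -` {v. pr P v = pr P c}" by (rule image_eqI) (use z in simp)
    qed
  qed auto
  moreover have "inj of_k4" by (rule inj_on_inverseI [of _ to_k4]) simp
  moreover have "card (g -` {v. pr P v = pr P c}) = card {v. pr P v = pr P c}"
    by (rule card_vimage_inj) (use assms(1) in \<open>auto simp: bij_is_inj bij_is_surj\<close>)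
  ultimately show ?thesis
    using k4_class_card [OF assms(2) pr_range] by (simp add: card_image inj_on_subset)
qed

lemma sum_parity:
  fixes b :: "nat \<Rightarrow> nat" and P :: k4
  shows "(\<Sum>i<n. if even (b i) then 0 else P) = (if even (\<Sum>i<n. b i) then 0 else P)"
  by (induction n) auto

text \<open>
  The variables are split off one at a time by \<open>decoupled_sum\<close>.
\<close>

lemma sum_of_unary:
  fixes h :: "(nat \<Rightarrow> 'a::zero) \<Rightarrow> 'g::ab_group_add"
  assumes no: "\<And>i j y. i < n \<Longrightarrow> j < n \<Longrightarrow> i \<noteq> j \<Longrightarrow> agree {0..<n} (\<lambda>_. 0) y \<Longrightarrow> \<not> interact h i j y"
    and x: "\<And>i. i \<ge> n \<Longrightarrow> x i = 0"
  shows "h x = h (\<lambda>_. 0) + (\<Sum>i<n. h ((\<lambda>_. 0)(i := x i)) - h (\<lambda>_. 0))"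
proof -
  define z :: "nat \<Rightarrow> 'a" where "z = (\<lambda>_. 0)"
  have "h (patch {0..<k} x z) = h z + (\<Sum>i<k. h (z(i := x i)) - h z)" if "k \<le> n" for k
    using that
  proof (induction k)
    case 0
    then show ?case by (simp add: patch_def)
  next
    case (Suc k)
    have "decoupled h {0..<k} {k} z"
      unfolding decoupled_def
    proof (intro ballI allI impI)
      fix i j y assume ij: "i \<in> {0..<k}" "j \<in> {k}" and y: "agree ({0..<k} \<union> {k}) z y"
      have "agree {0..<n} z y" by (rule agree_mono [OF y]) (use Suc.prems in auto)
      then show "\<not> interact h i j y" using no ij Suc.prems by (simp add: z_def)
    qed
    from decoupled_sum [OF _ _ _ this agree_refl, of "z(k := x k)" x z]
    have "h (patch {0..<k} x z) + h (patch {0..<k} z (z(k := x k))) =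
        h (patch {0..<k} x (z(k := x k))) + h (patch {0..<k} z z)"
      by simp
    moreover have "patch {0..<k} z (z(k := x k)) = z(k := x k)"
      by (auto simp: patch_def fun_eq_iff)
    moreover have "patch {0..<k} x (z(k := x k)) = patch {0..<Suc k} x z"
      by (auto simp: patch_def fun_eq_iff less_Suc_eq)
    moreover have "patch {0..<k} z z = z" by simp
    ultimately have "h (patch {0..<Suc k} x z) = h (patch {0..<k} x z) + (h (z(k := x k)) - h z)"
      by (simp only: add_diff_eq) (metis add_diff_cancel_right')
    then show ?case using Suc.IH Suc.prems by (simp add: add.assoc fun_upd_def)
  qed
  from this [OF order_refl] show ?thesis
    using patch_eq [of "{0..<n}" z x] x by (simp add: agree_def z_def)
qed

text \<open>
  Relabel the values of each argument and of the result so that \<open>l_bit\<close> tells whether \<open>bitf P\<close> differs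
  from its value at the origin. The bits of the arguments then sum up to the bit of the result modulo 2.
\<close>

lemma additive_semilinear:
  assumes Q: "quasigroup4 F {0..<n}" and P: "P \<noteq> 0"
    and no: "\<And>i j y. i < n \<Longrightarrow> j < n \<Longrightarrow> i \<noteq> j \<Longrightarrow> agree {0..<n} (\<lambda>_. 0) y \<Longrightarrow>
      \<not> interact (\<lambda>x. pr P (F x)) i j y"
  shows "semilinear n (table n F)"
proof -
  interpret quasigroup4 F "{0..<n}" by (rule Q)
  define f where "f = table n F"
  have qf: "quasigroup Sigma4 n f" unfolding f_def by (rule quasigroup_table [OF Q])
  define z where "z = (\<lambda>_ :: nat. 0 :: k4)"
  define A where "A i = (if i = 0 then {v \<in> Sigma4. pr P (id (to_k4 v)) = pr P (F z)}
    else {v \<in> Sigma4. pr P (F (z(i - 1 := to_k4 v))) = pr P (F z)})" for i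
  have "\<exists>\<tau>. \<tau> permutes Sigma4 \<and> (\<forall>v\<in>Sigma4. l_bit (\<tau> v) = (if v \<in> A i then 0 else 1))" if "i \<le> n" for i
  proof -
    have "card (A i) = 2"
    proof (cases "i = 0")
      case True
      then show ?thesis using card_level_set [OF bij_id P] by (simp add: A_def)
    next
      case False
      then have "bij (\<lambda>v. F (z(i - 1 := v)))" using bij that by simp
      from card_level_set [OF this P] show ?thesis using False by (simp add: A_def)
    qed
    moreover have "A i \<subseteq> Sigma4" by (auto simp: A_def)
    ultimately show ?thesis using class_permutation by metis
  qed
  then obtain \<tau> where \<tau>: "\<And>i. i \<le> n \<Longrightarrow> \<tau> i permutes Sigma4"
    and l: "\<And>i v. i \<le> n \<Longrightarrow> v \<in> Sigma4 \<Longrightarrow> l_bit (\<tau> i v) = (if v \<in> A i then 0 else 1)"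
    by metis
  have parity: "even (l_bit (\<tau> 0 (f xs)) + (\<Sum>i<n. l_bit (\<tau> (i + 1) (xs ! i))))"
    if xs: "xs \<in> nlists n Sigma4" for xs
  proof -
    define x where "x = context_of n xs"
    have b: "bitf P (z(i := x i)) + bitf P z = (if even (l_bit (\<tau> (i + 1) (xs ! i))) then 0 else P)"
      if "i < n" for i
    proof -
      have "xs ! i \<in> Sigma4" using xs that by (rule nlistsE_nth_in)
      then have "l_bit (\<tau> (i + 1) (xs ! i)) = (if bitf P (z(i := x i)) = bitf P z then 0 else 1)"
        using l that by (simp add: A_def x_def context_of_def)
      then show ?thesis
        using pr_range [of P "F (z(i := x i))"] pr_range [of P "F z"] by auto
    qed
    have "bitf P x = bitf P z + (\<Sum>i<n. bitf P (z(i := x i)) - bitf P z)"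
      unfolding z_def by (rule sum_of_unary [OF no]) (simp_all add: x_def context_of_def)
    then have "bitf P x = bitf P z + (\<Sum>i<n. bitf P (z(i := x i)) + bitf P z)" by simp
    also have "(\<Sum>i<n. bitf P (z(i := x i)) + bitf P z) =
        (\<Sum>i<n. if even (l_bit (\<tau> (i + 1) (xs ! i))) then 0 else P)"
      by (rule sum.cong [OF refl]) (use b in simp)
    also have "\<dots> = (if even (\<Sum>i<n. l_bit (\<tau> (i + 1) (xs ! i))) then 0 else P)"
      by (rule sum_parity)
    finally have sum: "bitf P x = bitf P z \<longleftrightarrow> even (\<Sum>i<n. l_bit (\<tau> (i + 1) (xs ! i)))"
      using P by (auto simp: k4_eq_iff [of "pr P (F z) + P"] ac_simps)
    have "to_k4 (f xs) = F x" by (simp add: f_def table_def x_def)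
    then have "l_bit (\<tau> 0 (f xs)) = (if bitf P x = bitf P z then 0 else 1)"
      using l [of 0 "f xs"] quasigroup_in [OF qf xs] by (simp add: A_def)
    then show ?thesis unfolding sum by simp
  qed
  define \<tau>' where "\<tau>' i = (if i = 0 then \<tau> 0 else inv (\<tau> i))" for i :: nat
  define g where "g = (\<lambda>ys. \<tau>' 0 (f (map (\<lambda>i. \<tau>' (i + 1) (ys ! i)) [0..<n])))"
  have \<tau>': "\<tau>' i permutes Sigma4" if "i \<le> n" for i
    using \<tau> [OF that] permutes_inv by (auto simp: \<tau>'_def)
  have qg: "quasigroup Sigma4 n g"
    unfolding g_def by (rule isotope_quasigroup [OF qf \<tau>'])
  have "graph_pred g zs \<le> L_pred zs" if zs: "zs \<in> nlists (n + 1) Sigma4" for zs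
  proof -
    obtain c ys where c: "zs = c # ys" and ys: "ys \<in> nlists n Sigma4"
      using zs by (auto simp: in_nlists_Suc_iff)
    define xs where "xs = map (\<lambda>i. \<tau>' (i + 1) (ys ! i)) [0..<n]"
    have xs: "xs \<in> nlists n Sigma4"
      unfolding xs_def
      by (rule map_upt_in_nlists) (use ys permutes_in_image [OF \<tau>'] nlistsE_nth_in in simp)
    have "\<tau> (i + 1) (xs ! i) = ys ! i" if "i < n" for i
      using that permutes_inverses [OF \<tau> [of "i + 1"]] by (simp add: xs_def \<tau>'_def)
    then have "(\<Sum>i<n. l_bit (\<tau> (i + 1) (xs ! i))) = (\<Sum>i<n. l_bit (ys ! i))" by simp
    also have "\<dots> = sum_list (map l_bit ys)"
      using ys by (simp add: sum_list_sum_nth atLeast0LessThan)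
    finally have "even (l_bit (g ys) + sum_list (map l_bit ys))"
      using parity [OF xs] by (simp add: g_def xs_def \<tau>'_def)
    then have "(l_bit (g ys) + sum_list (map l_bit ys) + 1) mod 2 = 1" by presburger
    then show ?thesis by (simp add: c graph_pred_def L_pred_def)
  qed
  then have "standardly_semilinear n g" using qg by (simp add: standardly_semilinear_def)
  moreover have "isotopic Sigma4 n f g"
    unfolding isotopic_def
  proof (intro exI [of _ \<tau>] conjI ballI allI impI)
    fix xs assume xs: "xs \<in> nlists n Sigma4"
    have "map (\<lambda>i. \<tau>' (i + 1) (map (\<lambda>i. \<tau> (i + 1) (xs ! i)) [0..<n] ! i)) [0..<n] = xs"
      by (rule nth_equalityI)
        (use nlistsE_length [OF xs] permutes_inverses [OF \<tau>] in \<open>simp_all add: \<tau>'_def\<close>)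
    then show "f xs = inv (\<tau> 0) (g (map (\<lambda>i. \<tau> (i + 1) (xs ! i)) [0..<n]))"
      using permutes_inverses [OF \<tau> [of 0]] by (simp add: g_def \<tau>'_def)
  qed (rule \<tau>)
  ultimately show ?thesis
    using qf unfolding semilinear_def f_def by blast
qed

lemma permutably_reducible_cong:
  assumes "\<And>xs. xs \<in> nlists n S \<Longrightarrow> f xs = f' xs"
  shows "permutably_reducible S n f = permutably_reducible S n f'"
  unfolding permutably_reducible_def using assms by simp

lemma semilinear_cong:
  assumes "\<And>xs. xs \<in> nlists n Sigma4 \<Longrightarrow> f xs = f' xs" "quasigroup Sigma4 n f"
  shows "semilinear n f' \<Longrightarrow> semilinear n f"
  unfolding semilinear_def isotopic_def using assms by simp

theorem theorem3p1:
  fixes n :: nat and f :: "nat list \<Rightarrow> nat"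
  assumes "quasigroup Sigma4 n f"
  shows "permutably_reducible Sigma4 n f \<or> semilinear n f"
proof -
  obtain F where Q: "quasigroup4 F {0..<n}" and F: "\<And>xs. xs \<in> nlists n Sigma4 \<Longrightarrow> f xs = table n F xs"
    using table_of_quasigroup [OF assms] by blast
  interpret quasigroup4 F "{0..<n}" by (rule Q)
  define z where "z = (\<lambda>_ :: nat. 0 :: k4)"
  obtain P where P: "P \<noteq> 0" "2 \<le> n \<Longrightarrow> \<not> connected (bitf P) {0..<n} z"
  proof (cases "2 \<le> n")
    case True
    then show thesis using exists_splitting [of "{0..<n}" z] that by auto
  next
    case False
    have "K1 \<noteq> 0" by (simp add: zero_k4_def)
    then show thesis using that False by blast
  qed
  show ?thesis
  proof (cases "\<forall>i<n. decoupled (bitf P) {i} ({0..<n} - {i}) z")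
    case True
    have "\<not> interact (bitf P) i j y" if "i < n" "j < n" "i \<noteq> j" "agree {0..<n} (\<lambda>_. 0) y" for i j y
    proof -
      have "{i} \<union> ({0..<n} - {i}) = {0..<n}" using that(1) by auto
      then show ?thesis using True that unfolding decoupled_def z_def by simp
    qed
    then have "semilinear n (table n F)" by (rule additive_semilinear [OF Q P(1)])
    then show ?thesis using semilinear_cong [OF F assms] by simp
  next
    case False
    then obtain i where i: "i < n" "\<not> decoupled (bitf P) {i} ({0..<n} - {i}) z" by blast
    have "i \<in> {0..<n}" using i(1) by simp
    then obtain K where K: "K \<subseteq> {0..<n}" "i \<in> K" "decoupled (bitf P) K ({0..<n} - K) z" "connected (bitf P) K z"
      by (rule connected_component [OF finite_I])
    have finK: "finite K" using K(1) by (rule finite_subI)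
    have "{i} \<subset> K" using K(2,3) i(2) by blast
    from psubset_card_mono [OF finK this] have two: "2 \<le> card K" by simp
    have le: "card K \<le> n" using card_mono [OF finite_I K(1)] by simp
    then have "K \<noteq> {0..<n}" using P(2) two K(4) by auto
    then have "K \<subset> {0..<n}" using K(1) by blast
    from psubset_card_mono [OF finite_I this] have less: "card K < n" by simp
    have "module_at K k y" if "k \<in> {0..<n} - K" "agree {0..<n} (\<lambda>_. 0) y" for k y
      by (rule component_module [OF order_refl K(1) P(1) K(3,4) that(1)]) (use that(2) in \<open>simp add: z_def\<close>)
    then have "permutably_reducible Sigma4 n (table n F)"
      by (rule module_reducible [OF Q K(1) two less])
    then show ?thesis using permutably_reducible_cong [of n Sigma4 f "table n F"] F by blast
  qed
qed

end
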